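(* Suppose $\phi\in L^\infty(\mathbb{T})$ is unimodular (i.e. $|\phi|=1$ almost everywhere). The distance (in the $L^\infty$ norm) from $\phi$ to $\mathfrak{A}$ is strictly less than one if and only if $T^\alpha_\phi$ is left invertible for each $\alpha\in\mathbb{B}^2$. Likewise, the distance from $\phi$ to the set of invertible elements of $\mathfrak{A}$ is strictly less than one if and only if $T^\alpha_\phi$ is invertible for each $\alpha\in\mathbb{B}^2$.
   Context: $\mathbb{D}$ is the open unit disk, $\mathbb{T}$ the unit circle with normalized measure $\frac{dt}{2\pi}$, and $L^p=L^p(\mathbb{T})$. For $p=2,\infty$, $H^p$ denotes the Hardy space of the disk, identified via boundary values with the subspace of $L^p$ of functions with vanishing negative Fourier coefficients. The Neil algebra is $\mathfrak{A}=\{f\in H^\infty: f'(0)=0\}$. An element $\psi\in\mathfrak{A}$ is invertible in $\mathfrak{A}$ if it does not vanish in $\mathbb{D}$ and $\psi^{-1}=1/\psi\in\mathfrak{A}$. Let $\mathbb{B}^2=\{(a,b)\in\mathbb{C}^2:|a|^2+|b|^2=1\}$. For $\alpha=(a,b)\in\mathbb{B}^2$ let $H^2_\alpha=\{f\in H^2: f(0)\,b=f'(0)\,a\}$, a closed subspace of $H^2$, and let $V_\alpha:H^2_\alpha\to L^2$ be the inclusion. For $\phi\in L^\infty$, $M_\phi:L^2\to L^2$ is $M_\phi f=\phi f$, and $T^\alpha_\phi=V_\alpha^*M_\phi V_\alpha:H^2_\alpha\to H^2_\alpha$ is the Toeplitz operator with symbol $\phi$ with respect to $\alpha$. Left invertible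 and invertible mean having a bounded left inverse and a bounded two-sided inverse, respectively. *)

theory Defs
  imports "HOL-Analysis.Analysis" "HOL-Probability.Essential_Supremum"
begin

section \<open>The circle, Fourier coefficients, and the extension to the disk\<close>

text \<open>Normalized arc length \<open>dt / 2\<pi>\<close>; the underlying space is the unit circle itself.\<close>

definition circle :: "complex measure" where
  "circle = distr (uniform_measure lborel {0..2 * pi}) (restrict_space borel (sphere 0 1)) cis"

definition fourier :: "(complex \<Rightarrow> complex) \<Rightarrow> int \<Rightarrow> complex" where
  "fourier f n = (LINT z|circle. f z * cnj (z powi n))"

text \<open>The holomorphic function on the open unit disk whose boundary values are \<open>f\<close>, when the
  negative Fourier coefficients of \<open>f\<close> vanish: the Taylor coefficients at \<open>0\<close> are the Fourier
  coefficients of the boundary values. Only meaningful for \<open>z\<close> in the disk.\<close>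

definition disk_ext :: "(complex \<Rightarrow> complex) \<Rightarrow> complex \<Rightarrow> complex" where
  "disk_ext f z = (\<Sum>n. fourier f (int n) * z ^ n)"


section \<open>\<open>L\<^sup>\<infinity>\<close> and the Neil algebra\<close>

text \<open>Elements of \<open>L\<^sup>\<infinity>\<close> are represented by functions; all notions below depend only on the
  almost-everywhere class.\<close>

definition Linf_norm :: "(complex \<Rightarrow> complex) \<Rightarrow> ereal" where
  "Linf_norm f = esssup circle (\<lambda>z. ereal (cmod (f z)))"

definition Linf :: "(complex \<Rightarrow> complex) set" where
  "Linf = {f \<in> borel_measurable circle. Linf_norm f < \<infinity>}"

definition Hinf :: "(complex \<Rightarrow> complex) set" where
  "Hinf = {f \<in> Linf. \<forall>n<0. fourier f n = 0}"

definition neil_algebra :: "(complex \<Rightarrow> complex) set" where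
  "neil_algebra = {f \<in> Hinf. deriv (disk_ext f) 0 = 0}"

definition neil_invertible :: "(complex \<Rightarrow> complex) set" where
  "neil_invertible = {\<psi> \<in> neil_algebra. (\<forall>z\<in>ball 0 1. disk_ext \<psi> z \<noteq> 0) \<and>
     (\<exists>\<eta>\<in>neil_algebra. \<forall>z\<in>ball 0 1. disk_ext \<eta> z = 1 / disk_ext \<psi> z)}"

definition Linf_dist :: "(complex \<Rightarrow> complex) \<Rightarrow> (complex \<Rightarrow> complex) set \<Rightarrow> ereal" where
  "Linf_dist \<phi> A = (INF \<psi>\<in>A. Linf_norm (\<lambda>z. \<phi> z - \<psi> z))"


section \<open>The Hilbert space \<open>L\<^sup>2\<close>\<close>

definition sq_integrable :: "(complex \<Rightarrow> complex) set" where
  "sq_integrable = {f \<in> borel_measurable circle. integrable circle (\<lambda>z. (cmod (f z))\<^sup>2)}"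

lemma sq_integrable_mult:
  assumes "f \<in> sq_integrable" "g \<in> sq_integrable"
  shows "integrable circle (\<lambda>z. f z * cnj (g z))"
proof (rule Bochner_Integration.integrable_bound[where f = "\<lambda>z. (cmod (f z))\<^sup>2 + (cmod (g z))\<^sup>2"])
  show "integrable circle (\<lambda>z. (cmod (f z))\<^sup>2 + (cmod (g z))\<^sup>2)"
    using assms by (auto simp: sq_integrable_def)
  show "(\<lambda>z. f z * cnj (g z)) \<in> borel_measurable circle"
    using assms by (auto simp: sq_integrable_def intro!: borel_measurable_times
        borel_measurable_continuous_on[where f = cnj] continuous_intros)
  have "cmod (f z) * cmod (g z) \<le> (cmod (f z))\<^sup>2 + (cmod (g z))\<^sup>2" for z
    using sum_squares_bound[of "cmod (f z)" "cmod (g z)"]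
      mult_nonneg_nonneg[OF norm_ge_zero[of "f z"] norm_ge_zero[of "g z"]]
    unfolding mult.assoc by linarith
  then show "AE z in circle. norm (f z * cnj (g z)) \<le> norm ((cmod (f z))\<^sup>2 + (cmod (g z))\<^sup>2)"
    by (simp add: norm_mult)
qed

lemma sq_integrable_zero: "(\<lambda>_. 0) \<in> sq_integrable"
  by (simp add: sq_integrable_def)

lemma sq_integrable_cmult: "f \<in> sq_integrable \<Longrightarrow> (\<lambda>z. c * f z) \<in> sq_integrable"
  by (auto simp: sq_integrable_def norm_mult power_mult_distrib)

lemma sq_integrable_add:
  assumes "f \<in> sq_integrable" "g \<in> sq_integrable"
  shows "(\<lambda>z. f z + g z) \<in> sq_integrable"
proof -
  have "integrable circle (\<lambda>z. (cmod (f z))\<^sup>2 + (cmod (g z))\<^sup>2 + 2 * Re (f z * cnj (g z)))"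
    using assms sq_integrable_mult[OF assms] unfolding sq_integrable_def
    by (intro Bochner_Integration.integrable_add integrable_mult_right integrable_Re) auto
  moreover have "(cmod (f z))\<^sup>2 + (cmod (g z))\<^sup>2 + 2 * Re (f z * cnj (g z)) = (cmod (f z + g z))\<^sup>2"
    for z
    by (simp add: cmod_power2) (simp add: power2_eq_square algebra_simps)
  ultimately have "integrable circle (\<lambda>z. (cmod (f z + g z))\<^sup>2)"
    by (simp only:)
  then show ?thesis
    using assms by (auto simp: sq_integrable_def intro: borel_measurable_add)
qed

lemma Linf_mult_sq_integrable:
  assumes "\<phi> \<in> Linf" "f \<in> sq_integrable"
  shows "(\<lambda>z. \<phi> z * f z) \<in> sq_integrable"
proof -
  have m: "\<phi> \<in> borel_measurable circle" "f \<in> borel_measurable circle"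
    using assms by (auto simp: Linf_def sq_integrable_def)
  obtain C where C: "AE z in circle. cmod (\<phi> z) \<le> C"
  proof (cases "Linf_norm \<phi>")
    case (real r)
    have "AE z in circle. ereal (cmod (\<phi> z)) \<le> Linf_norm \<phi>"
      unfolding Linf_norm_def by (rule esssup_AE)
    then show ?thesis using real that by simp
  next
    case PInf
    then show ?thesis using assms by (simp add: Linf_def)
  next
    case MInf
    have "AE z in circle. ereal (cmod (\<phi> z)) \<le> Linf_norm \<phi>"
      unfolding Linf_norm_def by (rule esssup_AE)
    then have "AE z in circle. cmod (\<phi> z) \<le> 0" using MInf by (auto elim!: eventually_mono)
    then show ?thesis using that by blast
  qed
  have "integrable circle (\<lambda>z. (cmod (\<phi> z * f z))\<^sup>2)"
  proof (rule Bochner_Integration.integrable_bound[where f = "\<lambda>z. C\<^sup>2 * (cmod (f z))\<^sup>2"])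
    show "integrable circle (\<lambda>z. C\<^sup>2 * (cmod (f z))\<^sup>2)"
      using assms by (simp add: sq_integrable_def)
    show "(\<lambda>z. (cmod (\<phi> z * f z))\<^sup>2) \<in> borel_measurable circle" using m by measurable
    show "AE z in circle. norm ((cmod (\<phi> z * f z))\<^sup>2) \<le> norm (C\<^sup>2 * (cmod (f z))\<^sup>2)"
      using C by eventually_elim
        (auto simp: norm_mult power_mult_distrib abs_mult intro!: mult_right_mono power_mono)
  qed
  then show ?thesis using m by (simp add: sq_integrable_def)
qed

definition L2_rel :: "(complex \<Rightarrow> complex) \<Rightarrow> (complex \<Rightarrow> complex) \<Rightarrow> bool" where
  "L2_rel f g \<longleftrightarrow> f \<in> sq_integrable \<and> g \<in> sq_integrable \<and> (AE z in circle. f z = g z)"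

lemma part_equivp_L2_rel: "part_equivp L2_rel"
proof (rule part_equivpI)
  show "\<exists>f. L2_rel f f" using sq_integrable_zero by (auto simp: L2_rel_def)
  show "symp L2_rel" by (auto simp: symp_def L2_rel_def eq_commute)
  show "transp L2_rel"
  proof (rule transpI)
    fix f g h assume "L2_rel f g" "L2_rel g h"
    moreover from this have "AE z in circle. f z = g z" "AE z in circle. g z = h z"
      by (auto simp: L2_rel_def)
    then have "AE z in circle. f z = h z" by eventually_elim simp
    ultimately show "L2_rel f h" by (simp add: L2_rel_def)
  qed
qed

quotient_type L2 = "complex \<Rightarrow> complex" / partial: L2_rel
  by (rule part_equivp_L2_rel)

text \<open>Inner products are linear in the first argument.\<close>

lift_definition cinner :: "L2 \<Rightarrow> L2 \<Rightarrow> complex" is "\<lambda>f g. LINT z|circle. f z * cnj (g z)"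
  unfolding L2_rel_def
proof -
  fix f f' g g'
  assume f: "f \<in> sq_integrable \<and> f' \<in> sq_integrable \<and> (AE z in circle. f z = f' z)"
    and g: "g \<in> sq_integrable \<and> g' \<in> sq_integrable \<and> (AE z in circle. g z = g' z)"
  show "(LINT z|circle. f z * cnj (g z)) = (LINT z|circle. f' z * cnj (g' z))"
  proof (rule integral_cong_AE)
    show "AE z in circle. f z * cnj (g z) = f' z * cnj (g' z)"
      using f[THEN conjunct2, THEN conjunct2] g[THEN conjunct2, THEN conjunct2]
      by eventually_elim simp
  qed (use f g sq_integrable_mult[THEN borel_measurable_integrable] in blast)+
qed

lift_definition cscale :: "complex \<Rightarrow> L2 \<Rightarrow> L2" is "\<lambda>c f z. c * f z"
  unfolding L2_rel_def by (auto intro: sq_integrable_cmult)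

instantiation L2 :: real_vector
begin

lift_definition zero_L2 :: L2 is "\<lambda>_. 0"
  by (simp add: L2_rel_def sq_integrable_zero)

lift_definition plus_L2 :: "L2 \<Rightarrow> L2 \<Rightarrow> L2" is "\<lambda>f g z. f z + g z"
  unfolding L2_rel_def by (auto intro: sq_integrable_add)

definition uminus_L2 :: "L2 \<Rightarrow> L2" where "- f = cscale (- 1) f"
definition minus_L2 :: "L2 \<Rightarrow> L2 \<Rightarrow> L2" where "f - g = f + - (g :: L2)"
definition scaleR_L2 :: "real \<Rightarrow> L2 \<Rightarrow> L2" where "scaleR r f = cscale (of_real r) f"

instance
proof
  fix f g h :: L2 and r s :: real
  show "f + g + h = f + (g + h)"
    by transfer (auto simp: L2_rel_def add.assoc intro!: sq_integrable_add)
  show "f + g = g + f"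
    by transfer (auto simp: L2_rel_def add.commute intro!: sq_integrable_add)
  show "0 + f = f" by transfer (auto simp: L2_rel_def)
  show "- f + f = 0" unfolding uminus_L2_def
    by transfer (auto simp: L2_rel_def sq_integrable_zero)
  show "f - g = f + - g" by (rule minus_L2_def)
  show "r *\<^sub>R (f + g) = r *\<^sub>R f + r *\<^sub>R g" unfolding scaleR_L2_def
    by transfer (auto simp: L2_rel_def distrib_left intro!: sq_integrable_cmult sq_integrable_add)
  show "(r + s) *\<^sub>R f = r *\<^sub>R f + s *\<^sub>R f" unfolding scaleR_L2_def
    by transfer (auto simp: L2_rel_def distrib_right
        intro!: sq_integrable_cmult[where c = "of_real r + of_real s"] sq_integrable_add
          sq_integrable_cmult)
  show "r *\<^sub>R s *\<^sub>R f = (r * s) *\<^sub>R f" unfolding scaleR_L2_def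
    by transfer (auto simp: L2_rel_def mult.assoc intro!: sq_integrable_cmult)
  show "1 *\<^sub>R f = f" unfolding scaleR_L2_def by transfer (auto simp: L2_rel_def)
qed

end

instantiation L2 :: real_inner
begin

definition inner_L2 :: "L2 \<Rightarrow> L2 \<Rightarrow> real" where "inner f g = Re (cinner f g)"
definition norm_L2 :: "L2 \<Rightarrow> real" where "norm f = sqrt (inner f (f :: L2))"
definition sgn_L2 :: "L2 \<Rightarrow> L2" where "sgn f = f /\<^sub>R norm (f :: L2)"
definition dist_L2 :: "L2 \<Rightarrow> L2 \<Rightarrow> real" where "dist f g = norm (f - g :: L2)"
definition uniformity_L2 :: "(L2 \<times> L2) filter" where
  "uniformity_L2 = (INF e\<in>{0<..}. principal {(f, g). dist f (g :: L2) < e})"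
definition open_L2 :: "L2 set \<Rightarrow> bool" where
  "open_L2 U \<longleftrightarrow> (\<forall>x\<in>U. eventually (\<lambda>(x', y). x' = x \<longrightarrow> y \<in> U) uniformity)"

instance
proof
  fix f g h :: L2 and r s :: real
  show "inner f g = inner g f" unfolding inner_L2_def
  proof transfer
    fix f g
    have "(LINT z|circle. g z * cnj (f z)) = cnj (LINT z|circle. f z * cnj (g z))"
      by (subst Bochner_Integration.integral_cnj[symmetric]) (simp add: mult.commute)
    then show "Re (LINT z|circle. f z * cnj (g z)) = Re (LINT z|circle. g z * cnj (f z))"
      by simp
  qed
  show "inner (f + g) h = inner f h + inner g h" unfolding inner_L2_def
    by transfer (auto simp: L2_rel_def distrib_right sq_integrable_mult)
  show "inner (r *\<^sub>R f) g = r * inner f g" unfolding inner_L2_def scaleR_L2_def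
    by transfer (simp add: mult.assoc)
  have sq: "f z * cnj (f z) = of_real ((cmod (f z))\<^sup>2)" for f z
    by (simp add: complex_norm_square[symmetric])
  show "0 \<le> inner f f" unfolding inner_L2_def
    by transfer (simp only: sq integral_complex_of_real Re_complex_of_real, simp)
  show "(inner f f = 0) = (f = 0)" unfolding inner_L2_def
  proof transfer
    fix f assume "L2_rel f f"
    then have f: "f \<in> sq_integrable" by (simp add: L2_rel_def)
    then have "integrable circle (\<lambda>z. (cmod (f z))\<^sup>2)" by (simp add: sq_integrable_def)
    from integral_nonneg_eq_0_iff_AE[OF this]
    have "(LINT z|circle. (cmod (f z))\<^sup>2) = 0 \<longleftrightarrow> (AE z in circle. f z = 0)" by simp
    then show "(Re (LINT z|circle. f z * cnj (f z)) = 0) = L2_rel f (\<lambda>_. 0)"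
      using f by (simp only: sq integral_complex_of_real Re_complex_of_real)
        (simp add: L2_rel_def sq_integrable_zero)
  qed
  show "norm f = sqrt (inner f f)" by (rule norm_L2_def)
  show "sgn f = f /\<^sub>R norm f" by (rule sgn_L2_def)
  show "dist f g = norm (f - g)" by (rule dist_L2_def)
qed (rule uniformity_L2_def, rule open_L2_def)

end

lift_definition L2_fourier :: "L2 \<Rightarrow> int \<Rightarrow> complex" is fourier
proof -
  fix f g assume fg: "L2_rel f g"
  have "fourier f n = fourier g n" for n
    unfolding fourier_def
  proof (rule integral_cong_AE)
    have p: "(\<lambda>z. cnj (z powi n)) \<in> borel_measurable circle"
      unfolding circle_def measurable_distr_eq1
      by (intro borel_measurable_continuous_on_restrict continuous_intros) auto
    show "(\<lambda>z. f z * cnj (z powi n)) \<in> borel_measurable circle"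
      "(\<lambda>z. g z * cnj (z powi n)) \<in> borel_measurable circle"
      using fg p by (auto simp: L2_rel_def sq_integrable_def)
    show "AE z in circle. f z * cnj (z powi n) = g z * cnj (z powi n)"
      using fg by (auto simp: L2_rel_def)
  qed
  then show "fourier f = fourier g" by (rule ext)
qed

lift_definition L2_disk_ext :: "L2 \<Rightarrow> complex \<Rightarrow> complex" is disk_ext
proof -
  fix f g assume "L2_rel f g"
  then have "fourier f = fourier g" using L2_fourier.rsp by (simp add: rel_fun_def)
  then show "disk_ext f = disk_ext g" by (simp add: disk_ext_def fun_eq_iff)
qed

text \<open>The multiplication operator; the value \<open>0\<close> for a symbol outside \<open>L\<^sup>\<infinity>\<close> is junk.\<close>

lift_definition mult_op :: "(complex \<Rightarrow> complex) \<Rightarrow> L2 \<Rightarrow> L2" is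
  "\<lambda>\<phi> f. if \<phi> \<in> Linf then (\<lambda>z. \<phi> z * f z) else (\<lambda>_. 0)"
  unfolding L2_rel_def by (auto intro: Linf_mult_sq_integrable sq_integrable_zero)


section \<open>Bounded operators on subspaces of \<open>L\<^sup>2\<close>\<close>

definition bounded_op_on :: "L2 set \<Rightarrow> (L2 \<Rightarrow> L2) \<Rightarrow> bool" where
  "bounded_op_on X S \<longleftrightarrow> (\<forall>f\<in>X. S f \<in> X) \<and>
     (\<forall>f\<in>X. \<forall>g\<in>X. S (f + g) = S f + S g) \<and> (\<forall>c. \<forall>f\<in>X. S (cscale c f) = cscale c (S f)) \<and>
     (\<exists>C. \<forall>f\<in>X. norm (S f) \<le> C * norm f)"

definition left_invertible_on :: "L2 set \<Rightarrow> (L2 \<Rightarrow> L2) \<Rightarrow> bool" where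
  "left_invertible_on X T \<longleftrightarrow> (\<exists>S. bounded_op_on X S \<and> (\<forall>f\<in>X. S (T f) = f))"

definition invertible_on :: "L2 set \<Rightarrow> (L2 \<Rightarrow> L2) \<Rightarrow> bool" where
  "invertible_on X T \<longleftrightarrow>
     (\<exists>S. bounded_op_on X S \<and> (\<forall>f\<in>X. S (T f) = f) \<and> (\<forall>f\<in>X. T (S f) = f))"

text \<open>The Hilbert space adjoint of a bounded operator \<open>A\<close> from the closed subspace \<open>X\<close> to \<open>L\<^sup>2\<close>;
  it maps \<open>L\<^sup>2\<close> to \<open>X\<close>.\<close>

definition adjoint_on :: "L2 set \<Rightarrow> (L2 \<Rightarrow> L2) \<Rightarrow> L2 \<Rightarrow> L2" where
  "adjoint_on X A g = (THE f. f \<in> X \<and> (\<forall>h\<in>X. cinner (A h) g = cinner h f))"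


section \<open>Toeplitz operators\<close>

definition H2 :: "L2 set" where
  "H2 = {f. \<forall>n<0. L2_fourier f n = 0}"

definition B2 :: "(complex \<times> complex) set" where
  "B2 = {(a, b). (cmod a)\<^sup>2 + (cmod b)\<^sup>2 = 1}"

definition H2_sub :: "complex \<times> complex \<Rightarrow> L2 set" where
  "H2_sub = (\<lambda>(a, b). {f \<in> H2. L2_disk_ext f 0 * b = deriv (L2_disk_ext f) 0 * a})"

text \<open>The inclusion of \<open>H2_sub \<alpha>\<close> into \<open>L\<^sup>2\<close> is the identity on representatives, since
  \<open>H2_sub \<alpha>\<close> is a subset of \<open>L\<^sup>2\<close>; its domain enters through \<open>adjoint_on\<close>.\<close>

definition inclusion :: "L2 \<Rightarrow> L2" where
  "inclusion f = f"

definition toeplitz :: "complex \<times> complex \<Rightarrow> (complex \<Rightarrow> complex) \<Rightarrow> L2 \<Rightarrow> L2" where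
  "toeplitz \<alpha> \<phi> = adjoint_on (H2_sub \<alpha>) inclusion \<circ> mult_op \<phi> \<circ> inclusion"

end

(* Left invertibility of all Toeplitz operators holds with a lower bound e uniform in alpha, by
   compactness of B2. For a polynomial k = f h with |f| = |h| on the circle and k'(0) = 0, choose
   alpha proportional to (f(0), f'(0)): then f lies in H2_sub alpha and z h* is orthogonal to
   H2_sub alpha, so |integral of phi k / z| <= r * integral of |k| with r = sqrt (1 - e^2).
   Such k / z span the annihilator of the Neil algebra, so by duality phi is within r of the
   algebra. Conversely, a psi in the algebra with |phi - psi| <= r < 1 maps H2_sub alpha to itself
   and Re <psi f, T f> = Re <psi f, phi f> >= (1 - r) |f|^2, which bounds T from below and makes
   the invertibility of T and of psi equivalent. *)

theory Submission
  imports Defs "HOL-Probability.Probability_Measure"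
    "HOL-Computational_Algebra.Fundamental_Theorem_Algebra"
begin

section \<open>Closed convex sets in Hilbert spaces\<close>

text \<open>All \<alpha> are needed because f comes from k and nothing controls the ratio of f(0) to
  f'(0), so any \<open>H2_sub \<alpha>\<close> may be the one containing f. The condition |f| = |h|
  on the circle makes the squared L^2 norms of f and \<open>z * cnj (h z)\<close> both equal to the
  L^1 norm of k, so that Cauchy-Schwarz in L^2 gives a bound in L^1. The value of r is Pythagoras:
  multiplication by \<phi> is isometric and T f is the projection of \<phi> f, so the part of \<phi>
  f orthogonal to \<open>H2_sub \<alpha>\<close> has norm at most sqrt (1 - e^2) |f|. Polynomials
  take the place of a general inner-outer factorization, since their linear factors are balanced by
  explicit square roots. The duality of L^1 and L^\<infinity> is carried out inside the Hilbert
  space \<open>L2\<close>, with projection onto a closed convex set as the separation theorem. To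
  pass from invertibility of T back to \<psi>, the single point \<alpha> = (1, 0) suffices:
  \<open>H2_sub (1, 0)\<close> contains 1 and its bounded elements form the Neil algebra.\<close>

lemma infdist_lessE:
  fixes x :: "'a::metric_space"
  assumes "A \<noteq> {}" "infdist x A < e"
  obtains a where "a \<in> A" "dist x a < e"
proof -
  have "(INF a\<in>A. dist x a) < e" using assms by (simp add: infdist_def)
  then have "\<exists>a\<in>A. dist x a < e" by (subst (asm) cINF_less_iff[OF assms(1)]) auto
  then show ?thesis using that by blast
qed

text \<open>Takes the role of weak compactness of bounded closed convex sets. The distances of the
  sets from 0 increase to a finite limit and midpoints stay in the larger set, so by the
  parallelogram law points of almost minimal norm form a Cauchy sequence.\<close>

lemma closed_convex_nested_Inter_nonempty:
  fixes D :: "nat \<Rightarrow> 'a::{real_inner, complete_space} set"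
  assumes closed: "\<And>n. closed (D n)" and convex: "\<And>n. convex (D n)"
    and ne: "\<And>n. D n \<noteq> {}" and dec: "decseq D" and bdd: "bounded (D 0)"
  shows "(\<Inter>n. D n) \<noteq> {}"
proof -
  define d where "d n = infdist 0 (D n)" for n
  obtain B where B: "\<And>x. x \<in> D 0 \<Longrightarrow> norm x \<le> B"
    using bdd unfolding bounded_iff by blast
  have d_le: "d n \<le> norm x" if "x \<in> D n" for x n
    using infdist_le[OF that, of 0] by (simp add: d_def)
  have "incseq d"
    unfolding d_def by (intro incseq_SucI infdist_mono ne decseqD[OF dec]) simp
  have d_bdd: "d n \<le> B" for n
  proof -
    obtain x where "x \<in> D n" using ne by blast
    moreover have "D n \<subseteq> D 0" by (intro decseqD[OF dec]) simp
    ultimately show ?thesis using d_le B by force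
  qed
  then obtain L where L: "d \<longlonglongrightarrow> L" and dL: "\<And>n. d n \<le> L"
    using incseq_convergent[OF \<open>incseq d\<close>, of B] by blast
  have "\<exists>x\<in>D n. norm x < d n + 1 / Suc n" for n
  proof -
    have "infdist 0 (D n) < d n + 1 / Suc n" by (simp add: d_def)
    then obtain x where "x \<in> D n" "dist 0 x < d n + 1 / Suc n"
      by (rule infdist_lessE[OF ne])
    then show ?thesis by auto
  qed
  then obtain x where x: "\<And>n. x n \<in> D n" "\<And>n. norm (x n) < d n + 1 / Suc n" by metis
  \<comment> \<open>Bounds the squared distance of \<open>x n\<close> and \<open>x m\<close> for m
    \<ge> n: in the parallelogram law both points have norm at most L + 1 / (n + 1), and their sum
    has norm at least 2 * \<open>d n\<close>.\<close>
  define s where "s n = 4 * (L + 1 / Suc n)\<^sup>2 - 4 * (d n)\<^sup>2" for n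
  have "s \<longlonglongrightarrow> 4 * (L + 0)\<^sup>2 - 4 * L\<^sup>2"
    unfolding s_def by (intro tendsto_intros L LIMSEQ_Suc[OF lim_1_over_n])
  then have s0: "s \<longlonglongrightarrow> 0" by simp
  have d0: "0 \<le> d n" for n by (simp add: d_def infdist_nonneg)
  have est: "(dist (x n) (x m))\<^sup>2 \<le> s n" if "n \<le> m" for n m
  proof -
    have "x m \<in> D n" using x(1)[of m] decseqD[OF dec that] by blast
    then have "(1/2) *\<^sub>R x n + (1/2) *\<^sub>R x m \<in> D n"
      using x(1)[of n] by (intro convexD[OF convex]) auto
    then have "d n \<le> norm ((1/2) *\<^sub>R x n + (1/2) *\<^sub>R x m)" by (rule d_le)
    then have "(d n)\<^sup>2 \<le> (norm ((1/2) *\<^sub>R x n + (1/2) *\<^sub>R x m))\<^sup>2"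
      using d0 by (intro power_mono) auto
    also have "\<dots> = (norm (x n + x m))\<^sup>2 / 4"
      by (simp add: scaleR_add_right[symmetric] power_divide)
    finally have 1: "4 * (d n)\<^sup>2 \<le> (norm (x n + x m))\<^sup>2" by simp
    have 2: "(norm (x n - x m))\<^sup>2 = 2 * (norm (x n))\<^sup>2 + 2 * (norm (x m))\<^sup>2 - (norm (x n + x m))\<^sup>2"
      by (simp add: power2_norm_eq_inner inner_diff inner_add inner_commute algebra_simps)
    have "norm (x n) \<le> L + 1 / Suc n" using x(2)[of n] dL[of n] by simp
    then have 3: "(norm (x n))\<^sup>2 \<le> (L + 1 / Suc n)\<^sup>2" by (intro power_mono) auto
    have "1 / real (Suc m) \<le> 1 / real (Suc n)" using that by (simp add: field_simps)
    then have "norm (x m) \<le> L + 1 / Suc n" using x(2)[of m] dL[of m] by linarith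
    then have "(norm (x m))\<^sup>2 \<le> (L + 1 / Suc n)\<^sup>2" by (intro power_mono) auto
    with 1 2 3 show ?thesis by (simp add: s_def dist_norm)
  qed
  have "Cauchy x"
  proof (rule metric_CauchyI)
    fix e :: real assume "0 < e"
    then have "0 < (e/2)\<^sup>2" by simp
    then obtain N where N: "s N < (e/2)\<^sup>2"
      using order_tendstoD(2)[OF s0] eventually_happens' by (metis sequentially_bot)
    have N2: "dist (x N) (x m) < e/2" if "N \<le> m" for m
      using est[OF that] N \<open>0 < e\<close> by (intro power2_less_imp_less[of _ "e/2"]) auto
    show "\<exists>M. \<forall>m\<ge>M. \<forall>n\<ge>M. dist (x m) (x n) < e"
      using N2 by (meson dist_triangle_half_r)
  qed
  then obtain l where l: "x \<longlonglongrightarrow> l" by (meson Cauchy_convergent convergent_def)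
  have "l \<in> D n" for n
  proof (rule Lim_in_closed_set[OF closed _ _ l])
    show "eventually (\<lambda>m. x m \<in> D n) sequentially"
      using x(1) decseqD[OF dec] by (intro eventually_sequentiallyI[of n]) blast
  qed simp
  then show ?thesis by auto
qed

text \<open>The nearest point is a common point of the sets of 1 / (n + 1)-almost nearest points. If
  the angle at p were acute for some x, a short move from p towards x would come closer to
  y.\<close>

lemma closed_convex_projection:
  fixes K :: "'a::{real_inner, complete_space} set"
  assumes "closed K" "convex K" "K \<noteq> {}"
  obtains p where "p \<in> K" "\<And>x. x \<in> K \<Longrightarrow> inner (y - p) (x - p) \<le> 0"
proof -
  define D where "D n = K \<inter> cball y (infdist y K + 1 / Suc n)" for n
  have "(\<Inter>n. D n) \<noteq> {}"
  proof (rule closed_convex_nested_Inter_nonempty)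
    show "closed (D n)" "convex (D n)" for n
      unfolding D_def by (intro closed_Int convex_Int assms closed_cball convex_cball)+
    show "D n \<noteq> {}" for n
    proof -
      have "infdist y K < infdist y K + 1 / Suc n" by simp
      then obtain x where "x \<in> K" "dist y x < infdist y K + 1 / Suc n"
        by (rule infdist_lessE[OF assms(3)])
      then have "x \<in> D n" by (simp add: D_def)
      then show ?thesis by blast
    qed
    show "decseq D"
      unfolding D_def by (intro decseq_SucI Int_mono subset_cball) (auto simp: field_simps)
    show "bounded (D 0)"
      unfolding D_def by (rule bounded_subset[OF bounded_cball]) blast
  qed
  then obtain p where "\<And>n. p \<in> D n" by blast
  then have p: "p \<in> K" "\<And>n. dist y p \<le> infdist y K + 1 / Suc n"
    unfolding D_def by auto
  have "dist y p \<le> infdist y K"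
  proof (rule LIMSEQ_le_const)
    show "(\<lambda>n. infdist y K + 1 / Suc n) \<longlonglongrightarrow> infdist y K"
      using tendsto_add[OF tendsto_const LIMSEQ_Suc[OF lim_1_over_n], of "infdist y K"] by simp
  qed (use p in auto)
  then have min: "dist y p \<le> dist y x" if "x \<in> K" for x
    using infdist_le[OF that, of y] by linarith
  have "inner (y - p) (x - p) \<le> 0" if "x \<in> K" for x
  proof (rule ccontr)
    assume "\<not> ?thesis"
    then obtain u where u: "0 < u" "u \<le> 1" "dist (p + u *\<^sub>R (x - p)) y < dist p y"
      using closer_point_lemma[of y p x] by force
    have "(1 - u) *\<^sub>R p + u *\<^sub>R x \<in> K"
      using u p(1) that by (intro convexD[OF assms(2)]) auto
    then have "p + u *\<^sub>R (x - p) \<in> K" by (simp add: algebra_simps)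
    from min[OF this] u(3) show False by (simp add: dist_commute)
  qed
  with p(1) show ?thesis using that by blast
qed

lemma closed_subspace_projection:
  fixes K :: "'a::{real_inner, complete_space} set"
  assumes "closed K" "subspace K"
  obtains p where "p \<in> K" "\<And>x. x \<in> K \<Longrightarrow> inner (y - p) x = 0"
proof -
  have "K \<noteq> {}" using subspace_0[OF assms(2)] by blast
  then obtain p where p: "p \<in> K" "\<And>x. x \<in> K \<Longrightarrow> inner (y - p) (x - p) \<le> 0"
    using closed_convex_projection[OF assms(1) subspace_imp_convex[OF assms(2)]] by metis
  \<comment> \<open>The inequality at p + x and at p - x gives both signs.\<close>
  have "inner (y - p) x = 0" if "x \<in> K" for x
    using p(2)[OF subspace_add[OF assms(2) p(1) that]] p(2)[OF subspace_diff[OF assms(2) p(1) that]]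
    by simp
  with p(1) that show ?thesis by blast
qed

section \<open>The circle and \<open>L\<^sup>2\<close>\<close>

lemma space_circle [simp]: "space circle = sphere 0 1"
  by (simp add: circle_def)

lemma sets_circle [measurable_cong]: "sets circle = sets (restrict_space borel (sphere 0 1))"
  by (simp add: circle_def)

lemma cis_measurable [measurable]:
  "cis \<in> uniform_measure lborel {0..2 * pi} \<rightarrow>\<^sub>M restrict_space borel (sphere 0 1)"
proof (rule measurable_restrict_space2)
  have "cis \<in> borel_measurable borel"
    by (intro borel_measurable_continuous_onI continuous_intros)
  then show "cis \<in> borel_measurable (uniform_measure lborel {0..2 * pi})"
    by (simp add: measurable_def)
qed auto

interpretation circle: prob_space circle
  unfolding circle_def
proof (rule prob_space.prob_space_distr)
  show "prob_space (uniform_measure lborel {0..2 * pi})"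
    by (rule prob_space_uniform_measure) auto
qed measurable

lemma borel_measurable_circle_continuous:
  fixes f :: "complex \<Rightarrow> 'b::topological_space"
  assumes "continuous_on (sphere 0 1) f"
  shows "f \<in> borel_measurable circle"
  unfolding measurable_cong_sets[OF sets_circle refl]
  by (rule borel_measurable_continuous_on_restrict[OF assms])

lemma continuous_on_powi_sphere: "continuous_on (sphere 0 (1::real)) (\<lambda>z::complex. z powi n)"
  by (intro continuous_intros) auto

lemma AE_circleI: "(\<And>z. norm z = 1 \<Longrightarrow> P z) \<Longrightarrow> AE z in circle. P z"
  by (rule AE_I2) simp

lemma integral_circle_powi:
  "(LINT z|circle. z powi n) = (if n = 0 then 1 else 0)"
proof (cases "n = 0")
  case True
  then show ?thesis using circle.prob_space by simp
next
  case False
  have "(LINT z|circle. z powi n) = (LINT t|uniform_measure lborel {0..2 * pi}. cis t powi n)"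
    unfolding circle_def
    by (rule integral_distr) (auto intro!: borel_measurable_continuous_on_restrict continuous_on_powi_sphere)
  also have "\<dots> = (LINT t|density lborel (\<lambda>t. ennreal (indicator {0..2 * pi} t / (2 * pi))). cis (of_int n * t))"
  proof -
    have "uniform_measure lborel {0..2 * pi} =
        density lborel (\<lambda>t. ennreal (indicator {0..2 * pi} t / (2 * pi)))"
      unfolding uniform_measure_def
      by (rule arg_cong2[where f = density]) (auto simp: fun_eq_iff divide_ennreal[symmetric] split: split_indicator)
    then show ?thesis by (simp add: cis_power_int mult.commute)
  qed
  also have "\<dots> = (LINT t|lborel. (indicator {0..2 * pi} t / (2 * pi)) *\<^sub>R cis (of_int n * t))"
    by (intro integral_density) (auto intro!: borel_measurable_continuous_onI continuous_intros)
  also have "\<dots> = (LINT t|lborel. indicator {0..2 * pi} t *\<^sub>R (cis (of_int n * t) / (2 * pi)))"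
    by (intro Bochner_Integration.integral_cong) (auto simp: scaleR_conv_of_real)
  also have "\<dots> = (\<lambda>t. cis (of_int n * t) / (2 * pi * \<i> * of_int n)) (2 * pi) -
      (\<lambda>t. cis (of_int n * t) / (2 * pi * \<i> * of_int n)) 0"
  proof (rule integral_FTC_atLeastAtMost)
    fix t :: real
    show "((\<lambda>t. cis (of_int n * t) / (2 * pi * \<i> * of_int n)) has_vector_derivative
        cis (of_int n * t) / (2 * pi)) (at t within {0..2 * pi})"
      using False unfolding cis_conv_exp
      by (auto intro!: derivative_eq_intros has_vector_derivative_real_field simp: field_simps)
  qed (auto intro!: continuous_intros)
  also have "\<dots> = 0"
    using cis_multiple_2pi[of "of_int n"] by (simp add: mult.commute mult.left_commute)
  finally show ?thesis using False by simp
qed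

section \<open>The quotient \<open>L2\<close> through representatives, and its complex inner
  product\<close>

lemma rep_L2_sq_integrable [simp]: "rep_L2 x \<in> sq_integrable"
  using Quotient3_rep_reflp[OF Quotient3_L2, of x] by (simp add: L2_rel_def)

lemma abs_rep_L2 [simp]: "abs_L2 (rep_L2 x) = x"
  by (rule Quotient3_abs_rep[OF Quotient3_L2])

lemma L2_rel_refl [simp]: "L2_rel f f \<longleftrightarrow> f \<in> sq_integrable"
  by (simp add: L2_rel_def)

lemma abs_L2_eqI:
  "f \<in> sq_integrable \<Longrightarrow> g \<in> sq_integrable \<Longrightarrow> (AE z in circle. f z = g z) \<Longrightarrow> abs_L2 f = abs_L2 g"
  by (intro Quotient3_rel_abs[OF Quotient3_L2]) (simp add: L2_rel_def)

lemma abs_L2_eqD: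
  assumes "f \<in> sq_integrable" "g \<in> sq_integrable" "abs_L2 f = abs_L2 g"
  shows "AE z in circle. f z = g z"
proof -
  have "L2_rel f g" using Quotient3_rel[OF Quotient3_L2, of f g] assms by simp
  then show ?thesis by (simp add: L2_rel_def)
qed

lemma rep_abs_L2_AE: "f \<in> sq_integrable \<Longrightarrow> AE z in circle. rep_L2 (abs_L2 f) z = f z"
  by (rule abs_L2_eqD) simp_all

lemma sq_integrable_measurable: "f \<in> sq_integrable \<Longrightarrow> f \<in> borel_measurable circle"
  by (simp add: sq_integrable_def)

lemma sq_integrable_integrable_norm2: "f \<in> sq_integrable \<Longrightarrow> integrable circle (\<lambda>z. (cmod (f z))\<^sup>2)"
  by (simp add: sq_integrable_def)

lemma cinner_abs:
  "f \<in> sq_integrable \<Longrightarrow> g \<in> sq_integrable \<Longrightarrow>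
    cinner (abs_L2 f) (abs_L2 g) = (LINT z|circle. f z * cnj (g z))"
  by (simp add: cinner.abs_eq)

lemma add_abs:
  "f \<in> sq_integrable \<Longrightarrow> g \<in> sq_integrable \<Longrightarrow> abs_L2 f + abs_L2 g = abs_L2 (\<lambda>z. f z + g z)"
  by (simp add: plus_L2.abs_eq)

lemma cscale_abs: "f \<in> sq_integrable \<Longrightarrow> cscale c (abs_L2 f) = abs_L2 (\<lambda>z. c * f z)"
  by (simp add: cscale.abs_eq)

lemma sq_integrable_diff:
  "f \<in> sq_integrable \<Longrightarrow> g \<in> sq_integrable \<Longrightarrow> (\<lambda>z. f z - g z) \<in> sq_integrable"
  using sq_integrable_add[of f "\<lambda>z. (-1) * g z"] sq_integrable_cmult[of g "-1"] by simp

lemma diff_abs: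
  "f \<in> sq_integrable \<Longrightarrow> g \<in> sq_integrable \<Longrightarrow> abs_L2 f - abs_L2 g = abs_L2 (\<lambda>z. f z - g z)"
  using sq_integrable_cmult[of g "-1"] by (simp add: minus_L2_def uminus_L2_def cscale_abs add_abs)

lemma zero_L2_abs: "0 = abs_L2 (\<lambda>_. 0)"
  by (rule zero_L2.abs_eq)

lemma mult_op_abs:
  "\<phi> \<in> Linf \<Longrightarrow> f \<in> sq_integrable \<Longrightarrow> mult_op \<phi> (abs_L2 f) = abs_L2 (\<lambda>z. \<phi> z * f z)"
  by (simp add: mult_op.abs_eq)

lemma L2_fourier_abs: "f \<in> sq_integrable \<Longrightarrow> L2_fourier (abs_L2 f) = fourier f"
  by (simp add: L2_fourier.abs_eq)

lemma L2_cases: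
  obtains f where "f \<in> sq_integrable" "x = abs_L2 f"
  using that[of "rep_L2 x"] by simp

lemma scaleR_L2_cscale: "r *\<^sub>R x = cscale (of_real r) (x :: L2)"
  by (rule scaleR_L2_def)

lemma cinner_commute: "cinner y x = cnj (cinner x y)"
proof (cases x rule: L2_cases; cases y rule: L2_cases)
  fix f g assume "f \<in> sq_integrable" "x = abs_L2 f" "g \<in> sq_integrable" "y = abs_L2 g"
  then show ?thesis
    by (simp add: cinner_abs mult.commute flip: Bochner_Integration.integral_cnj)
qed

lemma cinner_add_left: "cinner (x + y) z = cinner x z + cinner y z"
  by transfer (auto simp: L2_rel_def distrib_right sq_integrable_mult)

lemma cinner_cscale_left: "cinner (cscale c x) y = c * cinner x y"
  by transfer (simp add: mult.assoc)

lemma cinner_add_right: "cinner x (y + z) = cinner x y + cinner x z"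
  by (simp add: cinner_commute[of x] cinner_add_left)

lemma cinner_cscale_right: "cinner x (cscale c y) = cnj c * cinner x y"
  by (simp add: cinner_commute[of x] cinner_cscale_left)

lemma cinner_self: "cinner x x = of_real ((norm x)\<^sup>2)"
proof -
  have "Im (cinner x x) = 0" using cinner_commute[of x x] by (simp add: complex_eq_iff)
  then show ?thesis
    by (simp add: power2_norm_eq_inner inner_L2_def complex_eq_iff)
qed

lemma norm_cscale [simp]: "norm (cscale c x) = cmod c * norm x"
proof -
  have "complex_of_real ((norm (cscale c x))\<^sup>2) = (c * cnj c) * of_real ((norm x)\<^sup>2)"
    by (simp only: cinner_self[symmetric] cinner_cscale_left cinner_cscale_right ac_simps)
  also have "\<dots> = of_real ((cmod c * norm x)\<^sup>2)"
    by (simp add: complex_norm_square[symmetric] power_mult_distrib)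
  finally have "(norm (cscale c x))\<^sup>2 = (cmod c * norm x)\<^sup>2" by (simp only: of_real_eq_iff)
  then show ?thesis by (simp add: power2_eq_iff_nonneg)
qed

lemma cinner_Cauchy_Schwarz: "cmod (cinner x y) \<le> norm x * norm y"
proof (cases "cinner x y = 0")
  case False
  \<comment> \<open>A unimodular factor that rotates \<open>cinner x y\<close> onto its modulus, so
    that the real Cauchy-Schwarz inequality applies.\<close>
  define c where "c = cnj (cinner x y) / cmod (cinner x y)"
  have c: "cmod c = 1" using False by (simp add: c_def norm_divide)
  have "cinner (cscale c x) y = of_real (cmod (cinner x y))"
    using False unfolding cinner_cscale_left c_def
    by (simp add: field_simps complex_norm_square[symmetric] power2_eq_square[symmetric])
  then have "cmod (cinner x y) = inner (cscale c x) y" by (simp add: inner_L2_def)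
  also have "\<dots> \<le> norm (cscale c x) * norm y" by (rule norm_cauchy_schwarz)
  finally show ?thesis by (simp add: c)
qed simp

interpretation cinner: bounded_bilinear cinner
proof
  show "\<exists>K. \<forall>a b. norm (cinner a b) \<le> norm a * norm b * K"
    using cinner_Cauchy_Schwarz by (auto intro!: exI[of _ 1])
qed (simp_all add: cinner_add_left cinner_add_right scaleR_L2_cscale cinner_cscale_left
    cinner_cscale_right scaleR_conv_of_real)

lemma cscale_add_right: "cscale c (x + y) = cscale c x + cscale c y"
  by transfer (auto simp: L2_rel_def distrib_left intro!: sq_integrable_cmult sq_integrable_add)

lemma norm_abs_L2: "f \<in> sq_integrable \<Longrightarrow> (norm (abs_L2 f))\<^sup>2 = (LINT z|circle. (cmod (f z))\<^sup>2)"
proof -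
  assume f: "f \<in> sq_integrable"
  have "complex_of_real ((norm (abs_L2 f))\<^sup>2) = (LINT z|circle. f z * cnj (f z))"
    by (simp only: cinner_self[symmetric] cinner_abs[OF f f])
  also have "\<dots> = of_real (LINT z|circle. (cmod (f z))\<^sup>2)"
    by (simp only: complex_norm_square[symmetric] integral_complex_of_real)
  finally show ?thesis by (simp only: of_real_eq_iff)
qed

lemma sq_integrable_bounded:
  assumes "f \<in> borel_measurable circle" "AE z in circle. cmod (f z) \<le> C"
  shows "f \<in> sq_integrable"
proof -
  have "integrable circle (\<lambda>z. (cmod (f z))\<^sup>2)"
  proof (rule circle.integrable_const_bound[where B = "C\<^sup>2"])
    show "AE z in circle. norm ((cmod (f z))\<^sup>2) \<le> C\<^sup>2"
      using assms(2) by eventually_elim (auto intro: power_mono)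
  qed (use assms(1) in measurable)
  with assms(1) show ?thesis by (simp add: sq_integrable_def)
qed

lemma sq_integrable_integrable: "f \<in> sq_integrable \<Longrightarrow> integrable circle f"
  using sq_integrable_mult[of f "\<lambda>_. 1"] sq_integrable_bounded[of "\<lambda>_. 1" 1] by simp

lemma sq_integrable_norm: "f \<in> sq_integrable \<Longrightarrow> (\<lambda>z. complex_of_real (cmod (f z))) \<in> sq_integrable"
  unfolding sq_integrable_def by (auto intro!: borel_measurable_of_real borel_measurable_norm)

text \<open>The circle has total mass 1, so this is Cauchy-Schwarz of |f| against the constant
  1.\<close>

lemma integral_norm_le_norm_L2:
  assumes "f \<in> sq_integrable"
  shows "(LINT z|circle. cmod (f z)) \<le> norm (abs_L2 f)"
proof -
  have 1: "(\<lambda>_. 1) \<in> sq_integrable" by (rule sq_integrable_bounded[of _ 1]) auto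
  have "complex_of_real (LINT z|circle. cmod (f z)) =
      cinner (abs_L2 (\<lambda>z. complex_of_real (cmod (f z)))) (abs_L2 (\<lambda>_. 1))"
    by (simp add: cinner_abs[OF sq_integrable_norm[OF assms] 1])
  then have "cmod (complex_of_real (LINT z|circle. cmod (f z))) \<le>
      norm (abs_L2 (\<lambda>z. complex_of_real (cmod (f z)))) * norm (abs_L2 (\<lambda>_. 1))"
    using cinner_Cauchy_Schwarz by simp
  moreover have "(norm (abs_L2 (\<lambda>_. 1)))\<^sup>2 = 1\<^sup>2"
    unfolding norm_abs_L2[OF 1] using circle.prob_space by simp
  then have "norm (abs_L2 (\<lambda>_. 1)) = 1" by (rule power2_eq_imp_eq) auto
  moreover have "(norm (abs_L2 (\<lambda>z. complex_of_real (cmod (f z)))))\<^sup>2 = (norm (abs_L2 f))\<^sup>2"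
    by (simp add: norm_abs_L2 sq_integrable_norm assms)
  then have "norm (abs_L2 (\<lambda>z. complex_of_real (cmod (f z)))) = norm (abs_L2 f)"
    by (rule power2_eq_imp_eq) auto
  ultimately show ?thesis by simp
qed

section \<open>Completeness of \<open>L2\<close>\<close>

lemma AE_summable_of_summable_integral:
  fixes g :: "nat \<Rightarrow> 'a \<Rightarrow> real"
  assumes g: "\<And>n. integrable M (g n)" "\<And>n z. 0 \<le> g n z" and s: "summable (\<lambda>n. integral\<^sup>L M (g n))"
  shows "AE z in M. summable (\<lambda>n. g n z)"
proof -
  have [measurable]: "g n \<in> borel_measurable M" for n
    by (rule borel_measurable_integrable[OF g(1)])
  have "(\<integral>\<^sup>+z. (\<Sum>n. ennreal (g n z)) \<partial>M) = (\<Sum>n. \<integral>\<^sup>+z. ennreal (g n z) \<partial>M)"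
    by (intro nn_integral_suminf) measurable
  also have "\<dots> = (\<Sum>n. ennreal (integral\<^sup>L M (g n)))"
    using g by (intro suminf_cong nn_integral_eq_integral) auto
  also have "\<dots> = ennreal (\<Sum>n. integral\<^sup>L M (g n))"
    using g(2) by (intro suminf_ennreal2 s) auto
  finally have "(\<integral>\<^sup>+z. (\<Sum>n. ennreal (g n z)) \<partial>M) \<noteq> \<infinity>" by simp
  moreover have "(\<lambda>z. \<Sum>n. ennreal (g n z)) \<in> borel_measurable M"
    by measurable
  ultimately have "AE z in M. (\<Sum>n. ennreal (g n z)) \<noteq> \<infinity>"
    by (intro nn_integral_PInf_AE)
  then show ?thesis
    by eventually_elim (use g(2) in \<open>auto intro!: summable_suminf_not_top\<close>)
qed

text \<open>The core of Riesz-Fischer. Geometric increments in \<open>L2\<close> are summable in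
  L^1, so the representatives converge almost everywhere by telescoping; Fatou's lemma then turns
  the pointwise limit into a limit in norm.\<close>

lemma L2_fast_Cauchy_limit:
  assumes r: "\<And>n. norm (X (Suc n) - X n) \<le> (1/2)^n" and "Cauchy X"
  shows "\<exists>x::L2. X \<longlonglongrightarrow> x"
proof -
  define f where "f n = rep_L2 (X n)" for n
  have f: "f n \<in> sq_integrable" "X n = abs_L2 (f n)" for n by (simp_all add: f_def)
  have df: "X m - X n = abs_L2 (\<lambda>z. f m z - f n z)" "(\<lambda>z. f m z - f n z) \<in> sq_integrable" for m n
    using f by (simp_all add: diff_abs sq_integrable_diff)
  have "AE z in circle. summable (\<lambda>n. cmod (f (Suc n) z - f n z))"
  proof (rule AE_summable_of_summable_integral)
    show "integrable circle (\<lambda>z. cmod (f (Suc n) z - f n z))" for n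
      by (intro integrable_norm sq_integrable_integrable df)
    show "summable (\<lambda>n. LINT z|circle. cmod (f (Suc n) z - f n z))"
    proof (rule summable_comparison_test[OF _ summable_geometric[of "1/2::real"]], intro exI allI impI)
      fix n
      have "(LINT z|circle. cmod (f (Suc n) z - f n z)) \<le> norm (X (Suc n) - X n)"
        unfolding df(1) by (rule integral_norm_le_norm_L2[OF df(2)])
      then show "norm (LINT z|circle. cmod (f (Suc n) z - f n z)) \<le> (1/2)^n"
        using r[of n] by simp
    qed simp
  qed simp
  then have conv: "AE z in circle. convergent (\<lambda>n. f n z)"
  proof eventually_elim
    case (elim z)
    then have "summable (\<lambda>n. f (Suc n) z - f n z)" by (rule summable_norm_cancel)
    then have "convergent (\<lambda>n. \<Sum>i<n. f (Suc i) z - f i z)" by (simp add: summable_iff_convergent)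
    then have "convergent (\<lambda>n. (\<Sum>i<n. f (Suc i) z - f i z) + f 0 z)"
      by (intro convergent_add convergent_const)
    then show ?case by (simp add: sum_lessThan_telescope[of "\<lambda>i. f i z"])
  qed
  define F where "F z = lim (\<lambda>n. f n z)" for z
  have lim: "AE z in circle. (\<lambda>n. f n z) \<longlonglongrightarrow> F z"
    using conv by eventually_elim (simp add: F_def convergent_LIMSEQ_iff)
  have mf [measurable]: "f n \<in> borel_measurable circle" for n
    using f(1) by (simp add: sq_integrable_def)
  have mF [measurable]: "F \<in> borel_measurable circle"
    unfolding F_def by (intro borel_measurable_lim_metric mf)
  \<comment> \<open>Fatou along m for fixed n. It is applied with e = 1 to see that \<open>F\<close>
    is square integrable, and with small e to get convergence.\<close>
  have key: "(\<lambda>z. F z - f n z) \<in> sq_integrable \<and> norm (abs_L2 (\<lambda>z. F z - f n z)) \<le> e"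
    if e: "0 < e" "\<And>m. m \<ge> n \<Longrightarrow> norm (X m - X n) \<le> e" for n e
  proof -
    have "(\<integral>\<^sup>+z. ennreal ((cmod (F z - f n z))\<^sup>2) \<partial>circle) =
        (\<integral>\<^sup>+z. liminf (\<lambda>m. ennreal ((cmod (f m z - f n z))\<^sup>2)) \<partial>circle)"
    proof (rule nn_integral_cong_AE)
      show "AE z in circle. ennreal ((cmod (F z - f n z))\<^sup>2) =
          liminf (\<lambda>m. ennreal ((cmod (f m z - f n z))\<^sup>2))"
        using lim
      proof eventually_elim
        case (elim z)
        have "(\<lambda>m. ennreal ((cmod (f m z - f n z))\<^sup>2)) \<longlonglongrightarrow> ennreal ((cmod (F z - f n z))\<^sup>2)"
          by (intro tendsto_ennrealI tendsto_intros elim)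
        then show ?case by (rule lim_imp_Liminf[OF sequentially_bot, symmetric])
      qed
    qed
    also have "\<dots> \<le> liminf (\<lambda>m. \<integral>\<^sup>+z. ennreal ((cmod (f m z - f n z))\<^sup>2) \<partial>circle)"
      by (rule nn_integral_liminf) measurable
    also have "\<dots> \<le> ennreal (e\<^sup>2)"
    proof (rule Liminf_le)
      show "eventually (\<lambda>m. (\<integral>\<^sup>+z. ennreal ((cmod (f m z - f n z))\<^sup>2) \<partial>circle) \<le> ennreal (e\<^sup>2)) sequentially"
      proof (rule eventually_sequentiallyI[of n])
        fix m assume "n \<le> m"
        have "(\<integral>\<^sup>+z. ennreal ((cmod (f m z - f n z))\<^sup>2) \<partial>circle) = ennreal ((norm (X m - X n))\<^sup>2)"
          unfolding df(1) norm_abs_L2[OF df(2)]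
          by (rule nn_integral_eq_integral[OF sq_integrable_integrable_norm2[OF df(2)]]) simp
        also have "\<dots> \<le> ennreal (e\<^sup>2)"
          using e(2)[OF \<open>n \<le> m\<close>] by (intro ennreal_leI power_mono) auto
        finally show "(\<integral>\<^sup>+z. ennreal ((cmod (f m z - f n z))\<^sup>2) \<partial>circle) \<le> ennreal (e\<^sup>2)" .
      qed
    qed simp
    finally have le: "(\<integral>\<^sup>+z. ennreal ((cmod (F z - f n z))\<^sup>2) \<partial>circle) \<le> ennreal (e\<^sup>2)" .
    have "integrable circle (\<lambda>z. (cmod (F z - f n z))\<^sup>2)"
    proof (rule integrableI_bounded)
      show "(\<integral>\<^sup>+z. ennreal (norm ((cmod (F z - f n z))\<^sup>2)) \<partial>circle) < \<infinity>"
        using le by (simp add: le_less_trans[OF _ ennreal_less_top])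
    qed measurable
    then have sq: "(\<lambda>z. F z - f n z) \<in> sq_integrable" by (simp add: sq_integrable_def)
    have "ennreal ((norm (abs_L2 (\<lambda>z. F z - f n z)))\<^sup>2) \<le> ennreal (e\<^sup>2)"
      using le unfolding norm_abs_L2[OF sq]
      by (subst (asm) nn_integral_eq_integral[OF sq_integrable_integrable_norm2[OF sq]]) auto
    then have "(norm (abs_L2 (\<lambda>z. F z - f n z)))\<^sup>2 \<le> e\<^sup>2"
      by (simp add: ennreal_le_iff)
    then show ?thesis using sq e(1) by (simp add: power2_le_iff_abs_le)
  qed
  have C: "\<exists>N. \<forall>n\<ge>N. \<forall>m\<ge>n. norm (X m - X n) \<le> e" if "0 < e" for e
    using CauchyD[OF \<open>Cauchy X\<close> that] by (meson less_imp_le order_trans)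
  obtain N where "\<And>n m. n \<ge> N \<Longrightarrow> m \<ge> n \<Longrightarrow> norm (X m - X n) \<le> 1" using C[of 1] by auto
  then have "(\<lambda>z. F z - f N z) \<in> sq_integrable" using key[of 1 N] by simp
  from sq_integrable_add[OF this f(1)[of N]] have F: "F \<in> sq_integrable" by simp
  have "X \<longlonglongrightarrow> abs_L2 F"
  proof (rule LIMSEQ_I)
    fix e :: real assume "0 < e"
    then have "0 < e/2" by simp
    from C[OF this] obtain N where N: "\<And>n m. n \<ge> N \<Longrightarrow> m \<ge> n \<Longrightarrow> norm (X m - X n) \<le> e/2" by blast
    have "norm (abs_L2 F - X n) \<le> e/2" if "n \<ge> N" for n
    proof -
      have "abs_L2 F - X n = abs_L2 (\<lambda>z. F z - f n z)"
        by (subst f(2)) (simp add: diff_abs F f(1))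
      then show ?thesis using key[OF \<open>0 < e/2\<close> N[OF that]] by simp
    qed
    then have "norm (X n - abs_L2 F) < e" if "n \<ge> N" for n
      using that \<open>0 < e\<close> by (subst norm_minus_commute) fastforce
    then show "\<exists>no. \<forall>n\<ge>no. norm (X n - abs_L2 F) < e" by blast
  qed
  then show ?thesis by blast
qed

instance L2 :: complete_space
proof
  fix X :: "nat \<Rightarrow> L2" assume X: "Cauchy X"
  have "\<exists>M. \<forall>m\<ge>M. \<forall>n\<ge>M. norm (X m - X n) < (1/2)^k" for k :: nat
    using CauchyD[OF X, of "(1/2)^k"] by simp
  then obtain M where M: "\<And>k m n. m \<ge> M k \<Longrightarrow> n \<ge> M k \<Longrightarrow> norm (X m - X n) < (1/2)^k" by metis
  \<comment> \<open>The maximum puts \<open>r k\<close> beyond \<open>M k\<close>, and the successor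
    makes \<open>r\<close> strictly increasing, as a subsequence must be.\<close>
  define r where "r = rec_nat (M 0) (\<lambda>k v. Suc (max v (M (Suc k))))"
  have r: "r (Suc k) = Suc (max (r k) (M (Suc k)))" "r 0 = M 0" for k by (simp_all add: r_def)
  have sm: "strict_mono r" by (rule strict_mono_Suc_iff[THEN iffD2]) (simp add: r less_Suc_eq_le)
  have rM: "M k \<le> r k" for k by (cases k) (simp_all add: r)
  have "\<exists>x. (X \<circ> r) \<longlonglongrightarrow> x"
  proof (rule L2_fast_Cauchy_limit)
    show "norm ((X \<circ> r) (Suc n) - (X \<circ> r) n) \<le> (1/2)^n" for n
    proof -
      have "r n \<le> r (Suc n)" by (simp add: r)
      then show ?thesis using M[of n "r (Suc n)" "r n"] rM[of n] by simp
    qed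
    show "Cauchy (X \<circ> r)" by (rule Cauchy_subseq_Cauchy[OF X sm])
  qed
  then obtain x where "(X \<circ> r) \<longlonglongrightarrow> x" by blast
  then have "X \<longlonglongrightarrow> x" by (rule Cauchy_converges_subseq[OF X sm])
  then show "convergent X" by (auto simp: convergent_def)
qed

section \<open>Fourier coefficients\<close>

lemma cnj_powi_circle:
  assumes "cmod z = 1"
  shows "cnj z powi n = z powi (- n)"
proof -
  have "z * cnj z = 1" using complex_norm_square[of z] assms by simp
  then have "cnj z = inverse z" by (metis inverse_unique)
  then show ?thesis by (simp add: power_int_inverse power_int_minus)
qed

lemma sq_integrable_powi: "(\<lambda>z. z powi n) \<in> sq_integrable"
  by (rule sq_integrable_bounded[where C = 1])
    (auto intro!: borel_measurable_circle_continuous continuous_on_powi_sphere AE_circleI simp: norm_power_int)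

definition L2_monom :: "int \<Rightarrow> L2" where
  "L2_monom n = abs_L2 (\<lambda>z. z powi n)"

lemma L2_fourier_cinner: "L2_fourier x n = cinner x (L2_monom n)"
  by (cases x rule: L2_cases) (simp add: L2_monom_def L2_fourier_abs cinner_abs sq_integrable_powi fourier_def)

lemma fourier_mult_powi: "fourier (\<lambda>z. f z * z powi k) n = fourier f (n - k)"
  unfolding fourier_def
proof (rule Bochner_Integration.integral_cong)
  fix z assume "z \<in> space circle"
  then have z: "cmod z = 1" by simp
  then have "z \<noteq> 0" by auto
  then show "f z * z powi k * cnj (z powi n) = f z * cnj (z powi (n - k))"
    by (simp add: cnj_powi_circle z power_int_add[symmetric])
qed simp

lemma fourier_one: "fourier (\<lambda>_. 1) n = (if n = 0 then 1 else 0)"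
proof -
  have "fourier (\<lambda>_. 1) n = (LINT z|circle. z powi (- n))"
    unfolding fourier_def by (intro Bochner_Integration.integral_cong) (simp_all add: cnj_powi_circle)
  then show ?thesis by (simp add: integral_circle_powi)
qed

lemma fourier_powi: "fourier (\<lambda>z. z powi m) n = (if m = n then 1 else 0)"
  using fourier_mult_powi[of "\<lambda>_. 1" m n] by (auto simp: fourier_one)

lemma L2_fourier_monom: "L2_fourier (L2_monom m) n = (if m = n then 1 else 0)"
  by (simp add: L2_monom_def L2_fourier_abs sq_integrable_powi fourier_powi)

lemma bounded_linear_L2_fourier: "bounded_linear (\<lambda>x. L2_fourier x n)"
  unfolding L2_fourier_cinner by (rule cinner.bounded_linear_left)

lemmas continuous_on_L2_fourier [continuous_intros] =
  bounded_linear.continuous_on[OF bounded_linear_L2_fourier]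
lemmas L2_fourier_add = linear_add[OF bounded_linear.linear[OF bounded_linear_L2_fourier]]
lemmas L2_fourier_diff = linear_diff[OF bounded_linear.linear[OF bounded_linear_L2_fourier]]
lemmas L2_fourier_zero = linear_0[OF bounded_linear.linear[OF bounded_linear_L2_fourier]]

lemma L2_fourier_cscale: "L2_fourier (cscale c x) n = c * L2_fourier x n"
  by (simp add: L2_fourier_cinner cinner_cscale_left)

lemma norm_L2_monom [simp]: "norm (L2_monom n) = 1"
proof -
  have "complex_of_real ((norm (L2_monom n))\<^sup>2) = 1"
    by (simp only: cinner_self[symmetric] L2_fourier_cinner[symmetric] L2_fourier_monom) simp
  then have "(norm (L2_monom n))\<^sup>2 = 1\<^sup>2" by (simp only: of_real_eq_1_iff one_power2)
  then show ?thesis by (rule power2_eq_imp_eq) auto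
qed

lemma norm_L2_fourier_le: "cmod (L2_fourier x n) \<le> norm x"
  using cinner_Cauchy_Schwarz[of x "L2_monom n"] by (simp add: L2_fourier_cinner)

section \<open>Uniqueness of Fourier coefficients\<close>

lemma integral_trig_eq_0:
  assumes f: "f \<in> sq_integrable" "\<And>n. fourier f n = 0"
    and g: "\<And>z. cmod z = 1 \<Longrightarrow> g z * z ^ N = poly q z"
  shows "(LINT z|circle. f z * g z) = 0"
proof -
  have "(LINT z|circle. f z * g z) = (LINT z|circle. (\<Sum>i\<le>degree q. coeff q i * (f z * cnj (z powi (int N - int i)))))"
  proof (rule Bochner_Integration.integral_cong)
    fix z assume "z \<in> space circle"
    then have z: "cmod z = 1" by simp
    then have z0: "z \<noteq> 0" by auto
    have "g z = poly q z * z powi (- int N)"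
      using g[OF z] z0 by (simp add: power_int_minus field_simps)
    also have "\<dots> = (\<Sum>i\<le>degree q. coeff q i * z powi (int i - int N))"
      unfolding poly_altdef sum_distrib_right
      by (intro sum.cong) (use z0 in \<open>simp_all add: power_int_diff power_int_minus divide_inverse\<close>)
    finally show "f z * g z = (\<Sum>i\<le>degree q. coeff q i * (f z * cnj (z powi (int N - int i))))"
      by (simp add: cnj_powi_circle z sum_distrib_left ac_simps)
  qed simp
  also have "\<dots> = (\<Sum>i\<le>degree q. coeff q i * fourier f (int N - int i))"
    unfolding fourier_def using sq_integrable_mult[OF f(1) sq_integrable_powi]
    by (subst Bochner_Integration.integral_sum) auto
  finally show ?thesis by (simp add: f(2))
qed

text \<open>Stone-Weierstrass: a continuous real function is a uniform limit of trigonometric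
  polynomials, against which f integrates to 0, and f is integrable.\<close>

lemma integral_continuous_eq_0:
  fixes g :: "complex \<Rightarrow> real"
  assumes f: "f \<in> sq_integrable" "\<And>n. fourier f n = 0" and g: "continuous_on (sphere 0 1) g"
  shows "(LINT z|circle. f z * g z) = 0"
proof -
  \<comment> \<open>Real trigonometric polynomials, with negative powers cleared: multiplication by
    a power of z leaves an ordinary polynomial on the circle. The coordinate functions qualify
    because z * \<open>cnj z\<close> = 1 there.\<close>
  define P where "P g \<longleftrightarrow> continuous_on (sphere 0 1) g \<and>
    (\<exists>N q. \<forall>z. cmod z = 1 \<longrightarrow> complex_of_real (g z) * z ^ N = poly q z)" for g :: "complex \<Rightarrow> real"
  have intf: "integrable circle f" by (rule sq_integrable_integrable[OF f(1)])
  have int_fg: "integrable circle (\<lambda>z. f z * complex_of_real (h z))"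
    if "continuous_on (sphere 0 1) h" for h :: "complex \<Rightarrow> real"
  proof -
    have "compact (h ` sphere 0 1)" by (intro compact_continuous_image that) auto
    from compact_imp_bounded[OF this] obtain B where "\<forall>y\<in>h ` sphere 0 1. norm y \<le> B"
      unfolding bounded_iff ..
    then have B: "norm (h z) \<le> B" if "z \<in> sphere 0 1" for z using that by simp
    have "(\<lambda>z. complex_of_real (h z)) \<in> sq_integrable"
      by (rule sq_integrable_bounded[of _ B])
        (use B that in \<open>auto intro!: borel_measurable_circle_continuous continuous_intros\<close>)
    from sq_integrable_mult[OF f(1) this] show ?thesis by simp
  qed
  have ap: "\<exists>h. P h \<and> (\<forall>z\<in>sphere 0 1. \<bar>g z - h z\<bar> < e)" if "0 < e" for e
  proof (rule Stone_Weierstrass_HOL[OF compact_sphere _ _ _ _ _ g that])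
    show "P (\<lambda>x. c)" for c
      unfolding P_def by (auto intro!: exI[of _ 0] exI[of _ "[:of_real c:]"])
    show "continuous_on (sphere 0 1) h" if "P h" for h using that by (simp add: P_def)
    show "P (\<lambda>x. h x + k x)" if "P h \<and> P k" for h k
    proof -
      from that obtain N q M r where
        1: "\<And>z. cmod z = 1 \<Longrightarrow> complex_of_real (h z) * z ^ N = poly q z"
           "\<And>z. cmod z = 1 \<Longrightarrow> complex_of_real (k z) * z ^ M = poly r z"
        unfolding P_def by blast
      have "complex_of_real (h z + k z) * z ^ (N + M) = poly (monom 1 M * q + monom 1 N * r) z"
        if "cmod z = 1" for z
        by (simp add: poly_monom 1[OF that, symmetric] power_add algebra_simps)
      moreover have "continuous_on (sphere 0 1) h" "continuous_on (sphere 0 1) k"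
        using that by (simp_all add: P_def)
      ultimately show ?thesis
        unfolding P_def by (intro conjI continuous_on_add exI allI impI)
    qed
    show "P (\<lambda>x. h x * k x)" if "P h \<and> P k" for h k
    proof -
      from that obtain N q M r where
        1: "\<And>z. cmod z = 1 \<Longrightarrow> complex_of_real (h z) * z ^ N = poly q z"
           "\<And>z. cmod z = 1 \<Longrightarrow> complex_of_real (k z) * z ^ M = poly r z"
        unfolding P_def by blast
      have "complex_of_real (h z * k z) * z ^ (N + M) = poly (q * r) z"
        if "cmod z = 1" for z
        by (simp add: 1[OF that, symmetric] power_add algebra_simps)
      moreover have "continuous_on (sphere 0 1) h" "continuous_on (sphere 0 1) k"
        using that by (simp_all add: P_def)
      ultimately show ?thesis
        unfolding P_def by (intro conjI continuous_on_mult exI allI impI)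
    qed
    have zc: "z * cnj z = 1" if "cmod z = 1" for z
      using complex_norm_square[of z] that by simp
    have "complex_of_real (Re z) * z ^ 1 = poly [:1/2, 0, 1/2:] z" if "cmod z = 1" for z
    proof -
      have eq: "complex_of_real (Re z) = (z + cnj z) / 2" by (simp add: complex_eq_iff)
      have "complex_of_real (Re z) * z ^ 1 = (z * z + z * cnj z) / 2"
        unfolding eq by (simp add: algebra_simps)
      then show ?thesis by (simp add: zc[OF that] add_divide_distrib)
    qed
    then have "P Re" unfolding P_def by (intro conjI continuous_on_Re continuous_on_id exI allI impI)
    have "complex_of_real (Im z) * z ^ 1 = poly [:\<i>/2, 0, -\<i>/2:] z" if "cmod z = 1" for z
    proof -
      have eq: "complex_of_real (Im z) = \<i> * (cnj z - z) / 2" by (simp add: complex_eq_iff)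
      have "complex_of_real (Im z) * z ^ 1 = \<i> * (z * cnj z - z * z) / 2"
        unfolding eq by (simp add: algebra_simps)
      then show ?thesis by (simp add: zc[OF that] field_simps)
    qed
    then have "P Im" unfolding P_def by (intro conjI continuous_on_Im continuous_on_id exI allI impI)
    show "\<exists>h. P h \<and> h x \<noteq> h y" if "x \<in> sphere 0 1 \<and> y \<in> sphere 0 1 \<and> x \<noteq> y" for x y
      using that \<open>P Re\<close> \<open>P Im\<close> complex_eq_iff[of x y] by metis
  qed
  define C where "C = (LINT z|circle. cmod (f z))"
  have "cmod (LINT z|circle. f z * g z) \<le> e * C" if e: "0 < e" for e :: real
  proof -
    obtain h where h: "P h" "\<And>z. z \<in> sphere 0 1 \<Longrightarrow> \<bar>g z - h z\<bar> < e" using ap[OF e] by blast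
    have ch: "continuous_on (sphere 0 1) h" using h(1) by (simp add: P_def)
    from h(1) obtain N q where "\<And>z. cmod z = 1 \<Longrightarrow> complex_of_real (h z) * z ^ N = poly q z"
      unfolding P_def by blast
    then have "(LINT z|circle. f z * h z) = 0" by (rule integral_trig_eq_0[OF f])
    then have "(LINT z|circle. f z * g z) = (LINT z|circle. f z * g z - f z * h z)"
      by (simp add: int_fg g ch)
    also have "cmod \<dots> \<le> (LINT z|circle. e * cmod (f z))"
    proof (rule Bochner_Integration.integral_norm_bound_integral)
      fix z assume "z \<in> space circle"
      then have "\<bar>g z - h z\<bar> \<le> e" using h(2)[of z] by simp
      moreover have "f z * g z - f z * h z = f z * of_real (g z - h z)" by (simp add: algebra_simps)
      ultimately show "cmod (f z * g z - f z * h z) \<le> e * cmod (f z)"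
        by (simp add: norm_mult mult.commute[of e] mult_left_mono del: of_real_diff)
    qed (use int_fg g ch intf in auto)
    also have "\<dots> = e * C" by (simp add: C_def)
    finally show ?thesis .
  qed
  \<comment> \<open>The bound e * C holds for every positive e and tends to 0 with e.\<close>
  then have ev: "eventually (\<lambda>e. cmod (LINT z|circle. f z * g z) \<le> e * C) (at_right 0)"
    by (intro eventually_at_rightI[of 0 1]) auto
  have "(\<lambda>e. e * C) \<midarrow>0\<rightarrow> 0 * C" by (intro tendsto_intros)
  then have "((\<lambda>e. e * C) \<longlongrightarrow> 0) (at_right 0)" by (simp add: filterlim_at_split)
  from tendsto_lowerbound[OF this ev] show ?thesis by simp
qed

text \<open>The indicator of a closed set is a pointwise limit of continuous functions with values
  in [0, 1], so dominated convergence with |f| as majorant reduces to the continuous case.\<close>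

lemma integral_closed_eq_0:
  assumes f: "f \<in> sq_integrable" "\<And>n. fourier f n = 0" and K: "closed K"
  shows "(LINT z|circle. indicat_real K z *\<^sub>R f z) = 0"
proof (cases "K = {}")
  case False
  \<comment> \<open>A ramp that is 1 on K and 0 at distance at least 1 / n from K when n > 0. The
    empty set is treated apart because \<open>infdist\<close> to it is 0 by convention.\<close>
  define g where "g n z = max 0 (1 - real n * infdist z K)" for n z
  have cont: "continuous_on A (g n)" for A n unfolding g_def by (intro continuous_intros)
  have "(\<lambda>n. LINT z|circle. f z * g n z) \<longlonglongrightarrow> (LINT z|circle. indicat_real K z *\<^sub>R f z)"
  proof (rule integral_dominated_convergence[where w = "\<lambda>z. cmod (f z)"])
    have [measurable]: "f \<in> borel_measurable circle" by (rule sq_integrable_measurable[OF f(1)])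
    have "K \<inter> sphere 0 1 \<in> sets circle"
      unfolding sets_circle using K by (subst sets_restrict_space_iff) auto
    then have "indicat_real (K \<inter> sphere 0 1) \<in> borel_measurable circle" by measurable
    then have "indicat_real K \<in> borel_measurable circle"
      by (rule measurable_cong[THEN iffD1, rotated]) (auto simp: indicator_def)
    then show "(\<lambda>z. indicat_real K z *\<^sub>R f z) \<in> borel_measurable circle" by measurable
    have [measurable]: "g n \<in> borel_measurable circle" for n
      by (rule borel_measurable_circle_continuous[OF cont])
    show "(\<lambda>z. f z * complex_of_real (g n z)) \<in> borel_measurable circle" for n by measurable
    show "integrable circle (\<lambda>z. cmod (f z))" by (intro integrable_norm sq_integrable_integrable f)
    show "AE z in circle. (\<lambda>n. f z * g n z) \<longlonglongrightarrow> indicat_real K z *\<^sub>R f z"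
    proof (rule AE_circleI)
      fix z
      have "(\<lambda>n. g n z) \<longlonglongrightarrow> indicat_real K z"
      proof (cases "z \<in> K")
        case True
        then show ?thesis by (simp add: g_def)
      next
        case False
        then have "0 < infdist z K"
          using K \<open>K \<noteq> {}\<close> by (simp add: infdist_pos_not_in_closed)
        then obtain N where N: "1 < real N * infdist z K" using reals_Archimedean3 by blast
        have "g n z = 0" if "n \<ge> N" for n
        proof -
          have "real N * infdist z K \<le> real n * infdist z K"
            using that \<open>0 < infdist z K\<close> by (intro mult_right_mono) auto
          then show ?thesis using N by (simp add: g_def)
        qed
        then have "eventually (\<lambda>n. g n z = 0) sequentially" by (rule eventually_sequentiallyI)
        then show ?thesis using False by (simp add: tendsto_eventually)
      qed
      then have "(\<lambda>n. f z * g n z) \<longlonglongrightarrow> f z * of_real (indicat_real K z)" by (intro tendsto_intros)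
      then show "(\<lambda>n. f z * g n z) \<longlonglongrightarrow> indicat_real K z *\<^sub>R f z"
        by (simp add: scaleR_conv_of_real mult.commute)
    qed
    show "AE z in circle. cmod (f z * complex_of_real (g n z)) \<le> cmod (f z)" for n
    proof (rule AE_circleI)
      fix z
      have "0 \<le> g n z" "g n z \<le> 1" by (auto simp: g_def infdist_nonneg)
      then show "cmod (f z * complex_of_real (g n z)) \<le> cmod (f z)"
        by (simp add: norm_mult mult_left_le)
    qed
  qed
  moreover have "(LINT z|circle. f z * g n z) = 0" for n
    by (rule integral_continuous_eq_0[OF f cont])
  ultimately show ?thesis by (simp add: LIMSEQ_const_iff)
qed simp

text \<open>The Borel sets over which f integrates to 0 form a Dynkin system, where the complement
  step uses that the coefficient at 0 is the full integral. This system contains the closed sets,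
  which are stable under intersection and generate the Borel sets.\<close>

lemma AE_0_if_fourier_0:
  assumes f: "f \<in> sq_integrable" "\<And>n. fourier f n = 0"
  shows "AE z in circle. f z = 0"
proof (rule circle.density_unique_banach)
  have intf: "integrable circle f" by (rule sq_integrable_integrable[OF f(1)])
  then show "integrable circle f" .
  have meas: "B \<inter> sphere 0 1 \<in> sets circle" if "B \<in> sets borel" for B
    unfolding sets_circle using that by (subst sets_restrict_space_iff) auto
  have cong: "(LINT z:B \<inter> sphere 0 1|circle. f z) = (LINT z|circle. indicat_real B z *\<^sub>R f z)" for B
    unfolding set_lebesgue_integral_def
    by (intro Bochner_Integration.integral_cong) (auto simp: indicator_def)
  have "(LINT z:B \<inter> sphere 0 1|circle. f z) = 0" if "B \<in> sets borel" for B
  proof -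
    have "Int_stable (Collect (closed :: complex set \<Rightarrow> bool))" by (auto simp: Int_stable_def)
    moreover have "Collect closed \<subseteq> Pow (UNIV :: complex set)" by simp
    moreover have "B \<in> sigma_sets UNIV (Collect closed)"
      using that by (simp add: borel_eq_closed)
    ultimately show ?thesis
    proof (induction rule: sigma_sets_induct_disjoint)
      case (basic A)
      then show ?case unfolding cong by (simp add: integral_closed_eq_0[OF f])
    next
      case (compl A)
      have A: "A \<inter> sphere 0 1 \<in> sets circle" using compl(1) by (intro meas) (simp add: borel_eq_closed)
      have "(LINT z:(UNIV - A) \<inter> sphere 0 1|circle. f z) =
          (LINT z|circle. f z - indicat_real (A \<inter> sphere 0 1) z *\<^sub>R f z)"
        unfolding set_lebesgue_integral_def
        by (intro Bochner_Integration.integral_cong) (auto simp: indicator_def)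
      also have "\<dots> = (LINT z|circle. f z) - (LINT z:A \<inter> sphere 0 1|circle. f z)"
        unfolding set_lebesgue_integral_def
        by (intro Bochner_Integration.integral_diff intf integrable_mult_indicator A)
      also have "(LINT z|circle. f z) = 0"
        using f(2)[of 0] by (simp add: fourier_def)
      finally show ?case using compl(2) by simp
    next
      case (union A)
      have A: "A i \<inter> sphere 0 1 \<in> sets circle" for i
        using union(2) by (intro meas) (auto simp: borel_eq_closed)
      have "(LINT z:(\<Union>i. A i \<inter> sphere 0 1)|circle. f z) = (\<Sum>i. (LINT z:(A i \<inter> sphere 0 1)|circle. f z))"
      proof (rule lebesgue_integral_countable_add[OF A])
        show "(A i \<inter> sphere 0 1) \<inter> (A j \<inter> sphere 0 1) = {}" if "i \<noteq> j" for i j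
          using disjoint_family_onD[OF union(1) _ _ that] by auto
        show "set_integrable circle (\<Union>i. A i \<inter> sphere 0 1) f"
          unfolding set_integrable_def by (intro integrable_mult_indicator intf sets.countable_UN image_subsetI A)
      qed
      then show ?case using union(3) by simp
    qed (simp add: set_lebesgue_integral_def)
  qed
  moreover have "\<exists>B\<in>sets borel. A = B \<inter> sphere 0 1" if "A \<in> sets circle" for A
    using that unfolding sets_circle sets_restrict_space by auto
  ultimately show "(LINT z:A|circle. f z) = (LINT z:A|circle. 0)" if "A \<in> sets circle" for A
    using that by (auto simp: set_lebesgue_integral_def)
qed simp

lemma L2_eq_0_if_fourier_0:
  assumes "\<And>n. L2_fourier x n = 0"
  shows "x = 0"
proof (cases x rule: L2_cases)
  case (1 f)
  then have "AE z in circle. f z = 0"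
    using assms by (intro AE_0_if_fourier_0) (simp_all add: L2_fourier_abs)
  then show ?thesis
    unfolding 1(2) zero_L2_abs by (intro abs_L2_eqI 1 sq_integrable_zero)
qed

lemma L2_eqI_fourier: "(\<And>n. L2_fourier x n = L2_fourier y n) \<Longrightarrow> x = y"
  using L2_eq_0_if_fourier_0[of "x - y"] by (simp add: L2_fourier_diff)

section \<open>Multiplication operators\<close>

lemma Linf_norm_le:
  assumes "\<phi> \<in> borel_measurable circle" "AE z in circle. cmod (\<phi> z) \<le> C"
  shows "Linf_norm \<phi> \<le> ereal C"
  unfolding Linf_norm_def by (rule esssup_I) (use assms in auto)

lemma Linf_norm_AE: "Linf_norm \<phi> \<le> ereal C \<Longrightarrow> AE z in circle. cmod (\<phi> z) \<le> C"
  using esssup_AE[of "\<lambda>z. ereal (cmod (\<phi> z))" circle] unfolding Linf_norm_def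
  by (auto elim!: eventually_mono dest: order_trans)

lemma Linf_norm_bound:
  assumes "Linf_norm \<phi> < ereal e" "0 < e"
  obtains r where "0 \<le> r" "r < e" "AE z in circle. cmod (\<phi> z) \<le> r"
proof -
  \<comment> \<open>The norm is an extended real; the value e - 1 covers its formal case of minus
    infinity.\<close>
  obtain r where r: "Linf_norm \<phi> \<le> ereal r" "r < e"
    using assms by (cases "Linf_norm \<phi>") (auto intro: that[of "e - 1"])
  have "AE z in circle. cmod (\<phi> z) \<le> max 0 r"
    using Linf_norm_AE[OF r(1)] by eventually_elim auto
  then show ?thesis using that[of "max 0 r"] r assms(2) by auto
qed

lemma Linf_iff: "\<phi> \<in> Linf \<longleftrightarrow> \<phi> \<in> borel_measurable circle \<and> (\<exists>C. AE z in circle. cmod (\<phi> z) \<le> C)"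
proof
  assume "\<phi> \<in> Linf"
  then have m: "\<phi> \<in> borel_measurable circle" and "Linf_norm \<phi> < \<infinity>" by (auto simp: Linf_def)
  then obtain C where "Linf_norm \<phi> \<le> ereal C"
    by (cases "Linf_norm \<phi>") auto
  with m Linf_norm_AE show "\<phi> \<in> borel_measurable circle \<and> (\<exists>C. AE z in circle. cmod (\<phi> z) \<le> C)"
    by blast
next
  assume "\<phi> \<in> borel_measurable circle \<and> (\<exists>C. AE z in circle. cmod (\<phi> z) \<le> C)"
  then obtain C where m: "\<phi> \<in> borel_measurable circle" and "AE z in circle. cmod (\<phi> z) \<le> C" by blast
  then have "Linf_norm \<phi> \<le> ereal C" by (intro Linf_norm_le)
  then show "\<phi> \<in> Linf" using m by (auto simp: Linf_def intro: le_less_trans)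
qed

lemma Linf_sq_integrable: "\<phi> \<in> Linf \<Longrightarrow> \<phi> \<in> sq_integrable"
  unfolding Linf_iff using sq_integrable_bounded by blast

lemma Linf_mult:
  assumes "\<phi> \<in> Linf" "\<psi> \<in> Linf"
  shows "(\<lambda>z. \<phi> z * \<psi> z) \<in> Linf"
proof -
  obtain C D where "AE z in circle. cmod (\<phi> z) \<le> C" "AE z in circle. cmod (\<psi> z) \<le> D"
    using assms by (auto simp: Linf_iff)
  then have "AE z in circle. cmod (\<phi> z * \<psi> z) \<le> C * D"
    by eventually_elim (auto simp: norm_mult intro!: mult_mono intro: order_trans[OF norm_ge_zero])
  moreover have "\<phi> \<in> borel_measurable circle" "\<psi> \<in> borel_measurable circle"
    using assms by (auto simp: Linf_iff)
  ultimately show ?thesis unfolding Linf_iff by auto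
qed

lemma mult_op_add: "\<phi> \<in> Linf \<Longrightarrow> mult_op \<phi> (x + y) = mult_op \<phi> x + mult_op \<phi> y"
  by (cases x rule: L2_cases; cases y rule: L2_cases)
    (simp add: add_abs mult_op_abs sq_integrable_add Linf_mult_sq_integrable distrib_left)

lemma mult_op_cscale: "\<phi> \<in> Linf \<Longrightarrow> mult_op \<phi> (cscale c x) = cscale c (mult_op \<phi> x)"
  by (cases x rule: L2_cases)
    (simp add: cscale_abs mult_op_abs sq_integrable_cmult Linf_mult_sq_integrable mult.left_commute)

lemma norm_mult_op_le:
  assumes "\<phi> \<in> Linf" "AE z in circle. cmod (\<phi> z) \<le> C" "0 \<le> C"
  shows "norm (mult_op \<phi> x) \<le> C * norm x"
proof (cases x rule: L2_cases)
  case (1 f)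
  have "(LINT z|circle. (cmod (\<phi> z * f z))\<^sup>2) \<le> (LINT z|circle. C\<^sup>2 * (cmod (f z))\<^sup>2)"
  proof (rule integral_mono_AE)
    show "AE z in circle. (cmod (\<phi> z * f z))\<^sup>2 \<le> C\<^sup>2 * (cmod (f z))\<^sup>2"
      using assms(2) by eventually_elim
        (auto simp: norm_mult power_mult_distrib intro!: mult_right_mono power_mono)
  qed (use 1 assms in \<open>auto intro!: sq_integrable_integrable_norm2 Linf_mult_sq_integrable\<close>)
  then have "(norm (mult_op \<phi> x))\<^sup>2 \<le> (C * norm x)\<^sup>2"
    using 1 assms by (simp add: mult_op_abs norm_abs_L2 Linf_mult_sq_integrable power_mult_distrib)
  then show ?thesis using assms(3) by (simp add: power2_le_iff_abs_le)
qed

lemma norm_mult_op_unimodular: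
  assumes "\<phi> \<in> Linf" "AE z in circle. cmod (\<phi> z) = 1"
  shows "norm (mult_op \<phi> x) = norm x"
proof (cases x rule: L2_cases)
  case (1 f)
  have m: "\<phi> \<in> borel_measurable circle" "f \<in> borel_measurable circle"
    using assms 1 by (auto simp: Linf_iff sq_integrable_def)
  have "(LINT z|circle. (cmod (\<phi> z * f z))\<^sup>2) = (LINT z|circle. (cmod (f z))\<^sup>2)"
  proof (rule integral_cong_AE)
    show "AE z in circle. (cmod (\<phi> z * f z))\<^sup>2 = (cmod (f z))\<^sup>2"
      using assms(2) by eventually_elim (simp add: norm_mult)
  qed (use m in measurable)
  then have "(norm (mult_op \<phi> x))\<^sup>2 = (norm x)\<^sup>2"
    using 1 assms by (simp add: mult_op_abs norm_abs_L2 Linf_mult_sq_integrable)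
  then show ?thesis by (simp add: power2_eq_iff_nonneg)
qed

lemma bounded_linear_mult_op:
  assumes "\<phi> \<in> Linf"
  shows "bounded_linear (mult_op \<phi>)"
proof -
  obtain C where C: "AE z in circle. cmod (\<phi> z) \<le> C" using assms by (auto simp: Linf_iff)
  have "AE z in circle. cmod (\<phi> z) \<le> max C 0" using C by eventually_elim auto
  from norm_mult_op_le[OF assms this] have "norm (mult_op \<phi> x) \<le> norm x * max C 0" for x
    by (simp add: mult.commute)
  then show ?thesis
    by (intro bounded_linear_intro)
      (simp_all add: mult_op_add mult_op_cscale scaleR_L2_cscale assms)
qed

text \<open>Pointwise, \<psi> times the conjugate of the unimodular \<phi> is 1 minus a number of
  modulus at most r, so its real part is at least 1 - r; integrate this against |f|^2.\<close>

lemma Re_cinner_mult_op_ge: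
  assumes "\<phi> \<in> Linf" "\<psi> \<in> Linf" "AE z in circle. cmod (\<phi> z) = 1"
    and "AE z in circle. cmod (\<phi> z - \<psi> z) \<le> r"
  shows "(1 - r) * (norm x)\<^sup>2 \<le> Re (cinner (mult_op \<psi> x) (mult_op \<phi> x))"
proof (cases x rule: L2_cases)
  case (1 f)
  have sq: "(\<lambda>z. \<phi> z * f z) \<in> sq_integrable" "(\<lambda>z. \<psi> z * f z) \<in> sq_integrable"
    using 1 assms by (auto intro: Linf_mult_sq_integrable)
  have int: "integrable circle (\<lambda>z. \<psi> z * f z * cnj (\<phi> z * f z))"
    by (rule sq_integrable_mult[OF sq(2,1)])
  have "(1 - r) * (norm x)\<^sup>2 = (LINT z|circle. (1 - r) * (cmod (f z))\<^sup>2)"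
    using 1 by (simp add: norm_abs_L2)
  also have "\<dots> \<le> (LINT z|circle. Re (\<psi> z * f z * cnj (\<phi> z * f z)))"
  proof (rule integral_mono_AE)
    show "AE z in circle. (1 - r) * (cmod (f z))\<^sup>2 \<le> Re (\<psi> z * f z * cnj (\<phi> z * f z))"
      using assms(3,4)
    proof eventually_elim
      case (elim z)
      have "\<psi> z * cnj (\<phi> z) = 1 - (\<phi> z - \<psi> z) * cnj (\<phi> z)"
        using elim(1) complex_norm_square[of "\<phi> z"] by (simp add: algebra_simps)
      moreover have "Re ((\<phi> z - \<psi> z) * cnj (\<phi> z)) \<le> r"
        using complex_Re_le_cmod[of "(\<phi> z - \<psi> z) * cnj (\<phi> z)"] elim by (simp add: norm_mult)
      ultimately have "1 - r \<le> Re (\<psi> z * cnj (\<phi> z))" by simp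
      then have "(1 - r) * (cmod (f z))\<^sup>2 \<le> Re (\<psi> z * cnj (\<phi> z)) * (cmod (f z))\<^sup>2"
        by (intro mult_right_mono) auto
      also have "\<dots> = Re ((\<psi> z * cnj (\<phi> z)) * of_real ((cmod (f z))\<^sup>2))"
        by (simp only: Re_complex_of_real times_complex.sel Im_complex_of_real)
      also have "(\<psi> z * cnj (\<phi> z)) * of_real ((cmod (f z))\<^sup>2) = \<psi> z * f z * cnj (\<phi> z * f z)"
        by (simp only: complex_norm_square complex_cnj_mult ac_simps)
      finally show ?case .
    qed
    show "integrable circle (\<lambda>z. Re (\<psi> z * f z * cnj (\<phi> z * f z)))" by (rule integrable_Re[OF int])
  qed (use 1 in \<open>auto intro!: sq_integrable_integrable_norm2\<close>)
  also have "\<dots> = Re (LINT z|circle. \<psi> z * f z * cnj (\<phi> z * f z))"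
    by (rule integral_Re[OF int])
  also have "\<dots> = Re (cinner (mult_op \<psi> x) (mult_op \<phi> x))"
    using 1 assms sq by (simp add: mult_op_abs cinner_abs)
  finally show ?thesis .
qed

section \<open>Closed complex subspaces and the Hardy space\<close>

definition csubspace_L2 :: "L2 set \<Rightarrow> bool" where
  "csubspace_L2 X \<longleftrightarrow> 0 \<in> X \<and> (\<forall>x\<in>X. \<forall>y\<in>X. x + y \<in> X) \<and> (\<forall>c. \<forall>x\<in>X. cscale c x \<in> X)"

lemma csubspace_L2_subspace: "csubspace_L2 X \<Longrightarrow> subspace X"
  by (auto simp: csubspace_L2_def subspace_def scaleR_L2_cscale)

text \<open>The real projection already works: orthogonality to x kills the real part of the complex
  pairing, and orthogonality to \<open>cscale \<i> x\<close> kills the imaginary part.\<close>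

lemma closed_csubspace_projection:
  assumes "closed X" "csubspace_L2 X"
  obtains p where "p \<in> X" "\<And>x. x \<in> X \<Longrightarrow> cinner x (y - p) = 0"
proof -
  obtain p where p: "p \<in> X" "\<And>x. x \<in> X \<Longrightarrow> inner (y - p) x = 0"
    using closed_subspace_projection[OF assms(1) csubspace_L2_subspace[OF assms(2)]] by metis
  have "cinner x (y - p) = 0" if "x \<in> X" for x
  proof -
    have "Re (cinner x (y - p)) = 0"
      using p(2)[OF that] by (simp add: inner_commute flip: inner_L2_def)
    moreover have "cscale \<i> x \<in> X" using assms(2) that by (simp add: csubspace_L2_def)
    then have "Re (cinner (cscale \<i> x) (y - p)) = 0"
      using p(2) by (simp add: inner_commute flip: inner_L2_def)
    ultimately show ?thesis by (simp add: complex_eq_iff cinner_cscale_left)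
  qed
  with p(1) that show ?thesis by blast
qed

lemma H2_iff: "x \<in> H2 \<longleftrightarrow> (\<forall>n<0. L2_fourier x n = 0)"
  by (simp add: H2_def)

lemma closed_L2_fourier_eq_0: "closed {x. \<forall>n\<in>S. L2_fourier x n = 0}"
  by (intro closed_Collect_all[of "\<lambda>n x. n \<in> S \<longrightarrow> L2_fourier x n = 0", folded Ball_def]
      closed_Collect_imp open_Collect_const closed_Collect_eq continuous_intros)

lemma closed_H2: "closed H2"
  using closed_L2_fourier_eq_0[of "{..<0}"] by (simp add: H2_def Ball_def)

lemma csubspace_H2: "csubspace_L2 H2"
  by (simp add: csubspace_L2_def H2_def L2_fourier_zero L2_fourier_add L2_fourier_cscale)

lemma L2_monom_H2: "0 \<le> n \<Longrightarrow> L2_monom n \<in> H2"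
  by (simp add: H2_def L2_fourier_monom)

text \<open>Density of the polynomials in \<open>H2\<close>, in the form of an induction rule. The
  residual of x after projection onto \<open>S \<inter> H2\<close> has no Fourier coefficients at
  nonnegative indices by orthogonality, and none at negative ones by membership in
  \<open>H2\<close>.\<close>

lemma H2_induct_closed:
  assumes "closed S" "csubspace_L2 S" "\<And>n. L2_monom (int n) \<in> S" "x \<in> H2"
  shows "x \<in> S"
proof -
  have "closed (S \<inter> H2)" "csubspace_L2 (S \<inter> H2)"
    using assms closed_H2 csubspace_H2 by (auto simp: csubspace_L2_def)
  then obtain p where p: "p \<in> S \<inter> H2" "\<And>y. y \<in> S \<inter> H2 \<Longrightarrow> cinner y (x - p) = 0"
    by (rule closed_csubspace_projection[where y = x]) auto
  have "L2_fourier (x - p) n = 0" for n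
  proof (cases "0 \<le> n")
    case True
    then have "L2_monom n \<in> S \<inter> H2" using assms(3)[of "nat n"] L2_monom_H2 by simp
    then show ?thesis using p(2) by (subst L2_fourier_cinner, subst cinner_commute) simp
  next
    case False
    then show ?thesis using p(1) assms(4) by (simp add: H2_iff L2_fourier_diff)
  qed
  then have "x - p = 0" by (rule L2_eq_0_if_fourier_0)
  with p(1) show ?thesis by simp
qed

section \<open>Multiplication of \<open>H2\<close> by elements of \<open>Hinf\<close>\<close>

lemma Hinf_Linf: "\<psi> \<in> Hinf \<Longrightarrow> \<psi> \<in> Linf"
  by (simp add: Hinf_def)

lemma Hinf_H2: "\<psi> \<in> Hinf \<Longrightarrow> abs_L2 \<psi> \<in> H2"
  by (simp add: Hinf_def H2_def L2_fourier_abs Linf_sq_integrable)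

lemma mult_op_monom_fourier:
  "\<psi> \<in> Linf \<Longrightarrow> L2_fourier (mult_op \<psi> (L2_monom k)) n = fourier \<psi> (n - k)"
  by (simp add: L2_monom_def mult_op_abs sq_integrable_powi L2_fourier_abs
      Linf_mult_sq_integrable fourier_mult_powi)

lemma mult_op_H2:
  assumes "\<psi> \<in> Hinf" "x \<in> H2"
  shows "mult_op \<psi> x \<in> H2"
proof -
  have L: "\<psi> \<in> Linf" using assms(1) by (rule Hinf_Linf)
  let ?S = "{x. mult_op \<psi> x \<in> H2}"
  have "x \<in> ?S"
  proof (rule H2_induct_closed)
    have "?S = mult_op \<psi> -` H2" by auto
    then show "closed ?S"
      by (simp add: continuous_closed_vimage[OF closed_H2] linear_continuous_at[OF bounded_linear_mult_op[OF L]])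
    show "csubspace_L2 ?S"
      using csubspace_H2 linear_0[OF bounded_linear.linear[OF bounded_linear_mult_op[OF L]]]
      by (simp add: csubspace_L2_def mult_op_add mult_op_cscale L)
    show "L2_monom (int n) \<in> ?S" for n
      using assms(1) by (simp add: H2_iff mult_op_monom_fourier L) (simp add: Hinf_def)
  qed fact
  then show ?thesis by simp
qed

text \<open>The Cauchy product formula. For fixed n both sides are continuous and linear in x, so it
  is enough to compare them on monomials, and no infinite sums have to be interchanged.\<close>

lemma mult_op_fourier:
  assumes "\<psi> \<in> Hinf" "x \<in> H2"
  shows "L2_fourier (mult_op \<psi> x) (int n) = (\<Sum>k\<le>n. L2_fourier x (int k) * fourier \<psi> (int (n - k)))"
proof -
  have L: "\<psi> \<in> Linf" using assms(1) by (rule Hinf_Linf)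
  let ?S = "{x. L2_fourier (mult_op \<psi> x) (int n) = (\<Sum>k\<le>n. L2_fourier x (int k) * fourier \<psi> (int (n - k)))}"
  have "x \<in> ?S"
  proof (rule H2_induct_closed)
    show "closed ?S"
      by (intro closed_Collect_eq continuous_intros
          bounded_linear.continuous_on[OF bounded_linear_mult_op[OF L]] continuous_on_id)
    show "csubspace_L2 ?S"
      using linear_0[OF bounded_linear.linear[OF bounded_linear_mult_op[OF L]]]
      by (simp add: csubspace_L2_def mult_op_add mult_op_cscale L L2_fourier_zero L2_fourier_add
          L2_fourier_cscale distrib_right sum.distrib sum_distrib_left mult.assoc)
    show "L2_monom (int m) \<in> ?S" for m
    proof -
      have "(\<Sum>k\<le>n. L2_fourier (L2_monom (int m)) (int k) * fourier \<psi> (int (n - k))) =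
          (\<Sum>k\<le>n. if k = m then fourier \<psi> (int (n - k)) else 0)"
        by (intro sum.cong) (auto simp: L2_fourier_monom)
      also have "\<dots> = (if m \<le> n then fourier \<psi> (int (n - m)) else 0)" by simp
      \<comment> \<open>For m > n the index on the right is negative, where the coefficients of an
        element of \<open>Hinf\<close> vanish.\<close>
      also have "\<dots> = fourier \<psi> (int n - int m)"
        using assms(1) by (auto simp: of_nat_diff Hinf_def)
      finally show ?thesis by (simp add: mult_op_monom_fourier L)
    qed
  qed fact
  then show ?thesis by simp
qed

lemma Hinf_mult:
  assumes "\<phi> \<in> Hinf" "\<psi> \<in> Hinf"
  shows "(\<lambda>z. \<phi> z * \<psi> z) \<in> Hinf"
    and "fourier (\<lambda>z. \<phi> z * \<psi> z) (int n) = (\<Sum>k\<le>n. fourier \<psi> (int k) * fourier \<phi> (int (n - k)))"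
proof -
  have L: "\<phi> \<in> Linf" "\<psi> \<in> Linf" using assms by (auto simp: Hinf_Linf)
  have sq: "(\<lambda>z. \<phi> z * \<psi> z) \<in> sq_integrable" by (intro Linf_sq_integrable Linf_mult L)
  have eq: "mult_op \<phi> (abs_L2 \<psi>) = abs_L2 (\<lambda>z. \<phi> z * \<psi> z)"
    by (rule mult_op_abs[OF L(1) Linf_sq_integrable[OF L(2)]])
  show "(\<lambda>z. \<phi> z * \<psi> z) \<in> Hinf"
    using mult_op_H2[OF assms(1) Hinf_H2[OF assms(2)]] Linf_mult[OF L]
    by (simp add: eq H2_iff L2_fourier_abs sq Hinf_def)
  show "fourier (\<lambda>z. \<phi> z * \<psi> z) (int n) = (\<Sum>k\<le>n. fourier \<psi> (int k) * fourier \<phi> (int (n - k)))"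
    using mult_op_fourier[OF assms(1) Hinf_H2[OF assms(2)], of n]
    by (simp add: eq L2_fourier_abs sq Linf_sq_integrable[OF L(2)])
qed

section \<open>Extension to the disk by power series\<close>

lemma summable_norm_fourier:
  assumes "f \<in> sq_integrable" "cmod z < 1"
  shows "summable (\<lambda>n. norm (fourier f (int n) * z ^ n))"
proof (rule summable_comparison_test)
  have "norm (norm (fourier f (int n) * z ^ n)) \<le> norm (abs_L2 f) * cmod z ^ n" for n
    using norm_L2_fourier_le[of "abs_L2 f" "int n"] assms(1)
    by (simp add: L2_fourier_abs norm_mult norm_power mult_right_mono)
  then show "\<exists>N. \<forall>n\<ge>N. norm (norm (fourier f (int n) * z ^ n)) \<le> norm (abs_L2 f) * cmod z ^ n" by blast
  show "summable (\<lambda>n. norm (abs_L2 f) * cmod z ^ n)"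
    using assms(2) by (intro summable_mult summable_geometric) simp
qed

lemma disk_ext_0: "disk_ext f 0 = fourier f 0"
  unfolding disk_ext_def by simp

lemma deriv_disk_ext_0:
  assumes "f \<in> sq_integrable"
  shows "deriv (disk_ext f) 0 = fourier f 1"
proof -
  have "((\<lambda>z. \<Sum>n. fourier f (int n) * z ^ n) has_field_derivative
      (\<Sum>n. diffs (\<lambda>n. fourier f (int n)) n * 0 ^ n)) (at 0)"
    by (rule termdiffs_strong'[where K = 1])
      (auto intro: summable_norm_cancel[OF summable_norm_fourier[OF assms]])
  then have "(disk_ext f has_field_derivative fourier f 1) (at 0)"
    by (simp add: diffs_def disk_ext_def[abs_def])
  then show ?thesis by (rule DERIV_imp_deriv)
qed

lemma disk_ext_mult:
  assumes "\<phi> \<in> Hinf" "\<psi> \<in> Hinf" "cmod z < 1"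
  shows "disk_ext (\<lambda>z. \<phi> z * \<psi> z) z = disk_ext \<phi> z * disk_ext \<psi> z"
proof -
  have "disk_ext \<psi> z * disk_ext \<phi> z =
      (\<Sum>n. \<Sum>i\<le>n. (fourier \<psi> (int i) * z ^ i) * (fourier \<phi> (int (n - i)) * z ^ (n - i)))"
    unfolding disk_ext_def using assms
    by (intro Cauchy_product summable_norm_fourier Linf_sq_integrable Hinf_Linf)
  also have "\<dots> = disk_ext (\<lambda>z. \<phi> z * \<psi> z) z"
    unfolding disk_ext_def
  proof (intro suminf_cong)
    fix n
    have "(\<Sum>i\<le>n. (fourier \<psi> (int i) * z ^ i) * (fourier \<phi> (int (n - i)) * z ^ (n - i))) =
        (\<Sum>i\<le>n. fourier \<psi> (int i) * fourier \<phi> (int (n - i)) * z ^ n)"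
    proof (rule sum.cong)
      fix i assume "i \<in> {..n}"
      then have "z ^ n = z ^ i * z ^ (n - i)" by (simp flip: power_add)
      then show "(fourier \<psi> (int i) * z ^ i) * (fourier \<phi> (int (n - i)) * z ^ (n - i)) =
          fourier \<psi> (int i) * fourier \<phi> (int (n - i)) * z ^ n" by simp
    qed simp
    then show "(\<Sum>i\<le>n. (fourier \<psi> (int i) * z ^ i) * (fourier \<phi> (int (n - i)) * z ^ (n - i))) =
        fourier (\<lambda>z. \<phi> z * \<psi> z) (int n) * z ^ n"
      by (simp only: Hinf_mult(2)[OF assms(1,2)] sum_distrib_right)
  qed
  finally show ?thesis by (simp add: mult.commute)
qed

lemma Hinf_one: "(\<lambda>_. 1) \<in> Hinf"
  by (auto simp: Hinf_def Linf_iff fourier_one intro: exI[of _ 1])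

lemma disk_ext_one: "disk_ext (\<lambda>_. 1) z = 1"
proof -
  have "disk_ext (\<lambda>_. 1) z = (\<Sum>n\<in>{0}. fourier (\<lambda>_. 1) (int n) * z ^ n)"
    unfolding disk_ext_def by (rule suminf_finite) (auto simp: fourier_one)
  then show ?thesis by (simp add: fourier_one)
qed

lemma disk_ext_eq_imp_fourier_eq:
  assumes sq: "f \<in> sq_integrable" "g \<in> sq_integrable"
    and eq: "\<And>z. cmod z < 1 \<Longrightarrow> disk_ext f z = disk_ext g z"
  shows "fourier f (int n) = fourier g (int n)"
proof -
  define F where "F h = Abs_fps (\<lambda>n. fourier h (int n))" for h
  have ev: "eval_fps (F h) z = disk_ext h z" for h z
    by (simp add: F_def eval_fps_def disk_ext_def)
  have rad: "0 < fps_conv_radius (F h)" if "h \<in> sq_integrable" for h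
  proof -
    \<comment> \<open>Convergence at one nonzero point, here 1/2, makes the radius of convergence
      positive, as comparison of formal power series requires.\<close>
    have "summable (\<lambda>n. fourier h (int n) * (1/2) ^ n)"
      by (intro summable_norm_cancel[OF summable_norm_fourier[OF that]]) (simp add: norm_divide)
    from conv_radius_geI[OF this] have "ereal (1/2) \<le> fps_conv_radius (F h)"
      by (simp add: F_def fps_conv_radius_def norm_divide)
    then show ?thesis by (rule less_le_trans[rotated]) simp
  qed
  have "eventually (\<lambda>z. z \<in> ball 0 1) (nhds (0::complex))"
    by (rule eventually_nhds_in_open) auto
  then have "eventually (\<lambda>z. eval_fps (F f) z = eval_fps (F g) z) (nhds 0)"
    by eventually_elim (simp add: ev eq)
  then have "F f = F g" by (intro eval_fps_eqD rad sq)
  then show ?thesis by (metis F_def fps_nth_Abs_fps)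
qed

lemma neil_algebra_iff: "\<psi> \<in> neil_algebra \<longleftrightarrow> \<psi> \<in> Hinf \<and> fourier \<psi> 1 = 0"
  unfolding neil_algebra_def using deriv_disk_ext_0 Hinf_Linf Linf_sq_integrable by force

text \<open>Moves invertibility from the disk to the circle, the form used from here on. Both
  directions rest on multiplicativity of \<open>disk_ext\<close>; from disk to circle, equal power
  series give equal Fourier coefficients, which determine the function almost everywhere.\<close>

lemma neil_invertible_iff:
  "\<psi> \<in> neil_invertible \<longleftrightarrow>
    \<psi> \<in> neil_algebra \<and> (\<exists>\<eta>\<in>neil_algebra. AE z in circle. \<psi> z * \<eta> z = 1)"
proof
  assume "\<psi> \<in> neil_invertible"
  then obtain \<eta> where \<psi>: "\<psi> \<in> neil_algebra" and \<eta>: "\<eta> \<in> neil_algebra"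
    and nz: "\<And>z. cmod z < 1 \<Longrightarrow> disk_ext \<psi> z \<noteq> 0"
    and inv: "\<And>z. cmod z < 1 \<Longrightarrow> disk_ext \<eta> z = 1 / disk_ext \<psi> z"
    unfolding neil_invertible_def by auto
  have H: "\<psi> \<in> Hinf" "\<eta> \<in> Hinf" using \<psi> \<eta> by (simp_all add: neil_algebra_iff)
  have sq: "(\<lambda>z. \<psi> z * \<eta> z) \<in> sq_integrable" "(\<lambda>_. 1) \<in> sq_integrable"
    using H Hinf_mult(1) Hinf_one Hinf_Linf Linf_sq_integrable by blast+
  have "disk_ext (\<lambda>z. \<psi> z * \<eta> z) z = disk_ext (\<lambda>_. 1) z" if "cmod z < 1" for z
    using nz[OF that] inv[OF that] by (simp add: disk_ext_mult H that disk_ext_one)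
  then have "fourier (\<lambda>z. \<psi> z * \<eta> z) (int n) = fourier (\<lambda>_. 1) (int n)" for n
    by (rule disk_ext_eq_imp_fourier_eq[OF sq])
  then have "fourier (\<lambda>z. \<psi> z * \<eta> z) n = fourier (\<lambda>_. 1) n" if "0 \<le> n" for n
    using that by (metis nonneg_int_cases)
  moreover have "fourier (\<lambda>z. \<psi> z * \<eta> z) n = fourier (\<lambda>_. 1) n" if "n < 0" for n
    using that Hinf_mult(1)[OF H] Hinf_one unfolding Hinf_def by simp
  ultimately have "abs_L2 (\<lambda>z. \<psi> z * \<eta> z) = abs_L2 (\<lambda>_. 1)"
    by (intro L2_eqI_fourier) (metis L2_fourier_abs sq not_le)
  then have "AE z in circle. \<psi> z * \<eta> z = 1" by (rule abs_L2_eqD[OF sq])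
  with \<psi> \<eta> show "\<psi> \<in> neil_algebra \<and> (\<exists>\<eta>\<in>neil_algebra. AE z in circle. \<psi> z * \<eta> z = 1)" by blast
next
  assume "\<psi> \<in> neil_algebra \<and> (\<exists>\<eta>\<in>neil_algebra. AE z in circle. \<psi> z * \<eta> z = 1)"
  then obtain \<eta> where \<psi>: "\<psi> \<in> neil_algebra" and \<eta>: "\<eta> \<in> neil_algebra"
    and eq: "AE z in circle. \<psi> z * \<eta> z = 1" by blast
  have H: "\<psi> \<in> Hinf" "\<eta> \<in> Hinf" using \<psi> \<eta> by (simp_all add: neil_algebra_iff)
  have sq: "(\<lambda>z. \<psi> z * \<eta> z) \<in> sq_integrable" "(\<lambda>_. 1) \<in> sq_integrable"
    using H Hinf_mult(1) Hinf_one Hinf_Linf Linf_sq_integrable by blast+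
  have "fourier (\<lambda>z. \<psi> z * \<eta> z) = fourier (\<lambda>_. 1)"
    using abs_L2_eqI[OF sq eq] sq by (metis L2_fourier_abs)
  then have "disk_ext (\<lambda>z. \<psi> z * \<eta> z) z = 1" for z
    using disk_ext_one[of z] by (simp add: disk_ext_def)
  then have "disk_ext \<psi> z * disk_ext \<eta> z = 1" if "cmod z < 1" for z
    using disk_ext_mult[OF H that] by simp
  then have "disk_ext \<psi> z \<noteq> 0 \<and> disk_ext \<eta> z = 1 / disk_ext \<psi> z" if "cmod z < 1" for z
    using that by (metis mult_zero_left nonzero_mult_div_cancel_left zero_neq_one)
  then show "\<psi> \<in> neil_invertible"
    unfolding neil_invertible_def using \<psi> \<eta> by (auto intro!: bexI[of _ \<eta>])
qed

section \<open>Toeplitz operators\<close>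

lemma H2_sub_iff:
  "x \<in> H2_sub (a, b) \<longleftrightarrow> x \<in> H2 \<and> L2_fourier x 0 * b = L2_fourier x 1 * a"
proof (cases x rule: L2_cases)
  case (1 f)
  then have "L2_disk_ext x = disk_ext f" by (simp add: L2_disk_ext.abs_eq)
  with 1 show ?thesis
    by (simp add: H2_sub_def disk_ext_0 deriv_disk_ext_0 L2_fourier_abs)
qed

lemma closed_H2_sub: "closed (H2_sub \<alpha>)"
proof -
  obtain a b where "\<alpha> = (a, b)" by (cases \<alpha>)
  then have "H2_sub \<alpha> = H2 \<inter> {x. L2_fourier x 0 * b = L2_fourier x 1 * a}"
    by (auto simp: H2_sub_iff)
  moreover have "closed {x. L2_fourier x 0 * b = L2_fourier x 1 * a}"
    by (intro closed_Collect_eq continuous_intros continuous_on_id)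
  ultimately show ?thesis using closed_H2 by auto
qed

lemma csubspace_H2_sub: "csubspace_L2 (H2_sub \<alpha>)"
  using csubspace_H2 by (cases \<alpha>)
    (auto simp: csubspace_L2_def H2_sub_iff L2_fourier_zero L2_fourier_add L2_fourier_cscale distrib_right)

lemma csubspace_L2_diff: "csubspace_L2 X \<Longrightarrow> x \<in> X \<Longrightarrow> y \<in> X \<Longrightarrow> x - y \<in> X"
  by (intro subspace_diff csubspace_L2_subspace)

lemma csubspace_L2_cinner_eqI:
  assumes "csubspace_L2 X" "x \<in> X" "y \<in> X" "\<And>h. h \<in> X \<Longrightarrow> cinner h x = cinner h y"
  shows "x = y"
proof -
  have "cinner (x - y) (x - y) = 0"
    using assms(4)[OF csubspace_L2_diff[OF assms(1-3)]] by (simp add: cinner.diff_right)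
  then show ?thesis by (simp add: cinner_self)
qed

text \<open>The adjoint of the inclusion is the orthogonal projection onto X. Its existence and
  uniqueness give the definite description in \<open>adjoint_on\<close> its meaning.\<close>

lemma adjoint_on_inclusion:
  assumes "closed X" "csubspace_L2 X"
  shows "adjoint_on X inclusion g \<in> X"
    and "h \<in> X \<Longrightarrow> cinner h (adjoint_on X inclusion g) = cinner h g"
proof -
  obtain p where p: "p \<in> X" "\<And>x. x \<in> X \<Longrightarrow> cinner x (g - p) = 0"
    using closed_csubspace_projection[OF assms] by metis
  have "\<exists>!f. f \<in> X \<and> (\<forall>h\<in>X. cinner (inclusion h) g = cinner h f)"
  proof (rule ex1I)
    show "p \<in> X \<and> (\<forall>h\<in>X. cinner (inclusion h) g = cinner h p)"
      using p by (simp add: inclusion_def cinner.diff_right)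
    show "f = p" if "f \<in> X \<and> (\<forall>h\<in>X. cinner (inclusion h) g = cinner h f)" for f
      using that p by (intro csubspace_L2_cinner_eqI[OF assms(2)]) (auto simp: inclusion_def cinner.diff_right)
  qed
  from theI'[OF this]
  have "adjoint_on X inclusion g \<in> X \<and> (\<forall>h\<in>X. cinner (inclusion h) g = cinner h (adjoint_on X inclusion g))"
    unfolding adjoint_on_def .
  then show "adjoint_on X inclusion g \<in> X"
    and "h \<in> X \<Longrightarrow> cinner h (adjoint_on X inclusion g) = cinner h g"
    by (auto simp: inclusion_def)
qed

lemma adjoint_on_inclusion_linear:
  assumes X: "closed X" "csubspace_L2 X"
  shows "adjoint_on X inclusion (x + y) = adjoint_on X inclusion x + adjoint_on X inclusion y"
    and "adjoint_on X inclusion (cscale c x) = cscale c (adjoint_on X inclusion x)"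
    and "norm (adjoint_on X inclusion x) \<le> norm x"
    and "x \<in> X \<Longrightarrow> adjoint_on X inclusion x = x"
proof -
  let ?P = "adjoint_on X inclusion"
  note P = adjoint_on_inclusion[OF X]
  show "?P (x + y) = ?P x + ?P y"
    using P X(2) by (intro csubspace_L2_cinner_eqI[OF X(2)])
      (auto simp: csubspace_L2_def cinner_add_right)
  show "?P (cscale c x) = cscale c (?P x)"
    using P X(2) by (intro csubspace_L2_cinner_eqI[OF X(2)])
      (auto simp: csubspace_L2_def cinner_cscale_right)
  show "?P x = x" if "x \<in> X"
    using P that by (intro csubspace_L2_cinner_eqI[OF X(2)]) auto
  have "complex_of_real ((norm (?P x))\<^sup>2) = cinner (?P x) x"
    unfolding cinner_self[symmetric] by (rule P(2)[OF P(1)])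
  then have "(norm (?P x))\<^sup>2 = cmod (cinner (?P x) x)"
    by (metis abs_power2 norm_of_real power2_abs real_norm_def)
  also have "\<dots> \<le> norm (?P x) * norm x" by (rule cinner_Cauchy_Schwarz)
  finally have "norm (?P x) * norm (?P x) \<le> norm (?P x) * norm x" by (simp add: power2_eq_square)
  then show "norm (?P x) \<le> norm x" by (cases "norm (?P x) = 0") (auto simp: mult_le_cancel_left)
qed

lemma bounded_linear_adjoint_on_inclusion:
  assumes "closed X" "csubspace_L2 X"
  shows "bounded_linear (adjoint_on X inclusion)"
  by (rule bounded_linear_intro[where K = 1])
    (simp_all add: adjoint_on_inclusion_linear[OF assms] scaleR_L2_cscale)

lemma toeplitz_in_H2_sub: "toeplitz \<alpha> \<phi> x \<in> H2_sub \<alpha>"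
  by (simp add: toeplitz_def adjoint_on_inclusion closed_H2_sub csubspace_H2_sub)

lemma cinner_toeplitz: "h \<in> H2_sub \<alpha> \<Longrightarrow> cinner h (toeplitz \<alpha> \<phi> x) = cinner h (mult_op \<phi> x)"
  by (simp add: toeplitz_def adjoint_on_inclusion closed_H2_sub csubspace_H2_sub) (simp add: inclusion_def)

lemma toeplitz_cscale:
  "\<phi> \<in> Linf \<Longrightarrow> toeplitz \<alpha> \<phi> (cscale c x) = cscale c (toeplitz \<alpha> \<phi> x)"
  by (simp add: toeplitz_def inclusion_def mult_op_cscale adjoint_on_inclusion_linear closed_H2_sub csubspace_H2_sub)

lemma bounded_linear_toeplitz:
  assumes "\<phi> \<in> Linf"
  shows "bounded_linear (toeplitz \<alpha> \<phi>)"
proof -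
  have "bounded_linear (\<lambda>x. adjoint_on (H2_sub \<alpha>) inclusion (mult_op \<phi> x))"
    by (intro bounded_linear_compose[OF bounded_linear_adjoint_on_inclusion]
        bounded_linear_mult_op assms closed_H2_sub csubspace_H2_sub)
  then show ?thesis by (simp add: toeplitz_def inclusion_def comp_def)
qed

section \<open>Operators bounded below and left inverses\<close>

lemma closed_bounded_below_image:
  fixes T :: "L2 \<Rightarrow> L2"
  assumes X: "closed X" "csubspace_L2 X" and T: "bounded_linear T" "\<And>c x. T (cscale c x) = cscale c (T x)"
    and c: "0 < c" "\<And>x. x \<in> X \<Longrightarrow> c * norm x \<le> norm (T x)"
  shows "closed (T ` X)" "csubspace_L2 (T ` X)"
proof -
  have "complete (T ` X)"
    using c X by (intro complete_isometric_image[OF c(1) csubspace_L2_subspace[OF X(2)] T(1)])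
      (auto simp: complete_eq_closed)
  then show "closed (T ` X)" by (rule complete_imp_closed)
  have "0 \<in> T ` X"
    using X(2) linear_0[OF bounded_linear.linear[OF T(1)]] by (force simp: csubspace_L2_def)
  moreover have "T x + T y \<in> T ` X" if "x \<in> X" "y \<in> X" for x y
    using that X(2) linear_add[OF bounded_linear.linear[OF T(1)], of x y]
    by (auto simp: csubspace_L2_def intro!: image_eqI[of _ T "x + y"])
  moreover have "cscale d (T x) \<in> T ` X" if "x \<in> X" for d x
    using that X(2) T(2)[of d x] by (auto simp: csubspace_L2_def intro!: image_eqI[of _ T "cscale d x"])
  ultimately show "csubspace_L2 (T ` X)" unfolding csubspace_L2_def by blast
qed

text \<open>The range is closed, so a left inverse is obtained by first projecting orthogonally onto
  the range and then inverting T there. If the range is X, the projection is the identity on X and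
  the inverse is two-sided.\<close>

lemma bounded_below_left_invertible:
  fixes T :: "L2 \<Rightarrow> L2"
  assumes X: "closed X" "csubspace_L2 X" and T: "bounded_linear T" "\<And>c x. T (cscale c x) = cscale c (T x)"
    and c: "0 < c" "\<And>x. x \<in> X \<Longrightarrow> c * norm x \<le> norm (T x)"
  shows "left_invertible_on X T"
    and "T ` X = X \<Longrightarrow> invertible_on X T"
proof -
  have R: "closed (T ` X)" "csubspace_L2 (T ` X)"
    using c by (intro closed_bounded_below_image[OF X T]; blast)+
  note lin = bounded_linear.linear[OF T(1)]
  note P = adjoint_on_inclusion[OF R] and P_lin = adjoint_on_inclusion_linear[OF R]
  have inj: "x = y" if "x \<in> X" "y \<in> X" "T x = T y" for x y
  proof -
    have "c * norm (x - y) \<le> 0"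
      using c(2)[OF csubspace_L2_diff[OF X(2) that(1,2)]] that(3) by (simp add: linear_diff[OF lin])
    then show ?thesis using c(1) by (simp add: mult_le_0_iff)
  qed
  define S where "S g = inv_into X T (adjoint_on (T ` X) inclusion g)" for g
  have S_in: "S g \<in> X" and TS: "T (S g) = adjoint_on (T ` X) inclusion g" for g
    unfolding S_def by (simp_all only: inv_into_into[OF P(1)] f_inv_into_f[OF P(1)])
  have X_add: "x + y \<in> X" if "x \<in> X" "y \<in> X" for x y
    using X(2) that by (simp add: csubspace_L2_def)
  have X_sc: "cscale d x \<in> X" if "x \<in> X" for d x
    using X(2) that by (simp add: csubspace_L2_def)
  have "bounded_op_on X S"
    unfolding bounded_op_on_def
  proof (intro conjI ballI allI exI)
    show "S f \<in> X" for f by (rule S_in)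
    show "S (f + g) = S f + S g" for f g
      by (rule inj) (simp_all add: S_in X_add linear_add[OF lin] TS P_lin)
    show "S (cscale d f) = cscale d (S f)" for d f
      by (rule inj) (simp_all add: S_in X_sc T(2) TS P_lin)
    show "norm (S f) \<le> (1 / c) * norm f" for f
      using c(2)[OF S_in[of f]] P_lin(3)[of f] c(1) by (simp add: TS field_simps)
  qed
  moreover have ST: "S (T f) = f" if "f \<in> X" for f
    by (rule inj) (use that in \<open>simp_all add: S_in TS P_lin\<close>)
  ultimately show "left_invertible_on X T" unfolding left_invertible_on_def by blast
  show "invertible_on X T" if img: "T ` X = X"
  proof -
    have TS': "T (S f) = f" if "f \<in> X" for f
    proof -
      have "f \<in> T ` X" unfolding img by (rule that)
      then show ?thesis unfolding TS by (rule P_lin(4))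
    qed
    show ?thesis
      unfolding invertible_on_def
      by (intro exI[of _ S] conjI ballI \<open>bounded_op_on X S\<close> ST TS')
  qed
qed

lemma left_invertible_bounded_below:
  assumes "left_invertible_on X T" "\<And>x. x \<in> X \<Longrightarrow> T x \<in> X"
  shows "\<exists>c>0. \<forall>x\<in>X. c * norm x \<le> norm (T x)"
proof -
  obtain S C where S: "\<And>x. x \<in> X \<Longrightarrow> S (T x) = x" "\<And>x. x \<in> X \<Longrightarrow> norm (S x) \<le> C * norm x"
    using assms(1) unfolding left_invertible_on_def bounded_op_on_def by blast
  \<comment> \<open>The bound C for S need not be positive, hence the maximum with 1.\<close>
  have "1 / max C 1 * norm x \<le> norm (T x)" if "x \<in> X" for x
  proof -
    have "norm x \<le> C * norm (T x)" using S(1)[OF that] S(2)[OF assms(2)[OF that]] by simp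
    also have "\<dots> \<le> max C 1 * norm (T x)" by (intro mult_right_mono) auto
    finally show ?thesis by (simp add: field_simps)
  qed
  then show ?thesis by (intro exI[of _ "1 / max C 1"]) auto
qed

text \<open>Because \<psi>'(0) = 0, multiplication by \<psi> scales the value and the derivative at
  0 by the same number \<psi>(0), which respects the linear relation between them that defines
  \<open>H2_sub \<alpha>\<close>.\<close>

lemma mult_op_H2_sub:
  assumes "\<psi> \<in> neil_algebra" "x \<in> H2_sub \<alpha>"
  shows "mult_op \<psi> x \<in> H2_sub \<alpha>"
proof -
  obtain a b where [simp]: "\<alpha> = (a, b)" by (cases \<alpha>)
  have \<psi>: "\<psi> \<in> Hinf" "fourier \<psi> 1 = 0" using assms(1) by (simp_all add: neil_algebra_iff)
  have x: "x \<in> H2" "L2_fourier x 0 * b = L2_fourier x 1 * a" using assms(2) by (simp_all add: H2_sub_iff)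
  have 0: "L2_fourier (mult_op \<psi> x) 0 = L2_fourier x 0 * fourier \<psi> 0"
    using mult_op_fourier[OF \<psi>(1) x(1), of 0] by simp
  have 1: "L2_fourier (mult_op \<psi> x) 1 = L2_fourier x 1 * fourier \<psi> 0"
    using mult_op_fourier[OF \<psi>(1) x(1), of 1] \<psi>(2) by simp
  show ?thesis
    using mult_op_H2[OF \<psi>(1) x(1)] x(2) by (simp add: H2_sub_iff 0 1 mult.assoc mult.left_commute[of _ "fourier \<psi> 0"])
qed

lemma Linf_dist_less_1D:
  assumes "Linf_dist \<phi> A < 1"
  obtains \<psi> r where "\<psi> \<in> A" "0 \<le> r" "r < 1" "AE z in circle. cmod (\<phi> z - \<psi> z) \<le> r"
proof -
  obtain \<psi> where "\<psi> \<in> A" "Linf_norm (\<lambda>z. \<phi> z - \<psi> z) < ereal 1"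
    using assms unfolding Linf_dist_def INF_less_iff one_ereal_def by blast
  moreover from this(2) zero_less_one obtain r
    where "0 \<le> r" "r < 1" "AE z in circle. cmod (\<phi> z - \<psi> z) \<le> r"
    by (rule Linf_norm_bound)
  ultimately show ?thesis using that by blast
qed

lemma Linf_dist_less_1I:
  assumes "\<phi> \<in> Linf" "\<psi> \<in> Linf" "\<psi> \<in> A" "r < 1" "AE z in circle. cmod (\<phi> z - \<psi> z) \<le> r"
  shows "Linf_dist \<phi> A < 1"
proof -
  have m: "\<phi> \<in> borel_measurable circle" "\<psi> \<in> borel_measurable circle"
    using assms by (auto simp: Linf_iff)
  have "Linf_norm (\<lambda>z. \<phi> z - \<psi> z) \<le> ereal r"
    by (intro Linf_norm_le assms) (use m in measurable)
  also have "\<dots> < 1" using assms(4) by (simp add: one_ereal_def)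
  finally show ?thesis unfolding Linf_dist_def INF_less_iff using assms(3) by blast
qed

section \<open>From an approximating element of the Neil algebra to Toeplitz operators\<close>

locale unimodular_near_neil =
  fixes \<phi> \<psi> :: "complex \<Rightarrow> complex" and r :: real
  assumes \<phi>: "\<phi> \<in> Linf" and unimod: "AE z in circle. cmod (\<phi> z) = 1"
    and \<psi>: "\<psi> \<in> neil_algebra"
    and r: "0 \<le> r" "r < 1" and near: "AE z in circle. cmod (\<phi> z - \<psi> z) \<le> r"
begin

lemma \<psi>_Linf: "\<psi> \<in> Linf"
  using \<psi> by (simp add: neil_algebra_iff Hinf_Linf)

lemma \<psi>_AE: "AE z in circle. 1 - r \<le> cmod (\<psi> z) \<and> cmod (\<psi> z) \<le> 1 + r"
  using unimod near
proof eventually_elim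
  case (elim z)
  then show ?case
    using norm_triangle_ineq2[of "\<phi> z" "\<psi> z"] norm_triangle_ineq3[of "\<phi> z" "\<psi> z"] by linarith
qed

lemma Re_cinner_ge: "(1 - r) * (norm x)\<^sup>2 \<le> Re (cinner (mult_op \<psi> x) (mult_op \<phi> x))"
  by (rule Re_cinner_mult_op_ge[OF \<phi> \<psi>_Linf unimod near])

text \<open>Since \<psi> x stays in \<open>H2_sub \<alpha>\<close>, its pairing with T x equals that
  with \<phi> x. The numerator 1 - r bounds this pairing from below, and the denominator 1 + r comes
  from |\<psi>| \<le> 1 + r in Cauchy-Schwarz.\<close>

lemma toeplitz_bounded_below:
  assumes "x \<in> H2_sub \<alpha>"
  shows "(1 - r) / (1 + r) * norm x \<le> norm (toeplitz \<alpha> \<phi> x)"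
proof (cases "x = 0")
  case False
  have "(1 - r) * (norm x)\<^sup>2 \<le> Re (cinner (mult_op \<psi> x) (mult_op \<phi> x))" by (rule Re_cinner_ge)
  also have "\<dots> = Re (cinner (mult_op \<psi> x) (toeplitz \<alpha> \<phi> x))"
    by (simp add: cinner_toeplitz mult_op_H2_sub[OF \<psi> assms])
  also have "\<dots> \<le> norm (mult_op \<psi> x) * norm (toeplitz \<alpha> \<phi> x)"
    using complex_Re_le_cmod cinner_Cauchy_Schwarz by (rule order_trans)
  also have "\<dots> \<le> ((1 + r) * norm x) * norm (toeplitz \<alpha> \<phi> x)"
    using \<psi>_AE r by (intro mult_right_mono norm_mult_op_le \<psi>_Linf) (auto elim: eventually_mono)
  finally have "((1 - r) * norm x) * norm x \<le> ((1 + r) * norm (toeplitz \<alpha> \<phi> x)) * norm x"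
    by (simp add: power2_eq_square ac_simps)
  then have "(1 - r) * norm x \<le> (1 + r) * norm (toeplitz \<alpha> \<phi> x)"
    using False by (simp add: mult_le_cancel_right)
  then show ?thesis using r by (simp add: field_simps)
qed simp

lemma toeplitz_left_invertible: "left_invertible_on (H2_sub \<alpha>) (toeplitz \<alpha> \<phi>)"
  using r by (intro bounded_below_left_invertible(1)[where c = "(1 - r) / (1 + r)"] closed_H2_sub
      csubspace_H2_sub bounded_linear_toeplitz toeplitz_cscale toeplitz_bounded_below \<phi>) auto

text \<open>The pairing of \<psi> f with T f has real part at least (1 - r) |f|^2. This coercivity
  drives both transfers of invertibility, from \<psi> to T and from T to \<psi>.\<close>

lemma eq_0_if_orthogonal:
  assumes "f \<in> H2_sub \<alpha>" "cinner (mult_op \<psi> f) (toeplitz \<alpha> \<phi> f) = 0"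
  shows "f = 0"
proof -
  have "(1 - r) * (norm f)\<^sup>2 \<le> 0"
    using Re_cinner_ge[of f] assms by (simp add: cinner_toeplitz mult_op_H2_sub[OF \<psi>])
  then show ?thesis using r by (simp add: mult_le_0_iff)
qed

text \<open>If \<open>u\<close> is orthogonal to the range of the Toeplitz operator, then \<open>u = \<psi> f\<close> with
  \<open>f = \<psi>\<^sup>-\<^sup>1 u\<close>, and \<open>\<langle>\<psi> f, T f\<rangle> = 0\<close> forces \<open>f = 0\<close>.\<close>

lemma toeplitz_invertible:
  assumes "\<psi> \<in> neil_invertible"
  shows "invertible_on (H2_sub \<alpha>) (toeplitz \<alpha> \<phi>)"
proof -
  let ?X = "H2_sub \<alpha>" and ?T = "toeplitz \<alpha> \<phi>"
  obtain \<eta> where \<eta>: "\<eta> \<in> neil_algebra" "AE z in circle. \<psi> z * \<eta> z = 1"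
    using assms by (auto simp: neil_invertible_iff)
  have \<eta>L: "\<eta> \<in> Linf" using \<eta> by (simp add: neil_algebra_iff Hinf_Linf)
  have \<psi>\<eta>: "mult_op \<psi> (mult_op \<eta> u) = u" for u
  proof (cases u rule: L2_cases)
    case (1 f)
    then have "abs_L2 (\<lambda>z. \<psi> z * (\<eta> z * f z)) = abs_L2 f"
      using \<eta>(2) by (intro abs_L2_eqI Linf_mult_sq_integrable \<psi>_Linf \<eta>L)
        (auto elim!: eventually_mono simp flip: mult.assoc)
    then show ?thesis using 1 by (simp add: mult_op_abs \<psi>_Linf \<eta>L Linf_mult_sq_integrable)
  qed
  have c: "0 < (1 - r) / (1 + r)" using r by simp
  note hyp = closed_H2_sub[of \<alpha>] csubspace_H2_sub bounded_linear_toeplitz[OF \<phi>, of \<alpha>]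
    toeplitz_cscale[OF \<phi>] c toeplitz_bounded_below
  have img: "?T ` ?X = ?X"
  proof (intro subset_antisym subsetI)
    fix g assume g: "g \<in> ?X"
    obtain p where p: "p \<in> ?T ` ?X" "\<And>x. x \<in> ?T ` ?X \<Longrightarrow> cinner x (g - p) = 0"
      using closed_csubspace_projection[OF closed_bounded_below_image[OF hyp]] by metis
    define f where "f = mult_op \<eta> (g - p)"
    have "p \<in> ?X" using p(1) toeplitz_in_H2_sub by blast
    then have f: "f \<in> ?X"
      unfolding f_def by (intro mult_op_H2_sub \<eta> csubspace_L2_diff csubspace_H2_sub g)
    have "mult_op \<psi> f = g - p" unfolding f_def by (rule \<psi>\<eta>)
    then have "cinner (mult_op \<psi> f) (?T f) = 0"
      using p(2)[OF imageI[OF f]] by (subst cinner_commute) simp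
    then have "f = 0" by (rule eq_0_if_orthogonal[OF f])
    then have "g = p" using \<open>mult_op \<psi> f = g - p\<close>
        linear_0[OF bounded_linear.linear[OF bounded_linear_mult_op[OF \<psi>_Linf]]] by simp
    with p(1) show "g \<in> ?T ` ?X" by simp
  qed (auto simp: toeplitz_in_H2_sub)
  show ?thesis by (rule bounded_below_left_invertible(2)[OF hyp]) (simp_all add: img)
qed

text \<open>The argument of \<open>toeplitz_invertible\<close> with T and \<psi> exchanged. Let p be
  the projection of 1 onto the closed range \<psi> X. By surjectivity 1 - p = T f, which is
  orthogonal to \<psi> f, so f = 0 and 1 = \<psi> g with g in X. The bound |\<psi>| \<ge> 1 - r
  makes g bounded, and a bounded element of \<open>H2_sub (1, 0)\<close> lies in the Neil
  algebra.\<close>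

lemma neil_invertible_if_toeplitz_invertible:
  assumes "invertible_on (H2_sub (1, 0)) (toeplitz (1, 0) \<phi>)"
  shows "\<psi> \<in> neil_invertible"
proof -
  let ?X = "H2_sub (1, 0)" and ?T = "toeplitz (1, 0) \<phi>"
  obtain S where S: "\<And>g. g \<in> ?X \<Longrightarrow> S g \<in> ?X" "\<And>g. g \<in> ?X \<Longrightarrow> ?T (S g) = g"
    using assms unfolding invertible_on_def bounded_op_on_def by blast
  have below: "(1 - r) * norm x \<le> norm (mult_op \<psi> x)" for x
  proof (cases "x = 0")
    case False
    have "(1 - r) * (norm x)\<^sup>2 \<le> norm (mult_op \<psi> x) * norm (mult_op \<phi> x)"
      using Re_cinner_ge[of x] complex_Re_le_cmod[of "cinner (mult_op \<psi> x) (mult_op \<phi> x)"]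
        cinner_Cauchy_Schwarz[of "mult_op \<psi> x" "mult_op \<phi> x"] by linarith
    then have "((1 - r) * norm x) * norm x \<le> norm (mult_op \<psi> x) * norm x"
      by (simp add: norm_mult_op_unimodular[OF \<phi> unimod] power2_eq_square ac_simps)
    then show ?thesis using False by (simp add: mult_le_cancel_right)
  qed simp
  have one: "L2_monom 0 \<in> ?X" by (simp add: H2_sub_iff L2_monom_H2 L2_fourier_monom)
  have c: "0 < 1 - r" using r by simp
  obtain p where p: "p \<in> mult_op \<psi> ` ?X"
      "\<And>x. x \<in> mult_op \<psi> ` ?X \<Longrightarrow> cinner x (L2_monom 0 - p) = 0"
    using closed_csubspace_projection[OF closed_bounded_below_image[OF closed_H2_sub csubspace_H2_sub
        bounded_linear_mult_op[OF \<psi>_Linf] mult_op_cscale[OF \<psi>_Linf] c below]] by metis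
  define f where "f = S (L2_monom 0 - p)"
  have "p \<in> ?X" using p(1) mult_op_H2_sub[OF \<psi>] by blast
  then have "L2_monom 0 - p \<in> ?X" by (intro csubspace_L2_diff csubspace_H2_sub one)
  then have f: "f \<in> ?X" "?T f = L2_monom 0 - p" by (simp_all add: f_def S)
  have "f = 0" using p(2)[OF imageI[OF f(1)]] by (intro eq_0_if_orthogonal[OF f(1)]) (simp add: f(2))
  then have "p = L2_monom 0"
    using f(2) linear_0[OF bounded_linear.linear[OF bounded_linear_toeplitz[OF \<phi>]]] by simp
  then obtain g where g: "g \<in> ?X" "mult_op \<psi> g = L2_monom 0" using p(1) by auto
  define \<eta> where "\<eta> = rep_L2 g"
  have \<eta>: "\<eta> \<in> sq_integrable" "g = abs_L2 \<eta>" by (simp_all add: \<eta>_def)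
  have "abs_L2 (\<lambda>z. \<psi> z * \<eta> z) = abs_L2 (\<lambda>z. z powi 0)"
    using g(2) by (simp add: \<eta>(2) mult_op_abs[OF \<psi>_Linf \<eta>(1)] L2_monom_def)
  then have "AE z in circle. \<psi> z * \<eta> z = z powi 0"
    by (intro abs_L2_eqD Linf_mult_sq_integrable \<psi>_Linf \<eta> sq_integrable_powi)
  then have eq: "AE z in circle. \<psi> z * \<eta> z = 1" by simp
  then have "AE z in circle. cmod (\<eta> z) \<le> 1 / (1 - r)"
    using \<psi>_AE
  proof eventually_elim
    case (elim z)
    then have "(1 - r) * cmod (\<eta> z) \<le> cmod (\<psi> z) * cmod (\<eta> z)" by (intro mult_right_mono) auto
    also have "\<dots> = 1" using elim by (simp flip: norm_mult)
    finally show ?case using c by (simp add: field_simps)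
  qed
  then have "\<eta> \<in> Linf" using sq_integrable_measurable[OF \<eta>(1)] by (auto simp: Linf_iff)
  moreover have "fourier \<eta> = L2_fourier g" by (simp add: \<eta> L2_fourier_abs)
  ultimately have "\<eta> \<in> neil_algebra"
    using g(1) by (simp add: neil_algebra_iff Hinf_def H2_sub_iff H2_iff)
  then show ?thesis using \<psi> eq by (auto simp: neil_invertible_iff)
qed

end

section \<open>A lower bound uniform in \<open>\<alpha>\<close>\<close>

text \<open>Membership in \<open>H2_sub \<beta>\<close> means that the coefficients at 0 and 1 form
  a multiple c \<beta>. Replacing them by c \<alpha> and leaving the others alone lands in
  \<open>H2_sub \<alpha>\<close>. The 4 is the crude bound |c| \<le> 2 |x| times two changed
  coordinates.\<close>

lemma H2_sub_perturb:
  assumes "\<alpha> \<in> B2" "\<beta> \<in> B2" "x \<in> H2_sub \<beta>"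
  obtains x' where "x' \<in> H2_sub \<alpha>" "norm (x - x') \<le> 4 * dist \<alpha> \<beta> * norm x"
proof -
  obtain a b a' b' where [simp]: "\<alpha> = (a, b)" "\<beta> = (a', b')" by (cases \<alpha>; cases \<beta>)
  have \<beta>: "(cmod a')\<^sup>2 + (cmod b')\<^sup>2 = 1" using assms(2) by (simp add: B2_def)
  have x: "x \<in> H2" "L2_fourier x 0 * b' = L2_fourier x 1 * a'" using assms(3) by (simp_all add: H2_sub_iff)
  \<comment> \<open>The inner product of the coefficient pair with the unit vector \<beta>, which
    recovers the scalar multiple.\<close>
  define c where "c = L2_fourier x 0 * cnj a' + L2_fourier x 1 * cnj b'"
  have one: "a' * cnj a' + b' * cnj b' = 1"
    using \<beta> by (metis complex_norm_square of_real_1 of_real_add)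
  have "c * a' = L2_fourier x 0 * (a' * cnj a') + (L2_fourier x 1 * a') * cnj b'"
    by (simp add: c_def algebra_simps)
  also have "\<dots> = L2_fourier x 0 * (a' * cnj a') + (L2_fourier x 0 * b') * cnj b'"
    by (simp only: x(2))
  also have "\<dots> = L2_fourier x 0 * (a' * cnj a' + b' * cnj b')"
    by (simp add: algebra_simps)
  finally have c0: "L2_fourier x 0 = c * a'" by (simp add: one)
  have "c * b' = (L2_fourier x 0 * b') * cnj a' + L2_fourier x 1 * (b' * cnj b')"
    by (simp add: c_def algebra_simps)
  also have "\<dots> = (L2_fourier x 1 * a') * cnj a' + L2_fourier x 1 * (b' * cnj b')"
    by (simp only: x(2))
  also have "\<dots> = L2_fourier x 1 * (a' * cnj a' + b' * cnj b')"
    by (simp add: algebra_simps)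
  finally have c1: "L2_fourier x 1 = c * b'" by (simp add: one)
  have "(cmod a')\<^sup>2 \<le> 1\<^sup>2" "(cmod b')\<^sup>2 \<le> 1\<^sup>2"
    unfolding one_power2 using \<beta> zero_le_power2[of "cmod a'"] zero_le_power2[of "cmod b'"] by linarith+
  then have "cmod a' \<le> 1" "cmod b' \<le> 1" by (simp_all only: power2_le_imp_le zero_le_one)
  then have "cmod c \<le> cmod (L2_fourier x 0) * 1 + cmod (L2_fourier x 1) * 1"
    unfolding c_def by (intro norm_triangle_le add_mono) (simp_all add: norm_mult mult_left_le)
  then have c_le: "cmod c \<le> 2 * norm x"
    using norm_L2_fourier_le[of x 0] norm_L2_fourier_le[of x 1] by linarith
  define x' where "x' = x + (cscale (c * (a - a')) (L2_monom 0) + cscale (c * (b - b')) (L2_monom 1))"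
  have "x' \<in> H2"
    unfolding x'_def using csubspace_H2 x(1) L2_monom_H2 by (simp add: csubspace_L2_def)
  moreover have "L2_fourier x' 0 = c * a" "L2_fourier x' 1 = c * b"
    by (simp_all add: x'_def L2_fourier_add L2_fourier_cscale L2_fourier_monom c0 c1 algebra_simps)
  ultimately have "x' \<in> H2_sub \<alpha>" by (simp add: H2_sub_iff)
  moreover have "norm (x - x') \<le> 4 * dist \<alpha> \<beta> * norm x"
  proof -
    have "norm (x - x') = norm (cscale (c * (a - a')) (L2_monom 0) + cscale (c * (b - b')) (L2_monom 1))"
      by (subst norm_minus_cancel[symmetric]) (simp add: x'_def add.commute)
    also have "\<dots> \<le> cmod c * cmod (a - a') + cmod c * cmod (b - b')"
      by (rule norm_triangle_le) (simp add: norm_mult)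
    also have "\<dots> \<le> cmod c * dist \<alpha> \<beta> + cmod c * dist \<alpha> \<beta>"
      using dist_fst_le[of \<alpha> \<beta>] dist_snd_le[of \<alpha> \<beta>]
      by (intro add_mono mult_left_mono) (auto simp: dist_norm)
    also have "\<dots> = 2 * (cmod c * dist \<alpha> \<beta>)" by simp
    also have "\<dots> \<le> 2 * ((2 * norm x) * dist \<alpha> \<beta>)"
      by (intro mult_left_mono mult_right_mono c_le) auto
    finally show ?thesis by (simp add: ac_simps)
  qed
  ultimately show ?thesis using that by blast
qed

text \<open>The operators act on different spaces, so vectors are carried over: x to x1 in
  \<open>H2_sub \<alpha>\<close>, and y1, the image of x1, back to y2 in
  \<open>H2_sub \<beta>\<close>. With \<open>\<delta>\<close> at most 1/2 one has |y2| \<le> 3/2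
  |y1| and |x1| \<ge> |x| / 2. With \<open>\<delta>\<close> at most c / 8 the total error 2
  \<open>\<delta>\<close> |x| consumes at most half of c |x| / 2. The remaining c / 4 divided by 3/2
  is c / 6.\<close>

lemma toeplitz_bounded_below_nearby:
  assumes \<phi>: "\<phi> \<in> Linf" "AE z in circle. cmod (\<phi> z) = 1"
    and B: "\<alpha> \<in> B2" "\<beta> \<in> B2"
    and c: "0 < c" "\<And>x. x \<in> H2_sub \<alpha> \<Longrightarrow> c * norm x \<le> norm (toeplitz \<alpha> \<phi> x)"
    and \<delta>: "4 * dist \<alpha> \<beta> \<le> 1 / 2" "4 * dist \<alpha> \<beta> \<le> c / 8"
    and x: "x \<in> H2_sub \<beta>"
  shows "c / 6 * norm x \<le> norm (toeplitz \<beta> \<phi> x)"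
proof -
  define \<delta> where "\<delta> = 4 * dist \<alpha> \<beta>"
  have d: "0 \<le> \<delta>" "\<delta> \<le> 1/2" "\<delta> \<le> c / 8" using \<delta> by (simp_all add: \<delta>_def)
  obtain x1 where x1: "x1 \<in> H2_sub \<alpha>" "norm (x - x1) \<le> \<delta> * norm x"
    using H2_sub_perturb[OF B x] unfolding \<delta>_def by blast
  define y1 where "y1 = toeplitz \<alpha> \<phi> x1"
  have y1: "y1 \<in> H2_sub \<alpha>" by (simp add: y1_def toeplitz_in_H2_sub)
  obtain y2 where y2: "y2 \<in> H2_sub \<beta>" "norm (y1 - y2) \<le> \<delta> * norm y1"
    using H2_sub_perturb[OF B(2,1) y1] unfolding \<delta>_def by (metis dist_commute)
  note lin = bounded_linear.linear[OF bounded_linear_mult_op[OF \<phi>(1)]]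
  note M = norm_mult_op_unimodular[OF \<phi>]
  have "complex_of_real ((norm y1)\<^sup>2) = cinner y1 (mult_op \<phi> x1)"
    using cinner_toeplitz[OF y1, of \<phi> x1] by (simp add: cinner_self flip: y1_def)
  \<comment> \<open>Exchange x1 for x, then y1 for y2; the vector y2 lies in
    \<open>H2_sub \<beta>\<close>, so its pairing with \<phi> x sees only the Toeplitz operator for
    \<beta>.\<close>
  also have "\<dots> = cinner y2 (toeplitz \<beta> \<phi> x) + cinner (y1 - y2) (mult_op \<phi> x) - cinner y1 (mult_op \<phi> (x - x1))"
    by (simp add: cinner_toeplitz[OF y2(1)] linear_diff[OF lin] cinner.diff_left cinner.diff_right)
  finally have "(norm y1)\<^sup>2 = cmod (cinner y2 (toeplitz \<beta> \<phi> x) + cinner (y1 - y2) (mult_op \<phi> x) - cinner y1 (mult_op \<phi> (x - x1)))"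
    by (metis abs_power2 norm_of_real)
  also have "\<dots> \<le> cmod (cinner y2 (toeplitz \<beta> \<phi> x)) + cmod (cinner (y1 - y2) (mult_op \<phi> x)) + cmod (cinner y1 (mult_op \<phi> (x - x1)))"
    using norm_triangle_ineq4 norm_triangle_ineq by (smt (verit))
  also have "\<dots> \<le> norm y2 * norm (toeplitz \<beta> \<phi> x) + norm (y1 - y2) * norm x + norm y1 * norm (x - x1)"
    using cinner_Cauchy_Schwarz[of y2 "toeplitz \<beta> \<phi> x"] cinner_Cauchy_Schwarz[of "y1 - y2" "mult_op \<phi> x"]
      cinner_Cauchy_Schwarz[of y1 "mult_op \<phi> (x - x1)"] by (simp add: M)
  also have "\<dots> \<le> ((3/2) * norm y1) * norm (toeplitz \<beta> \<phi> x) + (\<delta> * norm y1) * norm x + norm y1 * (\<delta> * norm x)"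
  proof (intro add_mono mult_right_mono mult_left_mono y2 x1)
    have "norm y2 \<le> norm y1 + norm (y1 - y2)" using norm_triangle_sub[of y2 y1] by (simp add: norm_minus_commute)
    also have "\<dots> \<le> norm y1 + (1/2) * norm y1" using y2(2) d(2) mult_right_mono[OF d(2), of "norm y1"] by simp
    finally show "norm y2 \<le> (3/2) * norm y1" by simp
  qed auto
  finally have "norm y1 * norm y1 \<le> norm y1 * ((3/2) * norm (toeplitz \<beta> \<phi> x) + 2 * \<delta> * norm x)"
    by (simp add: power2_eq_square algebra_simps)
  then have le: "norm y1 \<le> (3/2) * norm (toeplitz \<beta> \<phi> x) + 2 * \<delta> * norm x"
    using d by (cases "norm y1 = 0") (auto simp: mult_le_cancel_left)
  have "norm x - norm (x - x1) \<le> norm x1" using norm_triangle_ineq2[of x "x - x1"] by simp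
  moreover have "\<delta> * norm x \<le> (1/2) * norm x" by (intro mult_right_mono d) simp
  ultimately have "norm x / 2 \<le> norm x1" using x1(2) by linarith
  then have "c * (norm x / 2) \<le> c * norm x1" using c(1) by (intro mult_left_mono) auto
  also have "\<dots> \<le> norm y1" unfolding y1_def by (rule c(2)[OF x1(1)])
  finally have "c * (norm x / 2) \<le> (3/2) * norm (toeplitz \<beta> \<phi> x) + 2 * \<delta> * norm x" using le by simp
  moreover have "2 * \<delta> * norm x \<le> 2 * (c / 8) * norm x"
    by (intro mult_right_mono mult_left_mono d) auto
  ultimately show ?thesis by simp
qed

lemma compact_B2: "compact B2"
proof -
  have "closed {p :: complex \<times> complex. (cmod (fst p))\<^sup>2 + (cmod (snd p))\<^sup>2 = 1}"
    by (intro closed_Collect_eq continuous_intros)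
  moreover have "B2 = {p :: complex \<times> complex. (cmod (fst p))\<^sup>2 + (cmod (snd p))\<^sup>2 = 1}"
    by (auto simp: B2_def)
  moreover have "bounded B2"
    unfolding bounded_iff by (rule exI[of _ 1]) (auto simp: B2_def norm_prod_def)
  ultimately show ?thesis by (simp add: compact_eq_bounded_closed)
qed

lemma toeplitz_uniformly_bounded_below:
  assumes \<phi>: "\<phi> \<in> Linf" "AE z in circle. cmod (\<phi> z) = 1"
    and inv: "\<And>\<alpha>. \<alpha> \<in> B2 \<Longrightarrow> left_invertible_on (H2_sub \<alpha>) (toeplitz \<alpha> \<phi>)"
  obtains e where "0 < e" "\<And>\<alpha> x. \<alpha> \<in> B2 \<Longrightarrow> x \<in> H2_sub \<alpha> \<Longrightarrow> e * norm x \<le> norm (toeplitz \<alpha> \<phi> x)"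
proof -
  have "\<exists>c>0. \<forall>x\<in>H2_sub \<alpha>. c * norm x \<le> norm (toeplitz \<alpha> \<phi> x)" if "\<alpha> \<in> B2" for \<alpha>
    by (rule left_invertible_bounded_below[OF inv[OF that] toeplitz_in_H2_sub])
  then obtain c where c: "\<And>\<alpha>. \<alpha> \<in> B2 \<Longrightarrow> 0 < c \<alpha>"
    "\<And>\<alpha> x. \<alpha> \<in> B2 \<Longrightarrow> x \<in> H2_sub \<alpha> \<Longrightarrow> c \<alpha> * norm x \<le> norm (toeplitz \<alpha> \<phi> x)" by metis
  \<comment> \<open>The two smallness conditions of \<open>toeplitz_bounded_below_nearby\<close>,
    divided by 4.\<close>
  define \<rho> where "\<rho> \<alpha> = min (1/8) (c \<alpha> / 32)" for \<alpha>
  have \<rho>: "0 < \<rho> \<alpha>" if "\<alpha> \<in> B2" for \<alpha> using c(1)[OF that] by (simp add: \<rho>_def)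
  have "B2 \<subseteq> (\<Union>\<alpha>\<in>B2. ball \<alpha> (\<rho> \<alpha>))" using \<rho> by force
  then obtain D where D: "D \<subseteq> B2" "finite D" "B2 \<subseteq> (\<Union>\<alpha>\<in>D. ball \<alpha> (\<rho> \<alpha>))"
    by (rule compactE_image[OF compact_B2, rotated]) auto
  \<comment> \<open>The inserted 1 keeps the set nonempty, so that \<open>Min\<close> is
    meaningful.\<close>
  define e where "e = Min (insert 1 ((\<lambda>\<alpha>. c \<alpha> / 6) ` D))"
  have "0 < e" using D c(1) by (auto simp: e_def)
  moreover have "e * norm x \<le> norm (toeplitz \<beta> \<phi> x)" if \<beta>: "\<beta> \<in> B2" "x \<in> H2_sub \<beta>" for \<beta> x
  proof -
    obtain \<alpha> where \<alpha>: "\<alpha> \<in> D" "dist \<alpha> \<beta> < \<rho> \<alpha>" using D(3) \<beta>(1) by auto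
    then have "\<alpha> \<in> B2" using D(1) by blast
    have "e \<le> c \<alpha> / 6" unfolding e_def using \<alpha>(1) D(2) by (intro Min_le) auto
    then have "e * norm x \<le> c \<alpha> / 6 * norm x" by (intro mult_right_mono) auto
    also have "\<dots> \<le> norm (toeplitz \<beta> \<phi> x)"
      by (rule toeplitz_bounded_below_nearby[OF \<phi> \<open>\<alpha> \<in> B2\<close> \<beta>(1) c(1) c(2) _ _ \<beta>(2)])
        (use \<alpha> \<open>\<alpha> \<in> B2\<close> in \<open>auto simp: \<rho>_def\<close>)
    finally show ?thesis .
  qed
  ultimately show ?thesis by (rule that)
qed

section \<open>Factorization of polynomials on the circle\<close>

text \<open>Absolute summability up to the circle permits termwise integration. Both kinds of
  explicit functions in the factorization, polynomials and binomial series, are of this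
  form.\<close>

lemma Hinf_power_series:
  assumes d: "summable (\<lambda>n. norm (d n))" and f: "\<And>z. cmod z = 1 \<Longrightarrow> f z = (\<Sum>n. d n * z ^ n)"
  shows "f \<in> Hinf" and "fourier f (int m) = d m"
proof -
  have s: "summable (\<lambda>n. norm (d n * z ^ n))" if "cmod z = 1" for z
    using d that by (simp add: norm_mult norm_power)
  have "(\<lambda>z. \<Sum>n. d n * z ^ n) \<in> borel_measurable circle"
    by (intro borel_measurable_suminf borel_measurable_circle_continuous continuous_intros)
  then have m: "f \<in> borel_measurable circle"
    by (rule measurable_cong[THEN iffD1, rotated]) (simp add: f)
  have "AE z in circle. cmod (f z) \<le> (\<Sum>n. norm (d n))"
  proof (rule AE_circleI)
    fix z :: complex assume z: "cmod z = 1"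
    have "cmod (f z) \<le> (\<Sum>n. norm (d n * z ^ n))" unfolding f[OF z] by (rule summable_norm[OF s[OF z]])
    then show "cmod (f z) \<le> (\<Sum>n. norm (d n))" using z by (simp add: norm_mult norm_power)
  qed
  with m have L: "f \<in> Linf" by (auto simp: Linf_iff)
  have F: "fourier f k = (\<Sum>n. d n * (if int n = k then 1 else 0))" for k
  proof -
    have int: "integrable circle (\<lambda>z. d n * (z ^ n * cnj (z powi k)))" for n
      using sq_integrable_mult[OF sq_integrable_powi[of "int n"] sq_integrable_powi[of k]] by simp
    have n: "(LINT z|circle. norm (d n * (z ^ n * cnj (z powi k)))) = norm (d n)" for n
    proof -
      have "(LINT z|circle. norm (d n * (z ^ n * cnj (z powi k)))) = (LINT z|circle. norm (d n))"
        by (intro Bochner_Integration.integral_cong) (auto simp: norm_mult norm_power norm_power_int)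
      then show ?thesis using circle.prob_space by simp
    qed
    have "fourier f k = (LINT z|circle. (\<Sum>n. d n * (z ^ n * cnj (z powi k))))"
      unfolding fourier_def
    proof (rule Bochner_Integration.integral_cong)
      fix z assume "z \<in> space circle"
      then have z: "cmod z = 1" by simp
      show "f z * cnj (z powi k) = (\<Sum>n. d n * (z ^ n * cnj (z powi k)))"
        unfolding f[OF z] using suminf_mult2[OF summable_norm_cancel[OF s[OF z]], of "cnj (z powi k)"]
        by (simp add: mult.assoc)
    qed simp
    also have "\<dots> = (\<Sum>n. LINT z|circle. d n * (z ^ n * cnj (z powi k)))"
    proof (rule integral_suminf[OF int])
      show "AE z in circle. summable (\<lambda>n. norm (d n * (z ^ n * cnj (z powi k))))"
        by (rule AE_circleI) (use d in \<open>simp add: norm_mult norm_power norm_power_int\<close>)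
      show "summable (\<lambda>n. LINT z|circle. norm (d n * (z ^ n * cnj (z powi k))))"
        unfolding n by (rule d)
    qed
    also have "\<dots> = (\<Sum>n. d n * fourier (\<lambda>z. z powi int n) k)"
      by (simp add: fourier_def)
    finally show ?thesis by (simp only: fourier_powi)
  qed
  have "fourier f k = 0" if "k < 0" for k
  proof -
    have "(\<lambda>n. d n * (if int n = k then 1 else 0)) = (\<lambda>n. 0)" using that by auto
    then show ?thesis by (simp add: F)
  qed
  with L show "f \<in> Hinf" by (simp add: Hinf_def)
  have "(\<Sum>n. d n * (if int n = int m then 1 else 0)) = (\<Sum>n\<in>{m}. d n * (if int n = int m then 1 else 0))"
    by (rule suminf_finite) auto
  then show "fourier f (int m) = d m" by (simp add: F)
qed

lemma Hinf_poly: "poly p \<in> Hinf" "fourier (poly p) (int n) = coeff p n"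
proof -
  have 1: "summable (\<lambda>n. norm (coeff p n))"
    by (rule summable_finite[of "{..degree p}"]) (auto simp: coeff_eq_0)
  have 2: "poly p z = (\<Sum>n. coeff p n * z ^ n)" for z
    unfolding poly_altdef by (rule suminf_finite[symmetric]) (auto simp: coeff_eq_0)
  show "poly p \<in> Hinf" "fourier (poly p) (int n) = coeff p n"
    using Hinf_power_series[OF 1 2] by auto
qed

text \<open>For |b| < 1 the binomial series converges on a disk of radius greater than 1, hence
  absolutely on the circle.\<close>

lemma Hinf_binomial:
  assumes "cmod b < 1"
  shows "(\<lambda>z. (1 + b * z) powr s) \<in> Hinf" "fourier (\<lambda>z. (1 + b * z) powr s) 0 = 1"
proof -
  \<comment> \<open>The midpoint of |b| and 1: convergence at a point farther out than b gives
    absolute convergence at b.\<close>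
  define x where "x = complex_of_real ((1 + cmod b) / 2)"
  have nx: "cmod x = (1 + cmod b) / 2" unfolding x_def norm_of_real by simp
  have 1: "summable (\<lambda>n. norm ((s gchoose n) * b ^ n))"
  proof (rule powser_insidea)
    show "summable (\<lambda>n. (s gchoose n) * x ^ n)"
      using gen_binomial_complex[of x s] assms nx by (simp add: sums_iff)
    show "norm b < norm x" using assms nx by simp
  qed
  have 2: "(1 + b * z) powr s = (\<Sum>n. (s gchoose n) * b ^ n * z ^ n)" if "cmod z = 1" for z
    using gen_binomial_complex[of "b * z" s] assms that
    by (simp add: sums_iff norm_mult power_mult_distrib mult.assoc)
  show "(\<lambda>z. (1 + b * z) powr s) \<in> Hinf" "fourier (\<lambda>z. (1 + b * z) powr s) 0 = 1"
    using Hinf_power_series(1)[OF 1 2] Hinf_power_series(2)[OF 1 2, of 0] by auto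
qed

text \<open>Here \<open>f\<close> plays the role of the square root of the outer factor of \<open>k\<close>; of outerness only
  \<open>f(0) \<noteq> 0\<close> is needed.\<close>

definition balanced_factors :: "(complex \<Rightarrow> complex) \<Rightarrow> bool" where
  "balanced_factors k \<longleftrightarrow> (\<exists>f\<in>Hinf. \<exists>h\<in>Hinf. fourier f 0 \<noteq> 0 \<and>
     (\<forall>z. cmod z = 1 \<longrightarrow> k z = f z * h z \<and> cmod (f z) = cmod (h z)))"

lemma balanced_factors_mult:
  assumes "balanced_factors k" "balanced_factors l"
  shows "balanced_factors (\<lambda>z. k z * l z)"
proof -
  obtain f h where fh: "f \<in> Hinf" "h \<in> Hinf" "fourier f 0 \<noteq> 0"
    "\<And>z. cmod z = 1 \<Longrightarrow> k z = f z * h z \<and> cmod (f z) = cmod (h z)"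
    using assms(1) unfolding balanced_factors_def by blast
  obtain f' h' where fh': "f' \<in> Hinf" "h' \<in> Hinf" "fourier f' 0 \<noteq> 0"
    "\<And>z. cmod z = 1 \<Longrightarrow> l z = f' z * h' z \<and> cmod (f' z) = cmod (h' z)"
    using assms(2) unfolding balanced_factors_def by blast
  have "fourier (\<lambda>z. f z * f' z) 0 \<noteq> 0"
    using Hinf_mult(2)[OF fh(1) fh'(1), of 0] fh(3) fh'(3) by simp
  moreover have "k z * l z = (f z * f' z) * (h z * h' z) \<and> cmod (f z * f' z) = cmod (h z * h' z)"
    if "cmod z = 1" for z
    using fh(4)[OF that] fh'(4)[OF that] by (simp add: norm_mult)
  ultimately show ?thesis
    unfolding balanced_factors_def
    by (intro bexI[of _ "\<lambda>z. f z * f' z"] bexI[of _ "\<lambda>z. h z * h' z"] Hinf_mult(1) fh fh') auto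
qed

lemma balanced_factors_const:
  assumes "c \<noteq> 0"
  shows "balanced_factors (\<lambda>_. c)"
proof -
  have "poly [:csqrt c:] = (\<lambda>_. csqrt c)" by (simp add: fun_eq_iff)
  then have "(\<lambda>_. csqrt c) \<in> Hinf" "fourier (\<lambda>_. csqrt c) 0 = csqrt c"
    using Hinf_poly(1)[of "[:csqrt c:]"] Hinf_poly(2)[of "[:csqrt c:]" 0] by simp_all
  with assms show ?thesis
    unfolding balanced_factors_def
    by (intro bexI[of _ "\<lambda>_. csqrt c"]) (auto simp flip: power2_eq_square)
qed

lemma one_plus_mult_neq_0: "cmod b < 1 \<Longrightarrow> cmod z = 1 \<Longrightarrow> 1 + b * z \<noteq> 0"
  by (metis add.commute add_eq_0_iff2 mult.right_neutral norm_minus_cancel norm_mult norm_one order_less_irrefl)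

text \<open>On the circle |z - a| = |1 - \<open>cnj a\<close> z|. For |a| < 1 the right-hand
  function has no zero in the closed disk, so f is its square root and h = (z - a) / f, with value 1
  for f at 0. For |a| > 1 one has z - a = -a (1 - z / a), and the square root of 1 - z / a serves as
  both factors, up to the constant.\<close>

lemma balanced_factors_linear:
  assumes "cmod a \<noteq> 1"
  shows "balanced_factors (\<lambda>z. z - a)"
proof (cases "cmod a < 1")
  case True
  define b where "b = - cnj a"
  have b: "cmod b < 1" using True by (simp add: b_def)
  define f where "f z = (1 + b * z) powr (1/2)" for z
  define g where "g z = (1 + b * z) powr (- (1/2))" for z
  have f: "f \<in> Hinf" "fourier f 0 = 1" and g: "g \<in> Hinf"
    using Hinf_binomial[OF b] unfolding f_def[abs_def] g_def[abs_def] by auto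
  have "poly [:-a, 1:] = (\<lambda>z. z - a)" by (simp add: fun_eq_iff)
  then have p: "(\<lambda>z. z - a) \<in> Hinf" using Hinf_poly(1)[of "[:-a, 1:]"] by simp
  have fg: "f z * g z = 1" "f z * f z = 1 + b * z" if "cmod z = 1" for z
    using one_plus_mult_neq_0[OF b that] by (simp_all add: f_def g_def flip: powr_add)
  have "cmod (f z) = cmod ((z - a) * g z)" if z: "cmod z = 1" for z
  proof -
    have "z * cnj z = 1" using complex_norm_square[of z] z by simp
    then have "1 + b * z = z * cnj (z - a)" by (simp add: b_def algebra_simps)
    then have "cmod (f z) * cmod (f z) = cmod (z - a)"
      using fg(2)[OF z] z by (metis complex_mod_cnj mult_1 norm_mult)
    moreover have "cmod (f z) * cmod (g z) = 1" using fg(1)[OF z] by (metis norm_mult norm_one)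
    ultimately show ?thesis by (metis mult.assoc mult.right_neutral norm_mult)
  qed
  moreover have "z - a = f z * ((z - a) * g z)" if "cmod z = 1" for z
    using fg(1)[OF that] by (metis mult.assoc mult.commute mult.right_neutral)
  ultimately show ?thesis
    unfolding balanced_factors_def using f
    by (intro bexI[of _ f] bexI[of _ "\<lambda>z. (z - a) * g z"] Hinf_mult(1) p g) auto
next
  case False
  define b where "b = - (1 / a)"
  have a: "a \<noteq> 0" using False by auto
  have "1 < cmod a" using False assms by simp
  then have b: "cmod b < 1" unfolding b_def norm_minus_cancel norm_divide norm_one by (subst divide_less_eq) auto
  define f where "f z = (1 + b * z) powr (1/2)" for z
  have f: "f \<in> Hinf" "fourier f 0 = 1"
    using Hinf_binomial[OF b] unfolding f_def[abs_def] by auto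
  have "1 + b * z = f z * f z" if "cmod z = 1" for z
    using one_plus_mult_neq_0[OF b that] by (simp add: f_def flip: powr_add)
  then have "balanced_factors (\<lambda>z. 1 + b * z)"
    unfolding balanced_factors_def using f by (intro bexI[of _ f]) auto
  then have "balanced_factors (\<lambda>z. (- a) * (1 + b * z))"
    using a by (intro balanced_factors_mult balanced_factors_const) auto
  moreover have "(\<lambda>z. (- a) * (1 + b * z)) = (\<lambda>z. z - a)"
    using a by (auto simp: b_def fun_eq_iff field_simps)
  ultimately show ?thesis by simp
qed

text \<open>Split off the roots one at a time. Roots on the circle are excluded because the square
  roots come from binomial series with |b| < 1.\<close>

lemma balanced_factors_poly:
  assumes "p \<noteq> 0" "\<And>z. cmod z = 1 \<Longrightarrow> poly p z \<noteq> 0"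
  shows "balanced_factors (poly p)"
  using assms
proof (induction "degree p" arbitrary: p)
  case 0
  then obtain c where "p = [:c:]" by (metis degree_eq_zeroE)
  with 0 show ?case using balanced_factors_const[of c] by simp
next
  case (Suc n)
  then have "\<not> constant (poly p)" by (simp add: constant_degree)
  then obtain a where a: "poly p a = 0" using fundamental_theorem_of_algebra by blast
  then obtain q where q: "p = [:-a, 1:] * q" by (auto simp: poly_eq_0_iff_dvd elim: dvdE)
  have "q \<noteq> 0" using q Suc.prems(1) by auto
  then have "degree p = Suc (degree q)" unfolding q by (subst degree_mult_eq) auto
  then have "balanced_factors (poly q)"
    using Suc.hyps(2) Suc.prems(2) \<open>q \<noteq> 0\<close> by (intro Suc.hyps(1)) (auto simp: q)
  moreover have "cmod a \<noteq> 1" using a Suc.prems(2) by blast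
  ultimately have "balanced_factors (\<lambda>z. (z - a) * poly q z)"
    by (intro balanced_factors_mult balanced_factors_linear)
  moreover have "(\<lambda>z. (z - a) * poly q z) = poly p" by (simp add: q fun_eq_iff algebra_simps)
  ultimately show ?case by simp
qed

section \<open>The distance formula\<close>

text \<open>The L^1 norm as a continuous function on the Hilbert space, so that duality with
  L^\<infinity> can be treated without leaving \<open>L2\<close>.\<close>

definition L1_norm :: "L2 \<Rightarrow> real" where
  "L1_norm x = (LINT z|circle. cmod (rep_L2 x z))"

lemma L1_norm_abs: "f \<in> sq_integrable \<Longrightarrow> L1_norm (abs_L2 f) = (LINT z|circle. cmod (f z))"
  unfolding L1_norm_def
proof (rule integral_cong_AE)
  assume f: "f \<in> sq_integrable"
  have [measurable]: "f \<in> borel_measurable circle" "rep_L2 (abs_L2 f) \<in> borel_measurable circle"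
    using f by (simp_all add: sq_integrable_measurable)
  show "(\<lambda>z. cmod (rep_L2 (abs_L2 f) z)) \<in> borel_measurable circle"
    "(\<lambda>z. cmod (f z)) \<in> borel_measurable circle" by measurable
  show "AE z in circle. cmod (rep_L2 (abs_L2 f) z) = cmod (f z)"
    using rep_abs_L2_AE[OF f] by eventually_elim simp
qed

lemma L1_norm_nonneg: "0 \<le> L1_norm x"
  by (simp add: L1_norm_def)

lemma L1_norm_le_norm: "L1_norm x \<le> norm x"
  using integral_norm_le_norm_L2[of "rep_L2 x"] by (simp add: L1_norm_def)

lemma L1_norm_triangle: "L1_norm (x + y) \<le> L1_norm x + L1_norm y"
proof (cases x rule: L2_cases; cases y rule: L2_cases)
  fix f g assume f: "f \<in> sq_integrable" "x = abs_L2 f" and g: "g \<in> sq_integrable" "y = abs_L2 g"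
  have int: "integrable circle f" "integrable circle g"
    using f g by (simp_all add: sq_integrable_integrable)
  have "(LINT z|circle. cmod (f z + g z)) \<le> (LINT z|circle. cmod (f z) + cmod (g z))"
    by (intro integral_mono integrable_norm Bochner_Integration.integrable_add int norm_triangle_ineq)
  then show ?thesis using f g int by (simp add: add_abs L1_norm_abs sq_integrable_add)
qed

lemma L1_norm_diff_le: "\<bar>L1_norm x - L1_norm y\<bar> \<le> norm (x - y)"
  using L1_norm_triangle[of y "x - y"] L1_norm_triangle[of x "y - x"]
    L1_norm_le_norm[of "x - y"] L1_norm_le_norm[of "y - x"]
  by (simp add: norm_minus_commute)

lemma continuous_on_L1_norm: "continuous_on A L1_norm"
  unfolding continuous_on_iff
proof (intro ballI allI impI exI conjI)
  fix x x' :: L2 and e :: real assume "dist x' x < e"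
  then show "dist (L1_norm x') (L1_norm x) < e"
    using L1_norm_diff_le[of x' x] by (simp add: dist_norm)
qed

locale uniformly_left_invertible =
  fixes \<phi> :: "complex \<Rightarrow> complex" and e r :: real
  assumes \<phi>: "\<phi> \<in> Linf" and unimod: "AE z in circle. cmod (\<phi> z) = 1"
    and e: "0 < e" and r: "0 \<le> r" "1 - e\<^sup>2 \<le> r\<^sup>2"
    and below: "\<And>\<alpha> x. \<alpha> \<in> B2 \<Longrightarrow> x \<in> H2_sub \<alpha> \<Longrightarrow> e * norm x \<le> norm (toeplitz \<alpha> \<phi> x)"
begin

text \<open>Pythagoras: T x is the orthogonal projection of \<phi> x, |\<phi> x| = |x|, and |T x|
  \<ge> e |x|. The difference is the value at x of a Hankel-type operator.\<close>

lemma norm_Hankel_le: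
  assumes "\<alpha> \<in> B2" "x \<in> H2_sub \<alpha>"
  shows "norm (mult_op \<phi> x - toeplitz \<alpha> \<phi> x) \<le> r * norm x"
proof -
  let ?y = "mult_op \<phi> x" and ?T = "toeplitz \<alpha> \<phi> x"
  have "inner ?T ?y = inner ?T ?T"
    using cinner_toeplitz[OF toeplitz_in_H2_sub, of \<alpha> \<phi> x \<phi> x] by (simp add: inner_L2_def)
  then have "(norm (?y - ?T))\<^sup>2 = (norm ?y)\<^sup>2 - (norm ?T)\<^sup>2"
    by (simp add: power2_norm_eq_inner inner_diff inner_commute)
  also have "\<dots> \<le> (norm x)\<^sup>2 - (e * norm x)\<^sup>2"
    using below[OF assms] e by (simp add: norm_mult_op_unimodular[OF \<phi> unimod] power_mono)
  also have "\<dots> = (1 - e\<^sup>2) * (norm x)\<^sup>2" by (simp add: power_mult_distrib algebra_simps)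
  also have "\<dots> \<le> r\<^sup>2 * (norm x)\<^sup>2" by (intro mult_right_mono r) simp
  finally show ?thesis using r(1) by (simp add: power2_le_iff_abs_le flip: power_mult_distrib)
qed

text \<open>For \<open>k = f h\<close> with \<open>k'(0) = 0\<close> and \<open>\<alpha>\<close> proportional to \<open>(f(0), f'(0))\<close>, the function
  \<open>z h\<^sup>*\<close> is orthogonal to \<open>H\<^sup>2\<^sub>\<alpha>\<close>, so the pairing of \<open>\<phi>\<close> with \<open>k / z\<close> only sees the
  component of \<open>\<phi> f\<close> orthogonal to \<open>H\<^sup>2\<^sub>\<alpha>\<close>.\<close>

lemma pairing_le_if_balanced:
  assumes k: "k \<in> Hinf" "balanced_factors k" "fourier k 1 = 0"
  shows "cmod (LINT z|circle. \<phi> z * (k z * cnj z)) \<le> r * (LINT z|circle. cmod (k z))"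
proof -
  obtain f h where fh: "f \<in> Hinf" "h \<in> Hinf" "fourier f 0 \<noteq> 0"
    and eq: "\<And>z. cmod z = 1 \<Longrightarrow> k z = f z * h z" "\<And>z. cmod z = 1 \<Longrightarrow> cmod (f z) = cmod (h z)"
    using k(2) unfolding balanced_factors_def by blast
  have sq: "f \<in> sq_integrable" "h \<in> sq_integrable"
    using fh by (auto intro: Linf_sq_integrable Hinf_Linf)
  have zL: "(\<lambda>z. z) \<in> Linf"
    by (auto simp: Linf_iff intro!: exI[of _ 1] AE_circleI borel_measurable_circle_continuous continuous_on_id)
  have hc: "(\<lambda>z. cnj (h z)) \<in> sq_integrable"
    using sq(2) by (auto simp: sq_integrable_def intro!: borel_measurable_continuous_on[where f = cnj] continuous_intros)
  have sqy: "(\<lambda>z. z * cnj (h z)) \<in> sq_integrable" by (rule Linf_mult_sq_integrable[OF zL hc])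
  define x where "x = abs_L2 f"
  define y where "y = abs_L2 (\<lambda>z. z * cnj (h z))"
  define x0 x1 where "x0 = fourier f 0" and "x1 = fourier f 1"
  define s where "s = sqrt ((cmod x0)\<^sup>2 + (cmod x1)\<^sup>2)"
  have "0 < (cmod x0)\<^sup>2 + (cmod x1)\<^sup>2" using fh(3) by (simp add: x0_def add_pos_nonneg)
  then have s: "0 < s" "s\<^sup>2 = (cmod x0)\<^sup>2 + (cmod x1)\<^sup>2" by (simp_all add: s_def)
  define \<alpha> where "\<alpha> = (x0 / of_real s, x1 / of_real s)"
  have "(cmod (x0 / of_real s))\<^sup>2 + (cmod (x1 / of_real s))\<^sup>2 = ((cmod x0)\<^sup>2 + (cmod x1)\<^sup>2) / s\<^sup>2"
    using s(1) by (simp add: norm_divide power_divide add_divide_distrib)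
  also have "\<dots> = s\<^sup>2 / s\<^sup>2" by (simp only: s(2))
  finally have "(cmod (x0 / of_real s))\<^sup>2 + (cmod (x1 / of_real s))\<^sup>2 = s\<^sup>2 / s\<^sup>2" .
  then have "\<alpha> \<in> B2" using s(1) by (simp add: B2_def \<alpha>_def)
  have x: "x \<in> H2_sub \<alpha>"
    using Hinf_H2[OF fh(1)] by (simp add: H2_sub_iff \<alpha>_def x_def L2_fourier_abs[OF sq(1)] x0_def x1_def)
  have "fourier k 1 = fourier (\<lambda>z. f z * h z) 1"
    unfolding fourier_def by (intro Bochner_Integration.integral_cong) (auto simp: eq)
  then have fh1: "fourier h 1 * x0 + fourier h 0 * x1 = 0"
    using Hinf_mult(2)[OF fh(1,2), of 1] k(3) by (simp add: x0_def x1_def add.commute)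
  \<comment> \<open>The pairing of p with y is the coefficient at 1 of the product h p. The
    coefficients of p at 0 and 1 are proportional to those of f, so this is a multiple of the
    coefficient of k = f h at 1, which is 0.\<close>
  have orth: "cinner p y = 0" if p: "p \<in> H2_sub \<alpha>" for p
  proof -
    obtain q where q: "q \<in> sq_integrable" "p = abs_L2 q" by (rule L2_cases)
    define p0 p1 where "p0 = L2_fourier p 0" and "p1 = L2_fourier p 1"
    have pH: "p \<in> H2" "p0 * x1 = p1 * x0"
      using p s(1) by (simp_all add: H2_sub_iff \<alpha>_def p0_def p1_def)
    have "cinner p y = (LINT z|circle. h z * q z * cnj (z powi 1))"
      unfolding y_def q(2) cinner_abs[OF q(1) sqy]
      by (intro Bochner_Integration.integral_cong) (simp_all add: ac_simps)
    also have "\<dots> = L2_fourier (mult_op h p) 1"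
      using q by (simp add: mult_op_abs[OF Hinf_Linf[OF fh(2)]] L2_fourier_abs
          Linf_mult_sq_integrable[OF Hinf_Linf[OF fh(2)]] fourier_def)
    also have "\<dots> = p0 * fourier h 1 + p1 * fourier h 0"
      using mult_op_fourier[OF fh(2) pH(1), of 1] by (simp add: p0_def p1_def)
    finally have "cinner p y * x0 = p0 * (fourier h 1 * x0) + (p1 * x0) * fourier h 0"
      by (simp add: algebra_simps)
    also have "\<dots> = p0 * (fourier h 1 * x0 + fourier h 0 * x1)"
      unfolding pH(2)[symmetric] by (simp add: algebra_simps)
    finally show ?thesis using fh1 fh(3) by (simp add: x0_def)
  qed
  have "(LINT z|circle. \<phi> z * (k z * cnj z)) = cinner (mult_op \<phi> x) y"
    unfolding x_def y_def mult_op_abs[OF \<phi> sq(1)] cinner_abs[OF Linf_mult_sq_integrable[OF \<phi> sq(1)] sqy]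
    by (intro Bochner_Integration.integral_cong) (simp_all add: eq ac_simps)
  also have "\<dots> = cinner (mult_op \<phi> x - toeplitz \<alpha> \<phi> x) y"
    by (simp add: cinner.diff_left orth toeplitz_in_H2_sub)
  finally have "cmod (LINT z|circle. \<phi> z * (k z * cnj z)) \<le> norm (mult_op \<phi> x - toeplitz \<alpha> \<phi> x) * norm y"
    using cinner_Cauchy_Schwarz by simp
  also have "\<dots> \<le> (r * norm x) * norm y"
    by (intro mult_right_mono norm_Hankel_le \<open>\<alpha> \<in> B2\<close> x) simp
  \<comment> \<open>Balance enters here: |f|^2 = |h|^2 = |k| on the circle, so |x| and |y| are both
    the square root of the integral of |k|.\<close>
  also have "\<dots> = r * (LINT z|circle. cmod (k z))"
  proof -
    have kk: "cmod (k z) = (cmod (f z))\<^sup>2" "cmod (k z) = (cmod (h z))\<^sup>2" if "cmod z = 1" for z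
      using eq[OF that] by (simp_all add: norm_mult power2_eq_square)
    have nx: "(norm x)\<^sup>2 = (LINT z|circle. cmod (k z))"
      unfolding x_def norm_abs_L2[OF sq(1)]
      by (intro Bochner_Integration.integral_cong) (simp_all add: kk(1))
    have ny: "(norm y)\<^sup>2 = (LINT z|circle. cmod (k z))"
      unfolding y_def norm_abs_L2[OF sqy]
      by (intro Bochner_Integration.integral_cong) (simp_all add: kk(2) norm_mult)
    have "norm y = norm x" by (rule power2_eq_imp_eq) (simp_all add: nx ny)
    then show ?thesis using nx by (simp add: power2_eq_square)
  qed
  finally show ?thesis .
qed

text \<open>Zeros of \<open>p\<close> on the circle are avoided by dilating: \<open>p(s z)\<close> has none for all but finitely
  many \<open>s\<close>.\<close>

lemma pairing_poly_le:
  assumes p: "coeff p 1 = 0"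
  shows "cmod (LINT z|circle. \<phi> z * (poly p z * cnj z)) \<le> r * (LINT z|circle. cmod (poly p z))"
proof (cases "p = 0")
  case False
  define s where "s n = 1 - 1 / real (Suc n)" for n
  have s: "0 \<le> s n" "s n \<le> 1" for n by (auto simp: s_def field_simps)
  have s1: "s \<longlonglongrightarrow> 1"
    unfolding s_def using tendsto_diff[OF tendsto_const LIMSEQ_Suc[OF lim_1_over_n], of "1::real"] by simp
  define P where "P n = pcompose p [:0, of_real (s n):]" for n
  have P: "poly (P n) z = poly p (of_real (s n) * z)" for n z by (simp add: P_def poly_pcompose mult.commute)
  have "continuous_on (cball 0 1) (\<lambda>z. poly p z)" by (intro continuous_intros)
  then have "compact (poly p ` cball 0 1)" by (intro compact_continuous_image) auto
  from compact_imp_bounded[OF this] obtain B where "\<forall>y\<in>poly p ` cball 0 1. norm y \<le> B"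
    unfolding bounded_iff ..
  then have B: "cmod (poly p w) \<le> B" if "cmod w \<le> 1" for w using that by simp
  have PB: "cmod (poly (P n) z) \<le> B" if "cmod z = 1" for n z
    unfolding P using s[of n] that by (intro B) (simp add: norm_mult)
  have Plim: "(\<lambda>n. poly (P n) z) \<longlonglongrightarrow> poly p z" for z
  proof -
    have "(\<lambda>n. complex_of_real (s n) * z) \<longlonglongrightarrow> of_real 1 * z" by (intro tendsto_intros s1)
    then show ?thesis unfolding P by (intro isCont_tendsto_compose[of "z" "poly p"]) simp_all
  qed
  have cont: "continuous_on (sphere 0 1) (\<lambda>z. poly q z)" for q :: "complex poly" by (intro continuous_intros)
  have [measurable]: "poly q \<in> borel_measurable circle" for q
    by (rule borel_measurable_circle_continuous[OF cont])
  have [measurable]: "cnj \<in> borel_measurable circle"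
    by (intro borel_measurable_circle_continuous continuous_intros)
  have [measurable]: "\<phi> \<in> borel_measurable circle" using \<phi> by (simp add: Linf_iff)
  have lim1: "(\<lambda>n. LINT z|circle. \<phi> z * (poly (P n) z * cnj z)) \<longlonglongrightarrow> (LINT z|circle. \<phi> z * (poly p z * cnj z))"
  proof (rule integral_dominated_convergence[where w = "\<lambda>_. B"])
    show "AE z in circle. (\<lambda>n. \<phi> z * (poly (P n) z * cnj z)) \<longlonglongrightarrow> \<phi> z * (poly p z * cnj z)"
      by (intro AE_I2 tendsto_intros Plim)
    have circ: "AE z in circle. cmod z = 1" by (rule AE_circleI)
    show "AE z in circle. norm (\<phi> z * (poly (P n) z * cnj z)) \<le> B" for n
      using unimod circ by eventually_elim (simp add: norm_mult PB)
    show "(\<lambda>z. \<phi> z * (poly p z * cnj z)) \<in> borel_measurable circle" by measurable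
    show "(\<lambda>z. \<phi> z * (poly (P n) z * cnj z)) \<in> borel_measurable circle" for n by measurable
  qed simp
  have lim2: "(\<lambda>n. LINT z|circle. cmod (poly (P n) z)) \<longlonglongrightarrow> (LINT z|circle. cmod (poly p z))"
  proof (rule integral_dominated_convergence[where w = "\<lambda>_. B"])
    show "AE z in circle. (\<lambda>n. cmod (poly (P n) z)) \<longlonglongrightarrow> cmod (poly p z)"
      by (intro AE_I2 tendsto_intros Plim)
    show "AE z in circle. norm (cmod (poly (P n) z)) \<le> B" for n
      by (rule AE_circleI) (simp add: PB)
    show "(\<lambda>z. cmod (poly p z)) \<in> borel_measurable circle" by measurable
    show "(\<lambda>z. cmod (poly (P n) z)) \<in> borel_measurable circle" for n by measurable
  qed simp
  \<comment> \<open>Since \<open>s\<close> is injective, the finitely many moduli of roots exclude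
    only finitely many n.\<close>
  have "finite ((\<lambda>z. cmod z) ` {z. poly p z = 0})" using poly_roots_finite[OF False] by simp
  then have "finite (s -` (cmod ` {z. poly p z = 0}))"
    by (rule finite_vimageI) (auto simp: inj_def s_def)
  then have "eventually (\<lambda>n. n \<notin> s -` (cmod ` {z. poly p z = 0})) sequentially"
    unfolding cofinite_eq_sequentially[symmetric] eventually_cofinite by (simp add: vimage_def)
  then have "eventually (\<lambda>n. cmod (LINT z|circle. \<phi> z * (poly (P n) z * cnj z))
      \<le> r * (LINT z|circle. cmod (poly (P n) z))) sequentially"
  proof eventually_elim
    case (elim n)
    have nz: "poly (P n) z \<noteq> 0" if "cmod z = 1" for z
    proof
      assume "poly (P n) z = 0"
      moreover have "cmod (of_real (s n) * z) = s n" using that s[of n] by (simp add: norm_mult)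
      ultimately have "s n \<in> cmod ` {z. poly p z = 0}" unfolding P by force
      with elim show False by simp
    qed
    then have "P n \<noteq> 0" using nz[of 1] by (metis norm_one poly_0)
    \<comment> \<open>Dilation multiplies the coefficient of index 1 by \<open>s n\<close>, so its
      vanishing is preserved.\<close>
    have "coeff (P n) 1 = 0"
      using p by (simp add: P_def coeff_pcompose_linear)
    then have "fourier (poly (P n)) 1 = 0" using Hinf_poly(2)[of "P n" 1] by simp
    with nz \<open>P n \<noteq> 0\<close> show ?case
      by (intro pairing_le_if_balanced Hinf_poly(1) balanced_factors_poly)
  qed
  then show ?thesis
    by (intro tendsto_le[OF sequentially_bot tendsto_mult[OF tendsto_const lim2] tendsto_norm[OF lim1]])
qed simp

end

section \<open>Duality\<close>

lemma cscale_cscale: "cscale c (cscale d x) = cscale (c * d) x"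
  by (cases x rule: L2_cases) (simp add: cscale_abs sq_integrable_cmult mult.assoc)

lemma bounded_linear_cscale: "bounded_linear (cscale c)"
  by (rule bounded_linear_intro[where K = "cmod c"])
    (simp_all add: cscale_add_right scaleR_L2_cscale cscale_cscale mult.commute)

lemma csubspace_L2_closure:
  assumes "csubspace_L2 X"
  shows "csubspace_L2 (closure X)"
  unfolding csubspace_L2_def
proof (intro conjI ballI allI)
  show "0 \<in> closure X" using assms closure_subset by (auto simp: csubspace_L2_def)
  fix x assume "x \<in> closure X"
  then obtain u where u: "\<And>n. u n \<in> X" "u \<longlonglongrightarrow> x" by (auto simp: closure_sequential)
  have "(\<lambda>n. cscale c (u n)) \<longlonglongrightarrow> cscale c x" for c
    by (rule bounded_linear.tendsto[OF bounded_linear_cscale u(2)])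
  moreover have "cscale c (u n) \<in> X" for c n using assms u(1) by (simp add: csubspace_L2_def)
  ultimately show "cscale c x \<in> closure X" for c
    unfolding closure_sequential by (intro exI[of _ "\<lambda>n. cscale c (u n)"] conjI allI)
  fix y assume "y \<in> closure X"
  then obtain v where v: "\<And>n. v n \<in> X" "v \<longlonglongrightarrow> y" by (auto simp: closure_sequential)
  have "(\<lambda>n. u n + v n) \<longlonglongrightarrow> x + y" by (intro tendsto_add u v)
  moreover have "u n + v n \<in> X" for n using assms u(1) v(1) by (simp add: csubspace_L2_def)
  ultimately show "x + y \<in> closure X"
    unfolding closure_sequential by (intro exI[of _ "\<lambda>n. u n + v n"] conjI allI)
qed

text \<open>The double annihilator of the monomials with index in I lies in their closed span. The
  residual x - p of the projection onto S has no coefficients in I, so x is orthogonal to it; as p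
  is too, x = p.\<close>

lemma orthogonal_induct_closed:
  assumes S: "closed S" "csubspace_L2 S" and mon: "\<And>n. n \<in> I \<Longrightarrow> L2_monom n \<in> S"
    and x: "\<And>m. (\<And>n. n \<in> I \<Longrightarrow> L2_fourier m n = 0) \<Longrightarrow> cinner x m = 0"
  shows "x \<in> S"
proof -
  obtain p where p: "p \<in> S" "\<And>y. y \<in> S \<Longrightarrow> cinner y (x - p) = 0"
    using closed_csubspace_projection[OF S] by metis
  have "L2_fourier (x - p) n = 0" if "n \<in> I" for n
    using p(2)[OF mon[OF that]] by (subst L2_fourier_cinner, subst cinner_commute) simp
  then have "cinner x (x - p) = 0" by (rule x)
  then have "cinner (x - p) (x - p) = 0" using p(2)[OF p(1)] by (simp add: cinner.diff_left)
  then show ?thesis using p(1) by (simp add: cinner_self)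
qed

text \<open>The ball of radius r of L^\<infinity>, seen inside \<open>L2\<close>. Stated through
  pairings it is visibly closed and convex in \<open>L2\<close>; \<open>L1_dual_ball_AE\<close>
  recovers the pointwise bound.\<close>

definition L1_dual_ball :: "real \<Rightarrow> L2 set" where
  "L1_dual_ball r = {c. \<forall>g. cmod (cinner c g) \<le> r * L1_norm g}"

lemma closed_L1_dual_ball: "closed (L1_dual_ball r)"
  unfolding L1_dual_ball_def
  by (intro closed_Collect_all closed_Collect_le continuous_intros
      bounded_linear.continuous_on[OF cinner.bounded_linear_left] continuous_on_id)

lemma convex_L1_dual_ball: "convex (L1_dual_ball r)"
proof (rule convexI)
  fix x y :: L2 and u v :: real
  assume xy: "x \<in> L1_dual_ball r" "y \<in> L1_dual_ball r" and uv: "0 \<le> u" "0 \<le> v" "u + v = 1"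
  have "cmod (cinner (u *\<^sub>R x + v *\<^sub>R y) g) \<le> r * L1_norm g" for g
  proof -
    have "cmod (cinner (u *\<^sub>R x + v *\<^sub>R y) g) \<le> u * cmod (cinner x g) + v * cmod (cinner y g)"
      using uv norm_triangle_ineq[of "u *\<^sub>R cinner x g" "v *\<^sub>R cinner y g"]
      by (simp add: cinner.add_left cinner.scaleR_left)
    also have "\<dots> \<le> u * (r * L1_norm g) + v * (r * L1_norm g)"
      using xy uv by (intro add_mono mult_left_mono) (auto simp: L1_dual_ball_def)
    also have "\<dots> = r * L1_norm g" using uv(3) by (simp flip: distrib_right)
    finally show ?thesis .
  qed
  then show "u *\<^sub>R x + v *\<^sub>R y \<in> L1_dual_ball r" by (simp add: L1_dual_ball_def)
qed

lemma L1_dual_ball_norm: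
  assumes "c \<in> L1_dual_ball r" "0 \<le> r"
  shows "norm c \<le> r"
proof -
  have "(norm c)\<^sup>2 = cmod (cinner c c)" by (simp add: cinner_self norm_power)
  also have "\<dots> \<le> r * L1_norm c" using assms(1) by (simp add: L1_dual_ball_def)
  also have "\<dots> \<le> r * norm c" using assms(2) L1_norm_le_norm by (rule mult_left_mono[rotated])
  finally have "norm c * norm c \<le> r * norm c" by (simp add: power2_eq_square)
  then show ?thesis using assms(2) by (cases "norm c = 0") (auto simp: mult_le_cancel_right)
qed

text \<open>The supremum of the pairing with g over the ball is attained at r times the sign of
  g.\<close>

lemma L1_dual_ball_sgn:
  assumes "0 \<le> r"
  obtains c where "c \<in> L1_dual_ball r" "cinner c g = r * L1_norm g"
proof -
  obtain f where f: "f \<in> sq_integrable" "g = abs_L2 f" by (rule L2_cases)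
  \<comment> \<open>At zeros of f the quotient is 0 by the convention on division by zero.\<close>
  define u where "u z = of_real r * (f z / of_real (cmod (f z)))" for z
  have [measurable]: "f \<in> borel_measurable circle" by (rule sq_integrable_measurable[OF f(1)])
  have um [measurable]: "u \<in> borel_measurable circle" unfolding u_def by measurable
  have ur: "cmod (u z) \<le> r" for z using assms by (simp add: u_def norm_mult norm_divide)
  have u: "u \<in> sq_integrable" by (rule sq_integrable_bounded[OF um, of r]) (simp add: ur)
  have "cmod (cinner (abs_L2 u) y) \<le> r * L1_norm y" for y
  proof (cases y rule: L2_cases)
    case (1 q)
    have int: "integrable circle (\<lambda>z. u z * cnj (q z))" by (rule sq_integrable_mult[OF u 1(1)])
    have "cmod (LINT z|circle. u z * cnj (q z)) \<le> (LINT z|circle. r * cmod (q z))"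
      by (rule Bochner_Integration.integral_norm_bound_integral)
        (use int 1 ur in \<open>auto intro!: integrable_norm sq_integrable_integrable mult_right_mono simp: norm_mult\<close>)
    then show ?thesis using 1 u by (simp add: cinner_abs L1_norm_abs)
  qed
  then have "abs_L2 u \<in> L1_dual_ball r" by (simp add: L1_dual_ball_def)
  moreover have "cinner (abs_L2 u) g = r * L1_norm g"
  proof -
    have "u z * cnj (f z) = of_real (r * cmod (f z))" for z
    proof (cases "f z = 0")
      case False
      have "u z * cnj (f z) = of_real r * (f z * cnj (f z)) / of_real (cmod (f z))" by (simp add: u_def)
      also have "\<dots> = of_real (r * cmod (f z))"
        using False by (simp add: complex_norm_square[symmetric] power2_eq_square)
      finally show ?thesis .
    qed (simp add: u_def)
    then have "cinner (abs_L2 u) g = (LINT z|circle. complex_of_real (r * cmod (f z)))"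
      by (simp only: f(2) cinner_abs[OF u f(1)])
    also have "\<dots> = of_real (LINT z|circle. r * cmod (f z))" by (rule integral_complex_of_real)
    finally show ?thesis using f by (simp add: L1_norm_abs)
  qed
  ultimately show ?thesis by (rule that)
qed

text \<open>Test against u, the sign of f cut off to the set where |f| > r. The integral of the
  nonnegative function (|f| - r) |u| is then at most 0, so that set is null.\<close>

lemma L1_dual_ball_AE:
  assumes c: "abs_L2 f \<in> L1_dual_ball r" and f: "f \<in> sq_integrable" and r: "0 \<le> r"
  shows "AE z in circle. cmod (f z) \<le> r"
proof -
  define u where "u z = (if r < cmod (f z) then f z / of_real (cmod (f z)) else 0)" for z
  have [measurable]: "f \<in> borel_measurable circle" by (rule sq_integrable_measurable[OF f])
  have um [measurable]: "u \<in> borel_measurable circle" unfolding u_def by measurable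
  have ur: "cmod (u z) \<le> 1" for z by (simp add: u_def norm_divide)
  have u: "u \<in> sq_integrable" by (rule sq_integrable_bounded[OF um, of 1]) (simp add: ur)
  have fu: "f z * cnj (u z) = of_real (cmod (f z) * cmod (u z))" for z
  proof (cases "r < cmod (f z)")
    case True
    then have "f z \<noteq> 0" using r by auto
    then show ?thesis using True
      by (simp add: u_def norm_divide complex_norm_square[symmetric] power2_eq_square)
  qed (simp add: u_def)
  have int: "integrable circle (\<lambda>z. cmod (f z) * cmod (u z))"
    using integrable_norm[OF sq_integrable_mult[OF f u]] by (simp add: norm_mult)
  have int': "integrable circle (\<lambda>z. r * cmod (u z))"
    by (intro integrable_mult_right integrable_norm sq_integrable_integrable u)
  define D where "D z = cmod (f z) * cmod (u z) - r * cmod (u z)" for z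
  have D: "0 \<le> D z" for z by (auto simp: D_def u_def norm_divide)
  have "cinner (abs_L2 f) (abs_L2 u) = of_real (LINT z|circle. cmod (f z) * cmod (u z))"
    by (simp only: cinner_abs[OF f u] fu integral_complex_of_real)
  then have "cmod (of_real (LINT z|circle. cmod (f z) * cmod (u z))) \<le> r * (LINT z|circle. cmod (u z))"
    using c u unfolding L1_dual_ball_def by (metis L1_norm_abs mem_Collect_eq)
  then have "(LINT z|circle. D z) \<le> 0"
    unfolding D_def using int int' by (simp add: abs_le_iff)
  then have "(LINT z|circle. D z) = 0"
    by (intro antisym Bochner_Integration.integral_nonneg D)
  moreover have "integrable circle D" unfolding D_def using int int' by simp
  ultimately have "AE z in circle. D z = 0"
    using integral_nonneg_eq_0_iff_AE[of circle D] D by simp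
  then show ?thesis
  proof eventually_elim
    case (elim z)
    show ?case
    proof (rule ccontr)
      assume "\<not> cmod (f z) \<le> r"
      moreover from this r have "cmod (u z) = 1" by (auto simp: u_def norm_divide)
      ultimately show False using elim by (simp add: D_def)
    qed
  qed
qed

text \<open>This replaces a Hahn--Banach argument: separation in the Hilbert space shows that \<open>x\<close> lies in
  the closure of \<open>L1_dual_ball r + M\<close>, where \<open>M\<close> is the annihilator of \<open>I\<close>, and nested closed
  convex sets remove the closure.\<close>

lemma L1_dual_extension:
  assumes r: "0 \<le> r"
    and x: "\<And>g. (\<And>m. (\<And>n. n \<in> I \<Longrightarrow> L2_fourier m n = 0) \<Longrightarrow> cinner g m = 0) \<Longrightarrow>
      cmod (cinner x g) \<le> r * L1_norm g"
  obtains c where "c \<in> L1_dual_ball r" "\<And>n. n \<in> I \<Longrightarrow> L2_fourier c n = L2_fourier x n"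
proof -
  let ?C = "L1_dual_ball r"
  define M where "M = {m. \<forall>n\<in>I. L2_fourier m n = 0}"
  have M: "csubspace_L2 M"
    by (simp add: csubspace_L2_def M_def L2_fourier_zero L2_fourier_add L2_fourier_cscale)
  define K where "K = closure (\<Union>c\<in>?C. \<Union>m\<in>M. {c + m})"
  have CM: "c + m \<in> K" if "c \<in> ?C" "m \<in> M" for c m
    unfolding K_def by (rule subsetD[OF closure_subset]) (use that in blast)
  have "0 \<in> M" using M by (simp add: csubspace_L2_def)
  have "closed K" by (simp add: K_def)
  have "convex K"
    unfolding K_def
    by (intro convex_closure convex_sums convex_L1_dual_ball subspace_imp_convex csubspace_L2_subspace M)
  have "0 \<in> ?C" using r by (simp add: L1_dual_ball_def cinner.zero_left L1_norm_nonneg)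
  then have "K \<noteq> {}" using CM[OF _ \<open>0 \<in> M\<close>] by blast
  with \<open>closed K\<close> \<open>convex K\<close> obtain p
    where p: "p \<in> K" "\<And>y. y \<in> K \<Longrightarrow> inner (x - p) (y - p) \<le> 0"
    by (metis closed_convex_projection)
  define g where "g = x - p"
  have gM: "inner g m = 0" if "m \<in> M" for m
  proof (rule ccontr)
    assume nz: "inner g m \<noteq> 0"
    \<comment> \<open>K contains the whole line through m, on which the pairing with g is bounded
      above by \<open>inner g p\<close>. This t makes it exceed that bound by 1.\<close>
    define t where "t = (inner g p + 1) / inner g m"
    have "0 + t *\<^sub>R m \<in> K"
      using M that by (intro CM \<open>0 \<in> ?C\<close>) (simp add: csubspace_L2_def scaleR_L2_cscale)
    from p(2)[OF this] have "t * inner g m \<le> inner g p" by (simp add: inner_diff_right flip: g_def)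
    then show False using nz by (simp add: t_def)
  qed
  have gM': "cinner g m = 0" if "m \<in> M" for m
  proof -
    have "cscale \<i> m \<in> M" using M that by (simp add: csubspace_L2_def)
    from gM[OF this] gM[OF that] show ?thesis
      by (simp add: inner_L2_def cinner_cscale_right complex_eq_iff)
  qed
  \<comment> \<open>A point of the ball where the pairing with g is maximal. Separation then gives r
    * \<open>L1_norm g\<close> \<le> \<open>inner g p\<close>, while the hypothesis on x bounds
    \<open>inner g p\<close> by r * \<open>L1_norm g\<close> - |g|^2; hence g = 0.\<close>
  obtain c0 where c0: "c0 \<in> ?C" "cinner c0 g = r * L1_norm g" by (rule L1_dual_ball_sgn[OF r])
  have "inner (x - p) ((c0 + 0) - p) \<le> 0"
    using M by (intro p(2) CM c0) (simp add: csubspace_L2_def)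
  then have "inner g c0 \<le> inner g p" by (simp add: inner_diff_right flip: g_def)
  moreover have "inner g c0 = r * L1_norm g"
    using c0(2) by (subst inner_commute) (simp add: inner_L2_def)
  moreover have "inner g p = inner x g - (norm g)\<^sup>2"
    by (simp add: g_def power2_norm_eq_inner inner_diff inner_commute)
  moreover have "inner x g \<le> r * L1_norm g"
  proof -
    have "cmod (cinner x g) \<le> r * L1_norm g" by (rule x, rule gM') (simp add: M_def)
    then show ?thesis using complex_Re_le_cmod[of "cinner x g"] by (simp add: inner_L2_def)
  qed
  ultimately have "(norm g)\<^sup>2 \<le> 0" by linarith
  then have "x \<in> K" using p(1) by (simp add: g_def)
  \<comment> \<open>Elements of M have no coefficients in I, so c + m close to x forces the
    coefficients of c in I to be close to those of x. A common point of all \<open>D n\<close>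
    matches them exactly.\<close>
  define D where "D n = ?C \<inter> {c. \<forall>k. k \<in> I \<longrightarrow> cmod (L2_fourier (x - c) k) \<le> 1 / Suc n}" for n
  have "(\<Inter>n. D n) \<noteq> {}"
  proof (rule closed_convex_nested_Inter_nonempty)
    show "closed (D n)" for n
      unfolding D_def
      by (intro closed_Int closed_L1_dual_ball closed_Collect_all closed_Collect_imp open_Collect_const
          closed_Collect_le continuous_intros continuous_on_id)
    show "convex (D n)" for n
    proof (rule convexI)
      fix c d :: L2 and u v :: real
      assume cd: "c \<in> D n" "d \<in> D n" and uv: "0 \<le> u" "0 \<le> v" "u + v = 1"
      have "u *\<^sub>R c + v *\<^sub>R d \<in> ?C"
        using cd uv convexD[OF convex_L1_dual_ball] by (simp add: D_def)
      moreover have "cmod (L2_fourier (x - (u *\<^sub>R c + v *\<^sub>R d)) k) \<le> 1 / Suc n" if "k \<in> I" for k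
      proof -
        have "x = u *\<^sub>R x + v *\<^sub>R x" using uv(3) by (simp flip: scaleR_left.add)
        then have "x - (u *\<^sub>R c + v *\<^sub>R d) = u *\<^sub>R (x - c) + v *\<^sub>R (x - d)"
          by (simp add: algebra_simps)
        then have "cmod (L2_fourier (x - (u *\<^sub>R c + v *\<^sub>R d)) k) \<le>
            u * cmod (L2_fourier (x - c) k) + v * cmod (L2_fourier (x - d) k)"
          using uv by (simp add: L2_fourier_add L2_fourier_cscale scaleR_L2_cscale norm_triangle_le norm_mult)
        also have "\<dots> \<le> u * (1 / Suc n) + v * (1 / Suc n)"
          using cd uv that by (intro add_mono mult_left_mono) (auto simp: D_def)
        also have "\<dots> = 1 / Suc n" using uv(3) by (simp flip: add_divide_distrib)
        finally show ?thesis .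
      qed
      ultimately show "u *\<^sub>R c + v *\<^sub>R d \<in> D n" by (simp add: D_def)
    qed
    show "D n \<noteq> {}" for n
    proof -
      have "0 < 1 / real (Suc n)" by simp
      with \<open>x \<in> K\<close> obtain c m where cm: "c \<in> ?C" "m \<in> M" "dist (c + m) x < 1 / Suc n"
        unfolding K_def closure_approachable by blast
      have "cmod (L2_fourier (x - c) k) \<le> 1 / Suc n" if "k \<in> I" for k
      proof -
        have "L2_fourier (x - c) k = L2_fourier (x - (c + m)) k"
          using cm(2) that by (simp add: L2_fourier_diff L2_fourier_add M_def)
        then show ?thesis
          using norm_L2_fourier_le[of "x - (c + m)" k] cm(3) by (simp add: dist_norm norm_minus_commute)
      qed
      then have "c \<in> D n" using cm(1) by (simp add: D_def)
      then show ?thesis by blast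
    qed
    show "decseq D"
    proof (intro decseq_SucI subsetI)
      fix n c assume "c \<in> D (Suc n)"
      moreover have "1 / real (Suc (Suc n)) \<le> 1 / real (Suc n)" by (simp add: field_simps)
      ultimately show "c \<in> D n" unfolding D_def by (auto intro: order_trans)
    qed
    show "bounded (D 0)"
      unfolding bounded_iff D_def using L1_dual_ball_norm r by blast
  qed
  then obtain c where "\<And>n. c \<in> D n" by blast
  then have c: "c \<in> ?C" "\<And>n k. k \<in> I \<Longrightarrow> cmod (L2_fourier (x - c) k) \<le> 1 / Suc n"
    by (auto simp: D_def)
  have "L2_fourier c k = L2_fourier x k" if "k \<in> I" for k
  proof -
    have "cmod (L2_fourier (x - c) k) \<le> 0"
      by (rule LIMSEQ_le_const[OF LIMSEQ_Suc[OF lim_1_over_n]]) (use c(2)[OF that] in auto)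
    then show ?thesis by (simp add: L2_fourier_diff)
  qed
  with c(1) show ?thesis by (rule that)
qed

section \<open>The approximating element of the Neil algebra\<close>

context uniformly_left_invertible
begin

text \<open>The index set {..<0} \<union> {1} is where the coefficients of the Neil algebra vanish.
  Its monomials lie in the space K of conjugates of k / z for polynomials k with k'(0) = 0. The
  inequality is a closed condition in \<open>L2\<close>, so it passes from K, where it is
  \<open>pairing_poly_le\<close>, to the closure.\<close>

lemma pairing_le:
  assumes g: "\<And>m. (\<And>n. n \<in> {..<0} \<union> {1} \<Longrightarrow> L2_fourier m n = 0) \<Longrightarrow> cinner g m = 0"
  shows "cmod (cinner (abs_L2 \<phi>) g) \<le> r * L1_norm g"
proof -
  define G where "G = {g. cmod (cinner (abs_L2 \<phi>) g) \<le> r * L1_norm g}"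
  define K where "K = {abs_L2 (\<lambda>z. z * cnj (poly p z)) |p. coeff p 1 = 0}"
  have sq: "(\<lambda>z. z * cnj (poly p z)) \<in> sq_integrable" for p
  proof -
    have "compact ((\<lambda>z. z * cnj (poly p z)) ` sphere 0 1)"
      by (intro compact_continuous_image continuous_intros) auto
    from compact_imp_bounded[OF this] obtain B
      where "\<forall>y\<in>(\<lambda>z. z * cnj (poly p z)) ` sphere 0 1. norm y \<le> B"
      unfolding bounded_iff ..
    then show ?thesis
      by (intro sq_integrable_bounded[of _ B] borel_measurable_circle_continuous AE_circleI continuous_intros) auto
  qed
  have "csubspace_L2 K"
    unfolding csubspace_L2_def
  proof (intro conjI ballI allI)
    show "0 \<in> K" unfolding K_def zero_L2_abs by (auto intro!: exI[of _ 0])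
    show "x + y \<in> K" if xy: "x \<in> K" "y \<in> K" for x y
    proof -
      obtain p q where "coeff p 1 = 0" "x = abs_L2 (\<lambda>z. z * cnj (poly p z))"
        "coeff q 1 = 0" "y = abs_L2 (\<lambda>z. z * cnj (poly q z))"
        using xy unfolding K_def by blast
      then show ?thesis
        unfolding K_def by (auto simp: add_abs sq distrib_left intro!: exI[of _ "p + q"])
    qed
    show "cscale c x \<in> K" if x: "x \<in> K" for c x
    proof -
      obtain p where "coeff p 1 = 0" "x = abs_L2 (\<lambda>z. z * cnj (poly p z))"
        using x unfolding K_def by blast
      then show ?thesis
        unfolding K_def by (auto simp: cscale_abs sq mult.left_commute intro!: exI[of _ "smult (cnj c) p"])
    qed
  qed
  then have "csubspace_L2 (closure K)" by (rule csubspace_L2_closure)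
  have mon: "L2_monom n \<in> closure K" if "n \<in> {..<0} \<union> {1}" for n
  proof -
    \<comment> \<open>On the circle z times the conjugate of z^j is z^(1 - j). The excluded exponent
      j = 1 corresponds to the index n = 0.\<close>
    define j where "j = nat (1 - n)"
    have j: "int j = 1 - n" "j \<noteq> 1" using that by (auto simp: j_def)
    have "L2_monom n = abs_L2 (\<lambda>z. z * cnj (poly (monom 1 j) z))"
      unfolding L2_monom_def
    proof (intro abs_L2_eqI sq sq_integrable_powi AE_circleI)
      fix z :: complex assume z: "cmod z = 1"
      then have "z \<noteq> 0" by auto
      have "cnj z ^ j = z powi (- int j)" using cnj_powi_circle[OF z, of "int j"] by simp
      then have "z * cnj (poly (monom 1 j) z) = z powi 1 * z powi (n - 1)"
        by (simp add: poly_monom j(1))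
      also have "\<dots> = z powi n" using \<open>z \<noteq> 0\<close> by (simp add: power_int_add[symmetric] del: power_int_1_right)
      finally show "z powi n = z * cnj (poly (monom 1 j) z)" by simp
    qed
    then have "L2_monom n \<in> K" using j(2) unfolding K_def by (auto intro!: exI[of _ "monom 1 j"])
    then show ?thesis using closure_subset by blast
  qed
  have "closed G"
    unfolding G_def
    by (intro closed_Collect_le continuous_intros continuous_on_L1_norm
        bounded_linear.continuous_on[OF cinner.bounded_linear_right] continuous_on_id)
  moreover have "K \<subseteq> G"
  proof
    fix y assume "y \<in> K"
    then obtain p where p: "coeff p 1 = 0" and y: "y = abs_L2 (\<lambda>z. z * cnj (poly p z))"
      unfolding K_def by blast
    have "cinner (abs_L2 \<phi>) y = (LINT z|circle. \<phi> z * (poly p z * cnj z))"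
      unfolding y cinner_abs[OF Linf_sq_integrable[OF \<phi>] sq]
      by (intro Bochner_Integration.integral_cong) (simp_all add: mult.commute)
    moreover have "L1_norm y = (LINT z|circle. cmod (poly p z))"
      unfolding y L1_norm_abs[OF sq]
      by (intro Bochner_Integration.integral_cong) (simp_all add: norm_mult)
    ultimately show "y \<in> G" using pairing_poly_le[OF p] by (simp add: G_def)
  qed
  ultimately have "closure K \<subseteq> G" by (intro closure_minimal)
  moreover have "g \<in> closure K"
    by (rule orthogonal_induct_closed[OF closed_closure \<open>csubspace_L2 (closure K)\<close> mon g])
  ultimately show ?thesis by (auto simp: G_def)
qed

text \<open>Duality gives c bounded by r with the same coefficients as \<phi> at the negative
  indices and at 1. Then \<psi> = \<phi> - c has none there, and its distance from \<phi> is the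
  size of c.\<close>

lemma neil_algebra_approx:
  obtains \<psi> where "\<psi> \<in> neil_algebra" "AE z in circle. cmod (\<phi> z - \<psi> z) \<le> r"
proof -
  obtain c where c: "c \<in> L1_dual_ball r"
    "\<And>n. n \<in> {..<0} \<union> {1} \<Longrightarrow> L2_fourier c n = L2_fourier (abs_L2 \<phi>) n"
    using L1_dual_extension[OF r(1) pairing_le] by blast
  obtain f where f: "f \<in> sq_integrable" "c = abs_L2 f" by (rule L2_cases)
  have AE: "AE z in circle. cmod (f z) \<le> r"
    using c(1) f by (intro L1_dual_ball_AE r) simp_all
  define \<psi> where "\<psi> z = \<phi> z - f z" for z
  have "\<phi> \<in> sq_integrable" by (rule Linf_sq_integrable[OF \<phi>])
  then have \<psi>sq: "\<psi> \<in> sq_integrable" unfolding \<psi>_def by (rule sq_integrable_diff[OF _ f(1)])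
  have "AE z in circle. cmod (\<psi> z) \<le> 1 + r"
    using AE unimod
  proof eventually_elim
    case (elim z)
    then show ?case unfolding \<psi>_def using norm_triangle_ineq4[of "\<phi> z" "f z"] by simp
  qed
  then have "\<psi> \<in> Linf" using sq_integrable_measurable[OF \<psi>sq] by (auto simp: Linf_iff)
  moreover have "fourier \<psi> n = 0" if "n \<in> {..<0} \<union> {1}" for n
  proof -
    have "abs_L2 \<psi> = abs_L2 \<phi> - c"
      unfolding f(2) \<psi>_def using \<open>\<phi> \<in> sq_integrable\<close> f(1) by (simp add: diff_abs)
    then show ?thesis using c(2)[OF that] by (simp add: L2_fourier_diff flip: L2_fourier_abs[OF \<psi>sq])
  qed
  ultimately have "\<psi> \<in> neil_algebra" by (simp add: neil_algebra_iff Hinf_def)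
  then show ?thesis by (rule that) (use AE in \<open>simp add: \<psi>_def\<close>)
qed

end

section \<open>The two equivalences\<close>

lemma Linf_dist_neil_algebra_less_1_iff:
  assumes "\<phi> \<in> Linf" "AE z in circle. cmod (\<phi> z) = 1"
  shows "Linf_dist \<phi> neil_algebra < 1 \<longleftrightarrow>
    (\<forall>\<alpha>\<in>B2. left_invertible_on (H2_sub \<alpha>) (toeplitz \<alpha> \<phi>))"
proof
  assume "Linf_dist \<phi> neil_algebra < 1"
  then obtain \<psi> r where "\<psi> \<in> neil_algebra" "0 \<le> r" "r < 1" "AE z in circle. cmod (\<phi> z - \<psi> z) \<le> r"
    by (rule Linf_dist_less_1D)
  then interpret unimodular_near_neil \<phi> \<psi> r by unfold_locales (use assms in auto)
  show "\<forall>\<alpha>\<in>B2. left_invertible_on (H2_sub \<alpha>) (toeplitz \<alpha> \<phi>)"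
    by (simp add: toeplitz_left_invertible)
next
  assume inv: "\<forall>\<alpha>\<in>B2. left_invertible_on (H2_sub \<alpha>) (toeplitz \<alpha> \<phi>)"
  obtain e where e: "0 < e"
    "\<And>\<alpha> x. \<alpha> \<in> B2 \<Longrightarrow> x \<in> H2_sub \<alpha> \<Longrightarrow> e * norm x \<le> norm (toeplitz \<alpha> \<phi> x)"
    using toeplitz_uniformly_bounded_below[OF assms] inv by blast
  \<comment> \<open>The radicand is cut off at 0 because \<open>e\<close> is known here only to be
    positive, not to be at most 1.\<close>
  define r where "r = sqrt (max 0 (1 - e\<^sup>2))"
  have r: "0 \<le> r" "1 - e\<^sup>2 \<le> r\<^sup>2" and "r < 1" using e(1) by (simp_all add: r_def)
  interpret uniformly_left_invertible \<phi> e r by unfold_locales (use assms e r in auto)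
  obtain \<psi> where \<psi>: "\<psi> \<in> neil_algebra" "AE z in circle. cmod (\<phi> z - \<psi> z) \<le> r"
    by (rule neil_algebra_approx)
  then have "\<psi> \<in> Linf" by (simp add: neil_algebra_iff Hinf_Linf)
  then show "Linf_dist \<phi> neil_algebra < 1"
    by (rule Linf_dist_less_1I[OF assms(1) _ \<psi>(1) \<open>r < 1\<close> \<psi>(2)])
qed

lemma invertible_imp_left_invertible: "invertible_on X T \<Longrightarrow> left_invertible_on X T"
  unfolding invertible_on_def left_invertible_on_def by blast

theorem theorem1p6:
  fixes \<phi> :: "complex \<Rightarrow> complex"
  assumes "\<phi> \<in> Linf"
    and "AE z in circle. cmod (\<phi> z) = 1"
  shows "(Linf_dist \<phi> neil_algebra < 1 \<longleftrightarrow>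
            (\<forall>\<alpha>\<in>B2. left_invertible_on (H2_sub \<alpha>) (toeplitz \<alpha> \<phi>)))
       \<and> (Linf_dist \<phi> neil_invertible < 1 \<longleftrightarrow>
            (\<forall>\<alpha>\<in>B2. invertible_on (H2_sub \<alpha>) (toeplitz \<alpha> \<phi>)))"
proof (intro conjI Linf_dist_neil_algebra_less_1_iff assms iffI ballI)
  fix \<alpha> assume "Linf_dist \<phi> neil_invertible < 1"
  then obtain \<psi> r where inv: "\<psi> \<in> neil_invertible" and "0 \<le> r" "r < 1" "AE z in circle. cmod (\<phi> z - \<psi> z) \<le> r"
    by (rule Linf_dist_less_1D)
  then interpret unimodular_near_neil \<phi> \<psi> r
    by unfold_locales (use assms in \<open>auto simp: neil_invertible_iff\<close>)
  show "invertible_on (H2_sub \<alpha>) (toeplitz \<alpha> \<phi>)" by (rule toeplitz_invertible[OF inv])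
next
  assume inv: "\<forall>\<alpha>\<in>B2. invertible_on (H2_sub \<alpha>) (toeplitz \<alpha> \<phi>)"
  \<comment> \<open>The first equivalence supplies some \<psi> in the Neil algebra near \<phi>;
    invertibility of T at (1, 0) shows that this same \<psi> is invertible in the algebra, with no
    new approximation.\<close>
  then have "Linf_dist \<phi> neil_algebra < 1"
    using invertible_imp_left_invertible by (simp add: Linf_dist_neil_algebra_less_1_iff[OF assms])
  then obtain \<psi> r where "\<psi> \<in> neil_algebra" "0 \<le> r" "r < 1" "AE z in circle. cmod (\<phi> z - \<psi> z) \<le> r"
    by (rule Linf_dist_less_1D)
  then interpret unimodular_near_neil \<phi> \<psi> r by unfold_locales (use assms in auto)
  have "(1, 0) \<in> B2" by (simp add: B2_def)
  then have "\<psi> \<in> neil_invertible" using inv neil_invertible_if_toeplitz_invertible by blast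
  then show "Linf_dist \<phi> neil_invertible < 1"
    by (rule Linf_dist_less_1I[OF assms(1) \<psi>_Linf _ r(2) near])
qed

end
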